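(* Let $k$ be an algebraically closed field, let $A$ and $B$ be directed monomial $k$-algebras with the same set of vertices and the same ordering on the vertices, and let $\Lambda=\Lambda(B,A^{\mathrm{op}})$ be their dual extension algebra. Then there is an exact sequence of Lie algebras $$0\to \mathcal J/\mathcal I\to \mathrm{HH}^1(\Lambda)\to\mathrm{HH}^1(B)\to 0.$$
   Context: Arrows are composed right to left: $\beta\alpha$ means first $\alpha$, then $\beta$. A monomial algebra is $kQ/I$ with $Q$ a finite quiver and $I$ an admissible ideal generated by a set $Z$ of paths of length at least two (no proper subpath of an element of $Z$ lying in $Z$). $kQ/I$ with $I$ admissible is directed if $Q$ is finite, acyclic, with vertices numbered so that every arrow $i\to j$ has $i<j$. Dual extension algebra: for $A=kQ_A/I_A$, $B=kQ_B/I_B$ with the same vertices, $\Lambda(B,A^{\mathrm{op}})=kQ_\Lambda/I_\Lambda$, where $Q_\Lambda$ has the same vertices, its arrows are the disjoint union of the arrows of $Q_B$ and of $Q_{A^{\mathrm{op}}}$ (reversed arrows of $Q_A$), and $I_\Lambda$ is generated by the relations of $B$, the relations of $A^{\mathrm{op}}$, and all composable products $\alpha\beta'$ (first $\beta'$, then $\alpha$) with $\alpha$ an arrow of $Q_B$ and $\beta'$ an arrow of $Q_{A^{\mathrm{op}}}$. It is again a monomial algebra. Combinatorial description of $\mathrm{HH}^1$: for a monomial algebra $M=kQ/\langle Z\rangle$, let $\mathcal B_M$ be the basis of paths having no subpath in $Z$. For a set $K$ of paths, $k(K/\!/\mathcal B_M)$ is the vector space with basis the pairs $p/\!/q$, $p\in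 K$, $q\in\mathcal B_M$ parallel to $p$. Define $\delta^0_M:k(Q_0/\!/\mathcal B_M)\to k(Q_1/\!/\mathcal B_M)$ by $e/\!/p\mapsto\sum_{s(a)=e,\,ap\in\mathcal B_M}a/\!/ap-\sum_{t(a)=e,\,pa\in\mathcal B_M}a/\!/pa$, and $\delta^1_M:k(Q_1/\!/\mathcal B_M)\to k(Z/\!/\mathcal B_M)$ by $a/\!/p\mapsto\sum_{r\in Z}r/\!/r^{a/\!/p}$, where $r^{a/\!/p}$ is the sum of all paths in $\mathcal B_M$ obtained from $r$ by replacing one occurrence of $a$ by $p$. Then $\mathrm{HH}^1(M)=\mathrm{Der}_k(M)/\mathrm{Inn}_k(M)$ is identified with $\mathrm{Ker}(\delta^1_M)/\mathrm{Im}(\delta^0_M)$ as a Lie algebra, with bracket $[a/\!/p,b/\!/q]=b/\!/q^{a/\!/p}-a/\!/p^{b/\!/q}$. These spaces are graded by letting $a/\!/p$ have degree the length of $p$. Definition of $\mathcal J$ and $\mathcal I$: let $\overline{\mathcal B}_\Lambda\subseteq\mathcal B_\Lambda$ be the set of paths $q_n\cdots q_1p_m\cdots p_1$ in $\mathcal B_\Lambda$, $n,m\ge1$, with $p_j$ arrows of $Q_B$ and $q_i$ arrows of $Q_{A^{\mathrm{op}}}$. Put $\mathcal J'=\mathrm{Ker}(\delta^1_\Lambda)\cap k((Q_B)_1/\!/\overline{\mathcal B}_\Lambda)$, and let $\mathrm{Ker}(\delta^1_{\Lambda|B})$ be the set of elements of $\mathrm{Ker}(\delta^1_\Lambda)$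 involving only $a/\!/p$ with $a$ not an arrow of $Q_B$. Then $\mathcal J=\mathcal J'\oplus\mathrm{Ker}(\delta^1_{\Lambda|B})$, which is a Lie ideal of $\mathrm{Ker}(\delta^1_\Lambda)$, and $\mathcal I=\mathrm{Im}(\delta^0_\Lambda)_{|_{\ge2}}$ is the part of $\mathrm{Im}(\delta^0_\Lambda)$ of degree at least $2$.
   Formalization: Added assumption: each arrow of Q_A joins vertices in the same connected component of Q_B (automatic if B is connected); without it the sequence fails, e.g. Q_B two vertices without arrows and Q_A one arrow, where HH^1(Λ)=0 but J/I is one-dimensional. *)

theory Defs
  imports
    "HOL-Algebra.QuotRing"
    "HOL-Algebra.Module"
    "HOL-Computational_Algebra.Polynomial"
    "HOL-Library.Poly_Mapping"
    "HOL-Library.Sublist"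
    "Graph_Theory.Arc_Walk"
begin

section \<open>Lie algebras\<close>

text \<open>The scalars are the elements of a type of class \<open>field\<close>; the Lie algebra itself lives on
  an explicit carrier, so that subspaces and quotients are again of this form.\<close>

record ('k, 'l) lie_struct = "'l partial_object" +
  lzero :: 'l
  ladd :: "'l \<Rightarrow> 'l \<Rightarrow> 'l"
  lscale :: "'k \<Rightarrow> 'l \<Rightarrow> 'l"
  lbracket :: "'l \<Rightarrow> 'l \<Rightarrow> 'l"

locale lie_algebra =
  fixes L :: "('k::field, 'l) lie_struct"
  assumes zero_closed: "lzero L \<in> carrier L"
    and add_closed: "\<lbrakk>x \<in> carrier L; y \<in> carrier L\<rbrakk> \<Longrightarrow> ladd L x y \<in> carrier L"
    and scale_closed: "x \<in> carrier L \<Longrightarrow> lscale L c x \<in> carrier L"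
    and bracket_closed: "\<lbrakk>x \<in> carrier L; y \<in> carrier L\<rbrakk> \<Longrightarrow> lbracket L x y \<in> carrier L"
    and add_assoc: "\<lbrakk>x \<in> carrier L; y \<in> carrier L; z \<in> carrier L\<rbrakk>
          \<Longrightarrow> ladd L (ladd L x y) z = ladd L x (ladd L y z)"
    and add_commute: "\<lbrakk>x \<in> carrier L; y \<in> carrier L\<rbrakk> \<Longrightarrow> ladd L x y = ladd L y x"
    and add_zero: "x \<in> carrier L \<Longrightarrow> ladd L (lzero L) x = x"
    and add_inverse: "x \<in> carrier L \<Longrightarrow> \<exists>y\<in>carrier L. ladd L x y = lzero L"
    and scale_one: "x \<in> carrier L \<Longrightarrow> lscale L 1 x = x"
    and scale_scale: "x \<in> carrier L \<Longrightarrow> lscale L c (lscale L d x) = lscale L (c * d) x"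
    and scale_add_left: "x \<in> carrier L
          \<Longrightarrow> lscale L (c + d) x = ladd L (lscale L c x) (lscale L d x)"
    and scale_add_right: "\<lbrakk>x \<in> carrier L; y \<in> carrier L\<rbrakk>
          \<Longrightarrow> lscale L c (ladd L x y) = ladd L (lscale L c x) (lscale L c y)"
    and bracket_add_left: "\<lbrakk>x \<in> carrier L; y \<in> carrier L; z \<in> carrier L\<rbrakk>
          \<Longrightarrow> lbracket L (ladd L x y) z = ladd L (lbracket L x z) (lbracket L y z)"
    and bracket_add_right: "\<lbrakk>x \<in> carrier L; y \<in> carrier L; z \<in> carrier L\<rbrakk>
          \<Longrightarrow> lbracket L x (ladd L y z) = ladd L (lbracket L x y) (lbracket L x z)"
    and bracket_scale_left: "\<lbrakk>x \<in> carrier L; y \<in> carrier L\<rbrakk>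
          \<Longrightarrow> lbracket L (lscale L c x) y = lscale L c (lbracket L x y)"
    and bracket_scale_right: "\<lbrakk>x \<in> carrier L; y \<in> carrier L\<rbrakk>
          \<Longrightarrow> lbracket L x (lscale L c y) = lscale L c (lbracket L x y)"
    and bracket_self: "x \<in> carrier L \<Longrightarrow> lbracket L x x = lzero L"
    and jacobi: "\<lbrakk>x \<in> carrier L; y \<in> carrier L; z \<in> carrier L\<rbrakk>
          \<Longrightarrow> ladd L (lbracket L x (lbracket L y z))
                (ladd L (lbracket L y (lbracket L z x)) (lbracket L z (lbracket L x y))) = lzero L"

definition lie_ideal :: "'l set \<Rightarrow> ('k::field, 'l) lie_struct \<Rightarrow> bool" where
  "lie_ideal I L \<longleftrightarrow> I \<subseteq> carrier L \<and> lzero L \<in> I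
     \<and> (\<forall>x\<in>I. \<forall>y\<in>I. ladd L x y \<in> I)
     \<and> (\<forall>c. \<forall>x\<in>I. lscale L c x \<in> I)
     \<and> (\<forall>x\<in>carrier L. \<forall>y\<in>I. lbracket L x y \<in> I)"

definition lie_coset :: "('k, 'l) lie_struct \<Rightarrow> 'l set \<Rightarrow> 'l \<Rightarrow> 'l set" where
  "lie_coset L I x = ladd L x ` I"

definition lie_quotient :: "('k, 'l) lie_struct \<Rightarrow> 'l set \<Rightarrow> ('k, 'l set) lie_struct" where
  "lie_quotient L I =
     \<lparr>carrier = lie_coset L I ` carrier L,
      lzero = lie_coset L I (lzero L),
      ladd = (\<lambda>X Y. \<Union>x\<in>X. \<Union>y\<in>Y. lie_coset L I (ladd L x y)),
      lscale = (\<lambda>c X. \<Union>x\<in>X. lie_coset L I (lscale L c x)),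
      lbracket = (\<lambda>X Y. \<Union>x\<in>X. \<Union>y\<in>Y. lie_coset L I (lbracket L x y))\<rparr>"

definition lie_hom :: "('k, 'l) lie_struct \<Rightarrow> ('k, 'm) lie_struct \<Rightarrow> ('l \<Rightarrow> 'm) \<Rightarrow> bool" where
  "lie_hom L M f \<longleftrightarrow> f \<in> carrier L \<rightarrow> carrier M
     \<and> (\<forall>x\<in>carrier L. \<forall>y\<in>carrier L. f (ladd L x y) = ladd M (f x) (f y))
     \<and> (\<forall>c. \<forall>x\<in>carrier L. f (lscale L c x) = lscale M c (f x))
     \<and> (\<forall>x\<in>carrier L. \<forall>y\<in>carrier L. f (lbracket L x y) = lbracket M (f x) (f y))"

definition lie_short_exact ::
  "('k::field, 'l) lie_struct \<Rightarrow> ('l \<Rightarrow> 'm) \<Rightarrow> ('k, 'm) lie_struct \<Rightarrow> ('m \<Rightarrow> 'n)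
     \<Rightarrow> ('k, 'n) lie_struct \<Rightarrow> bool" where
  "lie_short_exact L f M g N \<longleftrightarrow>
     lie_algebra L \<and> lie_algebra M \<and> lie_algebra N \<and> lie_hom L M f \<and> lie_hom M N g
     \<and> inj_on f (carrier L)
     \<and> f ` carrier L = {x \<in> carrier M. g x = lzero N}
     \<and> g ` carrier M = carrier N"


section \<open>The first Hochschild cohomology of an algebra\<close>

text \<open>An associative algebra is given by the \<open>module\<close> record of \<open>HOL-Algebra\<close>, which has
  both the ring operations and a scalar multiplication.  Derivations are required to be
  \<open>extensional\<close>, so that each is determined by its values on the carrier.\<close>

definition derivations :: "('k, 'm) module \<Rightarrow> ('m \<Rightarrow> 'm) set" where
  "derivations M = {D \<in> carrier M \<rightarrow>\<^sub>E carrier M.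
     (\<forall>x\<in>carrier M. \<forall>y\<in>carrier M. D (x \<oplus>\<^bsub>M\<^esub> y) = D x \<oplus>\<^bsub>M\<^esub> D y)
     \<and> (\<forall>c. \<forall>x\<in>carrier M. D (c \<odot>\<^bsub>M\<^esub> x) = c \<odot>\<^bsub>M\<^esub> D x)
     \<and> (\<forall>x\<in>carrier M. \<forall>y\<in>carrier M.
           D (x \<otimes>\<^bsub>M\<^esub> y) = (D x \<otimes>\<^bsub>M\<^esub> y) \<oplus>\<^bsub>M\<^esub> (x \<otimes>\<^bsub>M\<^esub> D y))}"

definition Der :: "('k, 'm) module \<Rightarrow> ('k, 'm \<Rightarrow> 'm) lie_struct" where
  "Der M =
     \<lparr>carrier = derivations M,
      lzero = (\<lambda>x\<in>carrier M. \<zero>\<^bsub>M\<^esub>),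
      ladd = (\<lambda>D E. \<lambda>x\<in>carrier M. D x \<oplus>\<^bsub>M\<^esub> E x),
      lscale = (\<lambda>c D. \<lambda>x\<in>carrier M. c \<odot>\<^bsub>M\<^esub> D x),
      lbracket = (\<lambda>D E. \<lambda>x\<in>carrier M. D (E x) \<ominus>\<^bsub>M\<^esub> E (D x))\<rparr>"

definition Inn :: "('k, 'm) module \<Rightarrow> ('m \<Rightarrow> 'm) set" where
  "Inn M = (\<lambda>m. \<lambda>x\<in>carrier M. (m \<otimes>\<^bsub>M\<^esub> x) \<ominus>\<^bsub>M\<^esub> (x \<otimes>\<^bsub>M\<^esub> m)) ` carrier M"

definition HH1 :: "('k, 'm) module \<Rightarrow> ('k, ('m \<Rightarrow> 'm) set) lie_struct" where
  "HH1 M = lie_quotient (Der M) (Inn M)"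


section \<open>Quivers, path algebras and monomial algebras\<close>

text \<open>A quiver is a \<open>pre_digraph\<close>.  A path is its source together with the list of its arrows
  \<^emph>\<open>in the order of traversal\<close>: since arrows are composed right to left, the path
  \<open>a\<^sub>n \<cdots> a\<^sub>1\<close> is represented by \<open>(tail a\<^sub>1, [a\<^sub>1, \<dots>, a\<^sub>n])\<close>, and the trivial
  path at \<open>v\<close> by \<open>(v, [])\<close>.\<close>

type_synonym ('v, 'a) path = "'v \<times> 'a list"

definition paths :: "('v, 'a) pre_digraph \<Rightarrow> ('v, 'a) path set" where
  "paths Q = {(u, xs). \<exists>w. pre_digraph.awalk Q u xs w}"

definition psource :: "('v, 'a) path \<Rightarrow> 'v" where
  "psource p = fst p"

definition ptarget :: "('v, 'a) pre_digraph \<Rightarrow> ('v, 'a) path \<Rightarrow> 'v" where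
  "ptarget Q p = pre_digraph.awlast Q (fst p) (snd p)"

text \<open>Vectors are finitely supported functions, \<open>single x 1\<close> being the basis vector \<open>x\<close>.\<close>

definition pm_scale :: "'k::field \<Rightarrow> ('x \<Rightarrow>\<^sub>0 'k) \<Rightarrow> ('x \<Rightarrow>\<^sub>0 'k)" where
  "pm_scale c f = Poly_Mapping.map ((*) c) f"

definition linear_extension :: "('x \<Rightarrow> ('y \<Rightarrow>\<^sub>0 'k::field)) \<Rightarrow> ('x \<Rightarrow>\<^sub>0 'k) \<Rightarrow> ('y \<Rightarrow>\<^sub>0 'k)" where
  "linear_extension h f = (\<Sum>x\<in>Poly_Mapping.keys f. pm_scale (Poly_Mapping.lookup f x) (h x))"

text \<open>The product of the path \<open>p\<close> with the path \<open>q\<close>: first \<open>q\<close>, then \<open>p\<close>.\<close>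

definition path_mult ::
  "('v, 'a) pre_digraph \<Rightarrow> ('v, 'a) path \<Rightarrow> ('v, 'a) path \<Rightarrow> (('v, 'a) path \<Rightarrow>\<^sub>0 'k::field)" where
  "path_mult Q p q =
     (if ptarget Q q = psource p then Poly_Mapping.single (psource q, snd q @ snd p) 1 else 0)"

definition path_algebra :: "('v, 'a) pre_digraph \<Rightarrow> ('k::field, ('v, 'a) path \<Rightarrow>\<^sub>0 'k) module" where
  "path_algebra Q =
     \<lparr>carrier = {f. Poly_Mapping.keys f \<subseteq> paths Q},
      monoid.mult = (\<lambda>f g. linear_extension (\<lambda>p. linear_extension (path_mult Q p) g) f),
      one = (\<Sum>v\<in>verts Q. Poly_Mapping.single (v, []) 1),
      zero = 0,
      add = (+),
      module.smult = pm_scale\<rparr>"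

definition quotient_algebra :: "('k, 'm) module \<Rightarrow> 'm set \<Rightarrow> ('k, 'm set) module" where
  "quotient_algebra M I = ring.extend (M Quot I)
     (module.fields (\<lambda>c X. \<Union>x\<in>X. I +>\<^bsub>M\<^esub> (c \<odot>\<^bsub>M\<^esub> x)))"

text \<open>A quiver with a set \<open>Z\<close> of paths; the members of \<open>Z\<close> have positive length, so they
  are given by their lists of arrows alone.\<close>

record ('v, 'a) path_presentation =
  quiver :: "('v, 'a) pre_digraph"
  rels :: "'a list set"

definition rel_path :: "('v, 'a) path_presentation \<Rightarrow> 'a list \<Rightarrow> ('v, 'a) path" where
  "rel_path P r = (tail (quiver P) (hd r), r)"

definition presented_algebra ::
  "('v, 'a) path_presentation \<Rightarrow> ('k::field, (('v, 'a) path \<Rightarrow>\<^sub>0 'k) set) module" where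
  "presented_algebra P = quotient_algebra (path_algebra (quiver P))
     (Idl\<^bsub>path_algebra (quiver P)\<^esub> {Poly_Mapping.single (rel_path P r) 1 |r. r \<in> rels P})"

text \<open>The last clause says that \<open>\<langle>Z\<rangle>\<close> contains a power of the arrow ideal, which together
  with \<open>2 \<le> length z\<close> is admissibility.\<close>

definition monomial_presentation :: "('v, 'a) path_presentation \<Rightarrow> bool" where
  "monomial_presentation P \<longleftrightarrow> fin_digraph (quiver P)
     \<and> (\<forall>z\<in>rels P. 2 \<le> length z \<and> rel_path P z \<in> paths (quiver P))
     \<and> (\<forall>z\<in>rels P. \<forall>z'\<in>rels P. sublist z' z \<longrightarrow> z' = z)
     \<and> (\<exists>N. \<forall>p\<in>paths (quiver P). N \<le> length (snd p) \<longrightarrow> (\<exists>z\<in>rels P. sublist z (snd p)))"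

text \<open>The numbering of the vertices is the order of the vertex type; the condition implies that
  the quiver is acyclic.\<close>

definition directed_monomial :: "('v::linorder, 'a) path_presentation \<Rightarrow> bool" where
  "directed_monomial P \<longleftrightarrow> monomial_presentation P
     \<and> (\<forall>a\<in>arcs (quiver P). tail (quiver P) a < head (quiver P) a)"

definition op_presentation :: "('v, 'a) path_presentation \<Rightarrow> ('v, 'a) path_presentation" where
  "op_presentation P =
     \<lparr>quiver = \<lparr>verts = verts (quiver P), arcs = arcs (quiver P),
                tail = head (quiver P), head = tail (quiver P)\<rparr>,
      rels = rev ` rels P\<rparr>"

text \<open>\<open>dual_extension B C\<close> is \<open>\<Lambda>(B, C)\<close>.  The last set of relations consists of the
  composable products \<open>b c\<close>, that is, first \<open>c\<close> and then \<open>b\<close>.\<close>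

definition dual_extension ::
  "('v, 'b) path_presentation \<Rightarrow> ('v, 'c) path_presentation \<Rightarrow> ('v, 'b + 'c) path_presentation" where
  "dual_extension B C =
     \<lparr>quiver = \<lparr>verts = verts (quiver B),
                arcs = Inl ` arcs (quiver B) \<union> Inr ` arcs (quiver C),
                tail = case_sum (tail (quiver B)) (tail (quiver C)),
                head = case_sum (head (quiver B)) (head (quiver C))\<rparr>,
      rels = map Inl ` rels B \<union> map Inr ` rels C
        \<union> {[Inr c, Inl b] |b c. b \<in> arcs (quiver B) \<and> c \<in> arcs (quiver C)
              \<and> head (quiver C) c = tail (quiver B) b}\<rparr>"


text \<open>Every arrow of \<open>Q\<^sub>A\<close> joins two vertices of one connected component of (the graph
  underlying) \<open>Q\<^sub>B\<close>; equivalently, \<open>Q\<^sub>\<Lambda>\<close> has the same connected components as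
  \<open>Q\<^sub>B\<close>.  This holds whenever the algebra \<open>B\<close> is connected.  The exact sequence fails
  without it: if \<open>Q\<^sub>B\<close> has two vertices and no arrow and \<open>Q\<^sub>A\<close> has a single arrow
  \<open>a\<close> between them, then \<open>HH\<^sup>1(\<Lambda>) = 0\<close>, but \<open>\<J>\<close> is spanned by \<open>a//a\<close> and
  \<open>\<I> = 0\<close>.\<close>

definition arrows_within_components ::
  "('v, 'a) path_presentation \<Rightarrow> ('v, 'b) path_presentation \<Rightarrow> bool" where
  "arrows_within_components A B \<longleftrightarrow> (\<forall>a\<in>arcs (quiver A).
     (tail (quiver A) a, head (quiver A) a)
       \<in> (arcs_ends (quiver B) \<union> (arcs_ends (quiver B))\<inverse>)\<^sup>*)"


section \<open>Parallel paths\<close>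

definition basis_paths :: "('v, 'a) path_presentation \<Rightarrow> ('v, 'a) path set" where
  "basis_paths P = {p \<in> paths (quiver P). \<not> (\<exists>z\<in>rels P. sublist z (snd p))}"

text \<open>\<open>k(K//S)\<close> for a set \<open>S\<close> of paths, where \<open>K\<close> is a set of vertices, of arrows or of
  relations; \<open>s\<close> and \<open>t\<close> give the source and the target of its members.\<close>

definition parallel_space ::
  "('v, 'a) path_presentation \<Rightarrow> ('x \<Rightarrow> 'v) \<Rightarrow> ('x \<Rightarrow> 'v) \<Rightarrow> 'x set \<Rightarrow> ('v, 'a) path set
     \<Rightarrow> ('x \<times> ('v, 'a) path \<Rightarrow>\<^sub>0 'k::field) set" where
  "parallel_space P s t K S = {f. Poly_Mapping.keys f \<subseteq>
     {(x, p). x \<in> K \<and> p \<in> S \<and> psource p = s x \<and> ptarget (quiver P) p = t x}}"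

abbreviation vertex_parallel where
  "vertex_parallel P \<equiv> parallel_space P id id (verts (quiver P)) (basis_paths P)"

abbreviation arrow_parallel where
  "arrow_parallel P \<equiv>
     parallel_space P (tail (quiver P)) (head (quiver P)) (arcs (quiver P)) (basis_paths P)"

text \<open>\<open>subst_sum P x q a p\<close> is \<open>x//q\<^sup>a\<^sup>/\<^sup>/\<^sup>p\<close>: the sum of the \<open>x//q'\<close> over all positions
  at which \<open>a\<close> occurs in \<open>q\<close>, where \<open>q'\<close> arises by putting \<open>p\<close> at that position
  and only the \<open>q'\<close> that are basis paths are counted.\<close>

definition subst_sum ::
  "('v, 'a) path_presentation \<Rightarrow> 'x \<Rightarrow> ('v, 'a) path \<Rightarrow> 'a \<Rightarrow> ('v, 'a) path
     \<Rightarrow> ('x \<times> ('v, 'a) path \<Rightarrow>\<^sub>0 'k::field)" where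
  "subst_sum P x q a p =
     (let q' = (\<lambda>i. (psource q, take i (snd q) @ snd p @ drop (Suc i) (snd q)))
      in \<Sum>i | i < length (snd q) \<and> snd q ! i = a \<and> q' i \<in> basis_paths P.
           Poly_Mapping.single (x, q' i) 1)"

definition delta0 ::
  "('v, 'a) path_presentation \<Rightarrow> ('v \<times> ('v, 'a) path \<Rightarrow>\<^sub>0 'k::field)
     \<Rightarrow> ('a \<times> ('v, 'a) path \<Rightarrow>\<^sub>0 'k)" where
  "delta0 P = linear_extension (\<lambda>(e, p).
     let ap = (\<lambda>a. (psource p, snd p @ [a])); pa = (\<lambda>a. (tail (quiver P) a, a # snd p))
     in (\<Sum>a | a \<in> arcs (quiver P) \<and> tail (quiver P) a = e \<and> ap a \<in> basis_paths P.
           Poly_Mapping.single (a, ap a) 1)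
      - (\<Sum>a | a \<in> arcs (quiver P) \<and> head (quiver P) a = e \<and> pa a \<in> basis_paths P.
           Poly_Mapping.single (a, pa a) 1))"

definition delta1 ::
  "('v, 'a) path_presentation \<Rightarrow> ('a \<times> ('v, 'a) path \<Rightarrow>\<^sub>0 'k::field)
     \<Rightarrow> ('a list \<times> ('v, 'a) path \<Rightarrow>\<^sub>0 'k)" where
  "delta1 P = linear_extension (\<lambda>(a, p). \<Sum>r\<in>rels P. subst_sum P r (rel_path P r) a p)"

definition ker_delta1 ::
  "('v, 'a) path_presentation \<Rightarrow> ('a \<times> ('v, 'a) path \<Rightarrow>\<^sub>0 'k::field) set" where
  "ker_delta1 P = {f \<in> arrow_parallel P. delta1 P f = 0}"

definition im_delta0 ::
  "('v, 'a) path_presentation \<Rightarrow> ('a \<times> ('v, 'a) path \<Rightarrow>\<^sub>0 'k::field) set" where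
  "im_delta0 P = delta0 P ` vertex_parallel P"

definition parallel_bracket ::
  "('v, 'a) path_presentation \<Rightarrow> ('a \<times> ('v, 'a) path \<Rightarrow>\<^sub>0 'k::field)
     \<Rightarrow> ('a \<times> ('v, 'a) path \<Rightarrow>\<^sub>0 'k) \<Rightarrow> ('a \<times> ('v, 'a) path \<Rightarrow>\<^sub>0 'k)" where
  "parallel_bracket P f g =
     linear_extension (\<lambda>(a, p). linear_extension (\<lambda>(b, q).
       subst_sum P b q a p - subst_sum P a p b q) g) f"


section \<open>The Lie algebra \<open>\<J>\<close> and its ideal \<open>\<I>\<close>\<close>

text \<open>In this section \<open>P\<close> is a dual extension \<open>\<Lambda>(B, A\<^sup>o\<^sup>p)\<close>, so the arrows of \<open>Q\<^sub>B\<close> are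
  those of the form \<open>Inl b\<close>.\<close>

definition mixed_paths :: "('v, 'b + 'c) path_presentation \<Rightarrow> ('v, 'b + 'c) path set" where
  "mixed_paths P =
     {(u, map Inl ps @ map Inr qs) |u ps qs. ps \<noteq> [] \<and> qs \<noteq> []} \<inter> basis_paths P"

definition J_mixed ::
  "('v, 'b + 'c) path_presentation \<Rightarrow> (('b + 'c) \<times> ('v, 'b + 'c) path \<Rightarrow>\<^sub>0 'k::field) set" where
  "J_mixed P = ker_delta1 P \<inter>
     parallel_space P (tail (quiver P)) (head (quiver P))
       {a \<in> arcs (quiver P). isl a} (mixed_paths P)"

definition ker_delta1_off_B ::
  "('v, 'b + 'c) path_presentation \<Rightarrow> (('b + 'c) \<times> ('v, 'b + 'c) path \<Rightarrow>\<^sub>0 'k::field) set" where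
  "ker_delta1_off_B P =
     {f \<in> ker_delta1 P. \<forall>(a, p)\<in>Poly_Mapping.keys f. \<not> isl a}"

definition J_lie ::
  "('v, 'b + 'c) path_presentation
     \<Rightarrow> ('k::field, ('b + 'c) \<times> ('v, 'b + 'c) path \<Rightarrow>\<^sub>0 'k) lie_struct" where
  "J_lie P =
     \<lparr>carrier = {f + g |f g. f \<in> J_mixed P \<and> g \<in> ker_delta1_off_B P},
      lzero = 0, ladd = (+), lscale = pm_scale, lbracket = parallel_bracket P\<rparr>"

definition I_ideal ::
  "('v, 'b + 'c) path_presentation \<Rightarrow> (('b + 'c) \<times> ('v, 'b + 'c) path \<Rightarrow>\<^sub>0 'k::field) set" where
  "I_ideal P = {f \<in> im_delta0 P. \<forall>(a, p)\<in>Poly_Mapping.keys f. 2 \<le> length (snd p)}"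

end

theory Submission
  imports Defs
begin

text \<open>Modulo inner derivations, a derivation of a monomial algebra \<open>M\<close> vanishes on the idempotents
  \<open>e\<^sub>v\<close>; such a derivation is given by its values on the arrows, that is, by an element of
  \<open>Ker(\<delta>\<^sup>1)\<close>, and it is inner exactly if this element lies in \<open>Im(\<delta>\<^sup>0)\<close>.  Hence
  \<open>HH\<^sup>1(M)\<close> is the quotient of \<open>Ker(\<delta>\<^sup>1)\<close> by \<open>Im(\<delta>\<^sup>0)\<close>, as a Lie algebra.

  For the dual extension, forgetting all pairs \<open>a//p\<close> except those in which \<open>a\<close> and \<open>p\<close> consist
  of arrows of \<open>B\<close> is a surjective homomorphism \<open>Ker(\<delta>\<^sup>1\<^sub>\<Lambda>) \<rightarrow> Ker(\<delta>\<^sup>1\<^sub>B)\<close> with kernel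
  \<open>\<J>\<close>, since paths of \<open>B\<close> ascend and paths of \<open>A\<^sup>o\<^sup>p\<close> descend.  It maps
  \<open>Im(\<delta>\<^sup>0\<^sub>\<Lambda>)\<close> onto \<open>Im(\<delta>\<^sup>0\<^sub>B)\<close>, so it remains to see that
  \<open>\<J> \<inter> Im(\<delta>\<^sup>0\<^sub>\<Lambda>) = \<I>\<close>.  The part of degree one of \<open>\<delta>\<^sup>0\<^sub>\<Lambda>\<close> sends
  \<open>\<Sum>\<^sub>v c\<^sub>v e\<^sub>v//e\<^sub>v\<close> to the sum of the \<open>(c\<^sub>s\<^sub>(\<^sub>a\<^sub>) - c\<^sub>t\<^sub>(\<^sub>a\<^sub>)) a//a\<close>; if its coefficients
  vanish on the arrows of \<open>B\<close>, then \<open>c\<close> is constant on the connected components of \<open>Q\<^sub>B\<close>, and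
  they vanish on the arrows of \<open>A\<^sup>o\<^sup>p\<close> as well.\<close>

section \<open>Finitely supported functions\<close>

text \<open>\<open>HH1\<close> is made of genuine derivations of a quotient whose elements are
  cosets. Computations take place on normal forms instead: vectors supported on
  \<open>basis_paths\<close>, multiplied in the path algebra and then truncated by
  \<open>nf\<close>. Being finitely supported functions, they allow every multilinear identity to be
  checked on single paths. An element of Ker acts by substituting paths for arrows. Before
  truncation this is a derivation of the whole path algebra; lying in Ker means that it maps each
  relation into the ideal of relations, so that it descends. The bracket is the commutator of the
  descended derivations, hence its closure and the Jacobi identity are inherited through
  injectivity, without computing double substitutions. For the dual extension the obstacle is that a
  substitution inside a forgotten term might create a term that is kept; directedness excludes this.
  Surjectivity onto the kernel of B holds because a path parallel to an arrow b of B starts with an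
  arrow of B: substituting it for b in a mixed relation leaves a mixed relation, so these relations
  impose no condition.\<close>

lemma lookup_pm_scale [simp]: "Poly_Mapping.lookup (pm_scale c f) x = c * Poly_Mapping.lookup f x"
  by (auto simp: pm_scale_def Poly_Mapping.map.rep_eq when_def)

lemma pm_scale_simps [simp]:
  "pm_scale c 0 = 0" "pm_scale 0 f = 0" "pm_scale 1 f = f"
  "pm_scale c (pm_scale d f) = pm_scale (c * d) f"
  by (auto intro!: poly_mapping_eqI simp: algebra_simps)

lemma pm_scale_add_right: "pm_scale c (f + g) = pm_scale c f + pm_scale c g"
  and pm_scale_diff_right: "pm_scale c (f - g) = pm_scale c f - pm_scale c g"
  and pm_scale_add_left: "pm_scale (c + d) f = pm_scale c f + pm_scale d f"
  and pm_scale_uminus_one: "pm_scale (- 1) f = - f"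
  by (auto intro!: poly_mapping_eqI simp: algebra_simps lookup_add lookup_minus)

lemma pm_scale_sum_right: "pm_scale c (sum f S) = (\<Sum>x\<in>S. pm_scale c (f x))"
  by (induction S rule: infinite_finite_induct) (auto simp: pm_scale_add_right)

lemma keys_pm_scale: "Poly_Mapping.keys (pm_scale c f) \<subseteq> Poly_Mapping.keys f"
  by (auto simp: in_keys_iff)

lemma keys_sum_subset:
  "Poly_Mapping.keys (\<Sum>x\<in>S. f x) \<subseteq> (\<Union>x\<in>S. Poly_Mapping.keys (f x))"
proof (induction S rule: infinite_finite_induct)
  case (insert x F)
  then show ?case using Poly_Mapping.keys_add[of "f x" "\<Sum>x\<in>F. f x"] by auto
qed auto

definition pm_linear :: "(('x \<Rightarrow>\<^sub>0 'k::field) \<Rightarrow> ('y \<Rightarrow>\<^sub>0 'k)) \<Rightarrow> bool" where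
  "pm_linear F \<longleftrightarrow> (\<forall>x y. F (x + y) = F x + F y) \<and> (\<forall>c x. F (pm_scale c x) = pm_scale c (F x))"

lemma pm_linearI:
  assumes "\<And>x y. F (x + y) = F x + F y" "\<And>c x. F (pm_scale c x) = pm_scale c (F x)"
  shows "pm_linear F"
  using assms by (simp add: pm_linear_def)

lemma pm_linear_add: "pm_linear F \<Longrightarrow> F (x + y) = F x + F y"
  and pm_linear_scale: "pm_linear F \<Longrightarrow> F (pm_scale c x) = pm_scale c (F x)"
  by (auto simp: pm_linear_def)

lemma pm_linear_zero: "pm_linear F \<Longrightarrow> F 0 = 0"
  using pm_linear_scale[of F 0 0] by simp

lemma pm_linear_uminus: "pm_linear F \<Longrightarrow> F (- x) = - F x"
  using pm_linear_scale[of F "- 1" x] by (simp add: pm_scale_uminus_one)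

lemma pm_linear_diff: "pm_linear F \<Longrightarrow> F (x - y) = F x - F y"
  using pm_linear_add[of F x "- y"] pm_linear_uminus[of F y] by simp

lemma pm_linear_sum: "pm_linear F \<Longrightarrow> F (sum f S) = (\<Sum>x\<in>S. F (f x))"
  by (induction S rule: infinite_finite_induct) (auto simp: pm_linear_add pm_linear_zero)

lemma pm_expand:
  "f = (\<Sum>x\<in>Poly_Mapping.keys f. pm_scale (Poly_Mapping.lookup f x) (Poly_Mapping.single x 1))"
  by (rule poly_mapping_eqI)
     (auto simp: lookup_sum lookup_single when_def in_keys_iff if_distrib cong: if_cong)

lemma pm_linear_eqI:
  assumes "pm_linear F" "pm_linear G"
    and "\<And>x. x \<in> Poly_Mapping.keys f \<Longrightarrow>
      F (Poly_Mapping.single x 1) = G (Poly_Mapping.single x 1)"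
  shows "F f = G f"
proof -
  let ?e = "\<lambda>x. pm_scale (Poly_Mapping.lookup f x) (Poly_Mapping.single x 1)"
  have "F (sum ?e (Poly_Mapping.keys f)) = G (sum ?e (Poly_Mapping.keys f))"
    using assms by (simp add: pm_linear_sum pm_linear_scale)
  then show ?thesis by (simp flip: pm_expand)
qed

text \<open>Over one finite set containing both supports, additivity of
  \<open>linear_extension\<close> becomes termwise.\<close>

lemma linear_extension_superset:
  assumes "finite S" "Poly_Mapping.keys f \<subseteq> S"
  shows "linear_extension h f = (\<Sum>x\<in>S. pm_scale (Poly_Mapping.lookup f x) (h x))"
  unfolding linear_extension_def
  by (rule sum.mono_neutral_left) (use assms in \<open>auto simp: in_keys_iff\<close>)

lemma pm_linear_linear_extension [intro]: "pm_linear (linear_extension h)"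
proof (rule pm_linearI)
  fix x y :: "'a \<Rightarrow>\<^sub>0 'b"
  let ?S = "Poly_Mapping.keys x \<union> Poly_Mapping.keys y"
  show "linear_extension h (x + y) = linear_extension h x + linear_extension h y"
    using Poly_Mapping.keys_add[of x y]
    by (simp add: linear_extension_superset[of ?S] lookup_add pm_scale_add_left sum.distrib)
next
  fix c and x :: "'a \<Rightarrow>\<^sub>0 'b"
  show "linear_extension h (pm_scale c x) = pm_scale c (linear_extension h x)"
    by (simp add: linear_extension_superset[OF finite_keys keys_pm_scale]
        linear_extension_def[of h x] pm_scale_sum_right)
qed

lemmas linear_extension_zero [simp] = pm_linear_zero[OF pm_linear_linear_extension]

lemma linear_extension_single [simp]: "linear_extension h (Poly_Mapping.single x 1) = h x"
  by (simp add: linear_extension_def)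

lemma keys_linear_extension:
  "Poly_Mapping.keys (linear_extension h f) \<subseteq> (\<Union>x\<in>Poly_Mapping.keys f. Poly_Mapping.keys (h x))"
  unfolding linear_extension_def using keys_pm_scale keys_sum_subset by fastforce

lemma pm_linear_compose:
  "pm_linear F \<Longrightarrow> pm_linear G \<Longrightarrow> pm_linear (\<lambda>x. F (G x))"
  by (simp add: pm_linear_def)

text \<open>Products and substitutions are nested linear extensions; this gives their linearity in
  the inner argument.\<close>

lemma pm_linear_coefficients:
  assumes "\<And>x. pm_linear (h x)"
  shows "pm_linear (\<lambda>g. linear_extension (\<lambda>x. h x g) f)"
  using assms
  by (intro pm_linearI)
     (simp_all add: linear_extension_def pm_linear_add pm_linear_scale pm_scale_add_right
       sum.distrib pm_scale_sum_right mult.commute)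

lemma pm_linear_plus:
  "pm_linear F \<Longrightarrow> pm_linear G \<Longrightarrow> pm_linear (\<lambda>x. F x + G x)"
  by (rule pm_linearI) (simp_all add: pm_linear_add pm_linear_scale pm_scale_add_right)

lemma pm_linear_minus:
  "pm_linear F \<Longrightarrow> pm_linear G \<Longrightarrow> pm_linear (\<lambda>x. F x - G x)"
  by (rule pm_linearI) (simp_all add: pm_linear_add pm_linear_scale pm_scale_diff_right)

lemma pm_linear_ident: "pm_linear (\<lambda>x. x)"
  and pm_linear_const_zero: "pm_linear (\<lambda>x. 0)"
  by (auto intro: pm_linearI)

text \<open>The carriers of the path algebra, of its normal forms and of all spaces of parallel
  pairs are coordinate subspaces of this one shape, so closure facts are proved once.\<close>

definition supported :: "'x set \<Rightarrow> ('x \<Rightarrow>\<^sub>0 'k::field) set" where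
  "supported S = {f. Poly_Mapping.keys f \<subseteq> S}"

lemma supported_iff: "f \<in> supported S \<longleftrightarrow> (\<forall>x. x \<notin> S \<longrightarrow> Poly_Mapping.lookup f x = 0)"
  by (auto simp: supported_def in_keys_iff)

lemma supported_closed:
  "0 \<in> supported S"
  "f \<in> supported S \<Longrightarrow> g \<in> supported S \<Longrightarrow> f + g \<in> supported S"
  "f \<in> supported S \<Longrightarrow> g \<in> supported S \<Longrightarrow> f - g \<in> supported S"
  "f \<in> supported S \<Longrightarrow> - f \<in> supported S"
  "f \<in> supported S \<Longrightarrow> pm_scale c f \<in> supported S"
  by (auto simp: supported_iff lookup_add lookup_minus)

lemma supported_sum: "(\<And>x. x \<in> T \<Longrightarrow> f x \<in> supported S) \<Longrightarrow> sum f T \<in> supported S"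
  by (induction T rule: infinite_finite_induct) (auto intro: supported_closed)

lemma supported_single: "x \<in> S \<Longrightarrow> Poly_Mapping.single x c \<in> supported S"
  by (simp add: supported_def)

lemma supported_linear_extension:
  assumes "f \<in> supported T" "\<And>x. x \<in> T \<Longrightarrow> h x \<in> supported S"
  shows "linear_extension h f \<in> supported S"
  using keys_linear_extension[of h f] assms unfolding supported_def by fastforce

lemma supported_linear_eqI:
  assumes "pm_linear F" "pm_linear G" "f \<in> supported S"
    and "\<And>x. x \<in> S \<Longrightarrow> F (Poly_Mapping.single x 1) = G (Poly_Mapping.single x 1)"
  shows "F f = G f"
  by (rule pm_linear_eqI) (use assms in \<open>auto simp: supported_def\<close>)

lemma supported_linear_mem:
  assumes "pm_linear F" "f \<in> supported T"
    and "\<And>x. x \<in> T \<Longrightarrow> F (Poly_Mapping.single x 1) \<in> supported S"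
  shows "F f \<in> supported S"
proof -
  have "F f = linear_extension (\<lambda>x. F (Poly_Mapping.single x 1)) f"
    by (rule pm_linear_eqI) (use assms in auto)
  with assms(2,3) show ?thesis by (simp add: supported_linear_extension)
qed


section \<open>Quotients and homomorphisms of Lie algebras\<close>

context lie_algebra begin

lemma add_zero_right: "x \<in> carrier L \<Longrightarrow> ladd L x (lzero L) = x"
  using add_commute add_zero zero_closed by metis

lemma add_left_cancel:
  assumes "x \<in> carrier L" "y \<in> carrier L" "z \<in> carrier L" "ladd L x y = ladd L x z"
  shows "y = z"
proof -
  obtain w where w: "w \<in> carrier L" "ladd L x w = lzero L" using add_inverse assms(1) by blast
  have "ladd L (ladd L w x) y = ladd L (ladd L w x) z"
    using assms w by (simp add: add_assoc)
  then show ?thesis using assms w by (simp add: add_commute[of w x] add_zero)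
qed

lemma scale_zero_left: "x \<in> carrier L \<Longrightarrow> lscale L 0 x = lzero L"
  using add_left_cancel[of "lscale L 0 x" "lscale L 0 x" "lzero L"] scale_add_left[of x 0 0]
  by (simp add: scale_closed zero_closed add_zero_right)

lemma add_neg: "x \<in> carrier L \<Longrightarrow> ladd L x (lscale L (- 1) x) = lzero L"
  using scale_add_left[of x 1 "- 1"] by (simp add: scale_zero_left scale_one)

text \<open>A \<open>lie_struct\<close> has no subtraction; here and below the difference of x and y
  is x + (-1) y.\<close>

lemma diff_eq_zero_iff:
  assumes "x \<in> carrier L" "y \<in> carrier L"
  shows "ladd L x (lscale L (- 1) y) = lzero L \<longleftrightarrow> x = y"
  using add_left_cancel[of "lscale L (- 1) y" x y] assms
  by (auto simp: scale_closed add_neg add_commute[of "lscale L (- 1) y"])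

lemma add_swap:
  assumes "x \<in> carrier L" "y \<in> carrier L" "z \<in> carrier L" "w \<in> carrier L"
  shows "ladd L (ladd L x y) (ladd L z w) = ladd L (ladd L x z) (ladd L y w)"
proof -
  have "ladd L y (ladd L z w) = ladd L z (ladd L y w)"
    using assms by (simp flip: add_assoc add: add_commute[of y z])
  then show ?thesis using assms by (simp add: add_assoc add_closed)
qed

lemma add_diff_cancel:
  assumes "x \<in> carrier L" "y \<in> carrier L"
  shows "ladd L y (ladd L x (lscale L (- 1) y)) = x"
proof -
  have "ladd L y (ladd L x (lscale L (- 1) y)) = ladd L x (ladd L y (lscale L (- 1) y))"
    using assms scale_closed by (metis add_assoc add_commute)
  then show ?thesis using assms by (simp add: add_neg add_zero_right)
qed

text \<open>Polarization: expand the bracket of x + y with itself.\<close>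

lemma bracket_skew:
  assumes "x \<in> carrier L" "y \<in> carrier L"
  shows "lbracket L x y = lscale L (- 1) (lbracket L y x)"
proof -
  let ?b = "lbracket L"
  have "ladd L (?b x y) (?b y x) = ?b (ladd L x y) (ladd L x y)"
    using assms bracket_self[of x] bracket_self[of y]
    by (simp add: bracket_add_left bracket_add_right bracket_closed add_closed add_zero
        add_zero_right zero_closed add_commute)
  also have "\<dots> = lzero L" using assms by (simp add: bracket_self add_closed)
  finally have "ladd L (?b y x) (?b x y) = ladd L (?b y x) (lscale L (- 1) (?b y x))"
    using assms by (simp add: add_commute bracket_closed add_neg)
  then show ?thesis using assms by (auto dest!: add_left_cancel[rotated 3] simp: bracket_closed scale_closed)
qed

lemma sub_lie_algebra:
  assumes "S \<subseteq> carrier L" "lzero L \<in> S"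
    and "\<And>x y. x \<in> S \<Longrightarrow> y \<in> S \<Longrightarrow> ladd L x y \<in> S"
    and "\<And>c x. x \<in> S \<Longrightarrow> lscale L c x \<in> S"
    and "\<And>x y. x \<in> S \<Longrightarrow> y \<in> S \<Longrightarrow> lbracket L x y \<in> S"
  shows "lie_algebra (L\<lparr>carrier := S\<rparr>)"
proof -
  have *: "x \<in> S \<Longrightarrow> x \<in> carrier L" for x using assms(1) by blast
  show ?thesis
  proof
    fix x assume "x \<in> carrier (L\<lparr>carrier := S\<rparr>)"
    then show "\<exists>y\<in>carrier (L\<lparr>carrier := S\<rparr>). ladd (L\<lparr>carrier := S\<rparr>) x y = lzero (L\<lparr>carrier := S\<rparr>)"
      using assms(4)[of x "- 1"] add_neg[of x] * by auto
  next
    fix x y assume "x \<in> carrier (L\<lparr>carrier := S\<rparr>)" "y \<in> carrier (L\<lparr>carrier := S\<rparr>)"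
    then show "ladd (L\<lparr>carrier := S\<rparr>) x y = ladd (L\<lparr>carrier := S\<rparr>) y x"
      using add_commute * by simp
  qed (use assms(2-5) in \<open>simp_all add: * scale_one scale_scale scale_add_left scale_add_right
      bracket_add_left bracket_add_right bracket_scale_left bracket_scale_right bracket_self
      add_zero add_assoc jacobi\<close>)
qed

lemma lie_hom_zero:
  assumes "lie_algebra M" "lie_hom L M f"
  shows "f (lzero L) = lzero M"
proof -
  interpret M: lie_algebra M by fact
  have z: "f (lzero L) \<in> carrier M" using assms(2) zero_closed by (auto simp: lie_hom_def)
  have "f (lzero L) = f (lscale L 0 (lzero L))" by (simp add: scale_zero_left zero_closed)
  also have "\<dots> = lscale M 0 (f (lzero L))" using assms(2) zero_closed by (simp add: lie_hom_def)
  finally show ?thesis using z by (simp add: M.scale_zero_left)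
qed

lemma lie_hom_diff_zero_iff:
  assumes "lie_algebra M" "lie_hom L M f" "x \<in> carrier L" "y \<in> carrier L"
  shows "f (ladd L x (lscale L (- 1) y)) = lzero M \<longleftrightarrow> f x = f y"
proof -
  interpret M: lie_algebra M by fact
  have "f x \<in> carrier M" "f y \<in> carrier M" using assms by (auto simp: lie_hom_def)
  then show ?thesis using assms scale_closed by (simp add: lie_hom_def M.diff_eq_zero_iff)
qed

end

text \<open>The laws are equations or ask for an inverse, so they pass along a surjection that
  respects the operations, even if nothing is known about \<open>H\<close> beforehand. This serves
  quotients, the derivations of an isomorphic algebra, and Ker(\<delta>1).\<close>

lemma lie_algebra_image:
  assumes "lie_algebra K" "lie_hom K H h" "h ` carrier K = carrier H" "h (lzero K) = lzero H"
  shows "lie_algebra H"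
proof -
  interpret K: lie_algebra K by fact
  have img: "x \<in> carrier H \<Longrightarrow> \<exists>x'\<in>carrier K. x = h x'" for x using assms(3) by auto
  have hom [simp]: "ladd H (h x) (h y) = h (ladd K x y)"
      "lscale H c (h x) = h (lscale K c x)" "lbracket H (h x) (h y) = h (lbracket K x y)"
      "h x \<in> carrier H"
    if "x \<in> carrier K" "y \<in> carrier K" for x y c
    using assms(2) that by (auto simp: lie_hom_def)
  note cl = K.add_closed K.scale_closed K.bracket_closed K.zero_closed
  show ?thesis
  proof
    fix x assume "x \<in> carrier H"
    then obtain x' where "x' \<in> carrier K" "x = h x'" using img by blast
    moreover from this obtain y' where "y' \<in> carrier K" "ladd K x' y' = lzero K" using K.add_inverse by blast
    ultimately show "\<exists>y\<in>carrier H. ladd H x y = lzero H"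
      by (intro bexI[of _ "h y'"]) (simp_all add: assms(4))
  next
    fix x y assume "x \<in> carrier H" "y \<in> carrier H"
    then obtain x' y' where "x' \<in> carrier K" "x = h x'" "y' \<in> carrier K" "y = h y'" using img by metis
    then show "ladd H x y = ladd H y x" by (simp add: K.add_commute[of x' y'])
  next
    show "lzero H \<in> carrier H" using hom(4)[OF K.zero_closed K.zero_closed] by (simp add: assms(4))
  qed (auto dest!: img simp: cl assms(4)[symmetric] K.add_zero K.scale_one K.scale_scale
      K.scale_add_left K.scale_add_right K.bracket_add_left K.bracket_add_right
      K.bracket_scale_left K.bracket_scale_right K.bracket_self K.jacobi K.add_assoc)
qed

section \<open>Quotients by Lie ideals\<close>

locale lie_ideal_in = lie_algebra +
  fixes I
  assumes lie_ideal: "lie_ideal I L"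
begin

lemma ideal_simps:
  "x \<in> I \<Longrightarrow> x \<in> carrier L" "lzero L \<in> I"
  "x \<in> I \<Longrightarrow> y \<in> I \<Longrightarrow> ladd L x y \<in> I" "x \<in> I \<Longrightarrow> lscale L c x \<in> I"
  "x \<in> carrier L \<Longrightarrow> y \<in> I \<Longrightarrow> lbracket L x y \<in> I"
  using lie_ideal by (auto simp: lie_ideal_def)

lemma ideal_bracket_left: "x \<in> carrier L \<Longrightarrow> y \<in> I \<Longrightarrow> lbracket L y x \<in> I"
  using bracket_skew[of y x] ideal_simps by simp

lemma lie_coset_add:
  assumes "x \<in> carrier L" "i \<in> I"
  shows "lie_coset L I (ladd L x i) = lie_coset L I x"
proof
  show "lie_coset L I (ladd L x i) \<subseteq> lie_coset L I x"
    using assms ideal_simps by (auto simp: lie_coset_def add_assoc)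
  show "lie_coset L I x \<subseteq> lie_coset L I (ladd L x i)"
  proof
    fix y assume "y \<in> lie_coset L I x"
    then obtain j where j: "j \<in> I" "y = ladd L x j" by (auto simp: lie_coset_def)
    let ?k = "ladd L j (lscale L (- 1) i)"
    have "y = ladd L (ladd L x i) ?k" "?k \<in> I"
      using j assms ideal_simps by (simp_all add: add_assoc add_diff_cancel add_closed scale_closed)
    then show "y \<in> lie_coset L I (ladd L x i)" by (auto simp: lie_coset_def)
  qed
qed

lemma mem_lie_coset:
  "x \<in> carrier L \<Longrightarrow> x \<in> lie_coset L I x"
  using ideal_simps(2) by (force simp: lie_coset_def add_zero_right)

lemma lie_coset_eq_iff:
  assumes "x \<in> carrier L" "y \<in> carrier L"
  shows "lie_coset L I x = lie_coset L I y \<longleftrightarrow> (\<exists>i\<in>I. x = ladd L y i)"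
proof
  assume "lie_coset L I x = lie_coset L I y"
  then show "\<exists>i\<in>I. x = ladd L y i"
    using mem_lie_coset[of x] assms by (auto simp: lie_coset_def[of L I y])
next
  assume "\<exists>i\<in>I. x = ladd L y i"
  then show "lie_coset L I x = lie_coset L I y" using lie_coset_add[of y] assms by auto
qed

lemma lie_coset_zero_iff:
  "x \<in> carrier L \<Longrightarrow> lie_coset L I x = lie_coset L I (lzero L) \<longleftrightarrow> x \<in> I"
  by (auto simp: lie_coset_eq_iff zero_closed add_zero ideal_simps)

text \<open>The operations of \<open>lie_quotient\<close> are unions over all representatives. All
  members of such a union are the same coset and \<open>I\<close> is nonempty, so the union is that
  coset.\<close>

lemma quotient_ops:
  assumes "x \<in> carrier L" "y \<in> carrier L"
  shows "ladd (lie_quotient L I) (lie_coset L I x) (lie_coset L I y) = lie_coset L I (ladd L x y)"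
    and "lscale (lie_quotient L I) c (lie_coset L I x) = lie_coset L I (lscale L c x)"
    and "lbracket (lie_quotient L I) (lie_coset L I x) (lie_coset L I y)
      = lie_coset L I (lbracket L x y)"
proof -
  note cl = add_closed scale_closed bracket_closed ideal_simps
  have ne: "I \<noteq> {}" using ideal_simps(2) by blast
  have "lie_coset L I (ladd L (ladd L x i) (ladd L y j)) = lie_coset L I (ladd L x y)"
    if "i \<in> I" "j \<in> I" for i j
  proof -
    have "ladd L (ladd L x i) (ladd L y j) = ladd L (ladd L x y) (ladd L i j)"
      using assms that ideal_simps(1) by (simp add: add_swap)
    then show ?thesis using assms that by (simp add: lie_coset_add cl)
  qed
  then show "ladd (lie_quotient L I) (lie_coset L I x) (lie_coset L I y) = lie_coset L I (ladd L x y)"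
    using ne by (simp add: lie_quotient_def) (simp add: lie_coset_def[of L I x] lie_coset_def[of L I y])
  have "lie_coset L I (lscale L c (ladd L x i)) = lie_coset L I (lscale L c x)" if "i \<in> I" for i
    using assms that by (simp add: scale_add_right lie_coset_add cl)
  then show "lscale (lie_quotient L I) c (lie_coset L I x) = lie_coset L I (lscale L c x)"
    using ne by (simp add: lie_quotient_def) (simp add: lie_coset_def[of L I x])
  have "lie_coset L I (lbracket L (ladd L x i) (ladd L y j)) = lie_coset L I (lbracket L x y)"
    if "i \<in> I" "j \<in> I" for i j
  proof -
    have "lbracket L (ladd L x i) (ladd L y j)
      = ladd L (ladd L (lbracket L x y) (lbracket L i y)) (lbracket L (ladd L x i) j)"
      using assms that by (simp add: bracket_add_left[of x i y] bracket_add_right cl)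
    then show ?thesis using assms that by (simp add: lie_coset_add cl ideal_bracket_left)
  qed
  then show "lbracket (lie_quotient L I) (lie_coset L I x) (lie_coset L I y)
      = lie_coset L I (lbracket L x y)"
    using ne by (simp add: lie_quotient_def) (simp add: lie_coset_def[of L I x] lie_coset_def[of L I y])
qed

lemma lie_hom_coset: "lie_hom L (lie_quotient L I) (lie_coset L I)"
  by (simp add: lie_hom_def quotient_ops) (auto simp: lie_quotient_def)

lemma carrier_quotient: "carrier (lie_quotient L I) = lie_coset L I ` carrier L"
  and lzero_quotient: "lzero (lie_quotient L I) = lie_coset L I (lzero L)"
  by (simp_all add: lie_quotient_def)

lemma lie_algebra_quotient: "lie_algebra (lie_quotient L I)"
  by (rule lie_algebra_image[OF lie_algebra_axioms lie_hom_coset])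
     (simp_all add: carrier_quotient lzero_quotient)

end

section \<open>Factorization of homomorphisms and short exact sequences\<close>

lemma lie_hom_compose: "lie_hom L M f \<Longrightarrow> lie_hom M N g \<Longrightarrow> lie_hom L N (\<lambda>x. g (f x))"
  by (auto simp: lie_hom_def Pi_iff)

lemma lie_hom_factor:
  assumes "lie_algebra K" "lie_hom K Q p" "p ` carrier K = carrier Q" "lie_hom K N g"
    and "\<And>x y. x \<in> carrier K \<Longrightarrow> y \<in> carrier K \<Longrightarrow> p x = p y \<Longrightarrow> g x = g y"
  obtains \<psi> where "lie_hom Q N \<psi>" "\<And>x. x \<in> carrier K \<Longrightarrow> \<psi> (p x) = g x"
proof -
  interpret K: lie_algebra K by fact
  \<comment> \<open>Any preimage would do: the last assumption makes the value independent of the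
    choice.\<close>
  define \<psi> where "\<psi> y = g (SOME x. x \<in> carrier K \<and> p x = y)" for y
  have \<psi>: "\<psi> (p x) = g x" if "x \<in> carrier K" for x
  proof -
    have "(SOME x'. x' \<in> carrier K \<and> p x' = p x) \<in> carrier K \<and> p (SOME x'. x' \<in> carrier K \<and> p x' = p x) = p x"
      by (rule someI[of _ x]) (use that in auto)
    then show ?thesis using assms(5) that unfolding \<psi>_def by blast
  qed
  have p: "p x \<in> carrier Q" "ladd Q (p x) (p y) = p (ladd K x y)" "lscale Q c (p x) = p (lscale K c x)"
    "lbracket Q (p x) (p y) = p (lbracket K x y)"
    if "x \<in> carrier K" "y \<in> carrier K" for x y c using assms(2) that by (auto simp: lie_hom_def)
  have g: "g x \<in> carrier N" "ladd N (g x) (g y) = g (ladd K x y)" "lscale N c (g x) = g (lscale K c x)"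
    "lbracket N (g x) (g y) = g (lbracket K x y)"
    if "x \<in> carrier K" "y \<in> carrier K" for x y c using assms(4) that by (auto simp: lie_hom_def)
  have "lie_hom Q N \<psi>"
    unfolding lie_hom_def assms(3)[symmetric]
    by (auto simp: p g \<psi> K.add_closed K.scale_closed K.bracket_closed)
  with \<psi> that show ?thesis by blast
qed

text \<open>Exactness is tested on one Lie algebra \<open>K\<close> mapping onto both outer terms,
  so that no coset occurs in the hypotheses. In the application \<open>K\<close> is Ker(\<delta>1)
  of \<Lambda>, \<open>h\<close> and \<open>g\<close> are its maps onto the cohomology of \<Lambda>
  and of B, and \<open>S\<close> is J. Condition \<open>hS\<close> yields injectivity,
  \<open>gS\<close> exactness in the middle, and \<open>hg\<close> lets \<open>g\<close> factor
  through \<open>h\<close>.\<close>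

lemma lie_short_exactI:
  assumes K: "lie_algebra K" and H: "lie_algebra H" and N: "lie_algebra N"
    and h: "lie_hom K H h" "h ` carrier K = carrier H"
    and g: "lie_hom K N g" "g ` carrier K = carrier N"
    and S: "S \<subseteq> carrier K" "lie_algebra (K\<lparr>carrier := S\<rparr>)"
    and I: "lie_ideal I (K\<lparr>carrier := S\<rparr>)"
    and hg: "\<And>x. x \<in> carrier K \<Longrightarrow> h x = lzero H \<Longrightarrow> g x = lzero N"
    and hS: "\<And>x. x \<in> S \<Longrightarrow> h x = lzero H \<longleftrightarrow> x \<in> I"
    and gS: "\<And>x. x \<in> carrier K \<Longrightarrow> g x = lzero N \<longleftrightarrow> (\<exists>j\<in>S. h x = h j)"
  shows "\<exists>\<phi> \<psi>. lie_short_exact (lie_quotient (K\<lparr>carrier := S\<rparr>) I) \<phi> H \<psi> N"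
proof -
  interpret K: lie_algebra K by fact
  let ?J = "K\<lparr>carrier := S\<rparr>"
  interpret J: lie_algebra ?J by fact
  interpret J: lie_ideal_in ?J I by unfold_locales fact
  have hJ: "lie_hom ?J H h" using h(1) S(1) by (auto simp: lie_hom_def subset_eq)
  have hdiff: "h x = h y \<Longrightarrow> g x = g y" if "x \<in> carrier K" "y \<in> carrier K" for x y
    using that K.lie_hom_diff_zero_iff[OF H h(1)] K.lie_hom_diff_zero_iff[OF N g(1)] hg
    by (metis K.add_closed K.scale_closed)
  obtain \<psi> where \<psi>: "lie_hom H N \<psi>" "\<And>x. x \<in> carrier K \<Longrightarrow> \<psi> (h x) = g x"
    using lie_hom_factor[OF K h g(1) hdiff] by blast
  \<comment> \<open>Both equalities say that the difference of x and y lies in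
    \<open>I\<close>.\<close>
  have SI: "h x = h y \<longleftrightarrow> lie_coset ?J I x = lie_coset ?J I y" if "x \<in> S" "y \<in> S" for x y
  proof -
    let ?d = "ladd K x (lscale K (- 1) y)"
    have d: "?d \<in> S" using that J.add_closed J.scale_closed by simp
    have "h x = h y \<longleftrightarrow> ?d \<in> I"
      using J.lie_hom_diff_zero_iff[OF H hJ, of x y] hS[OF d] that by simp
    also have "\<dots> \<longleftrightarrow> lie_coset ?J I x = lie_coset ?J I y"
      using J.lie_coset_zero_iff[of ?d] J.lie_hom_diff_zero_iff[OF J.lie_algebra_quotient J.lie_hom_coset, of x y] d that
      by (simp add: J.lzero_quotient)
    finally show ?thesis .
  qed
  obtain \<phi> where \<phi>: "lie_hom (lie_quotient ?J I) H \<phi>" "\<And>x. x \<in> S \<Longrightarrow> \<phi> (lie_coset ?J I x) = h x"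
    using lie_hom_factor[OF S(2) J.lie_hom_coset J.carrier_quotient[symmetric] hJ] SI by auto
  have "\<phi> ` carrier (lie_quotient ?J I) = h ` S" by (auto simp: J.carrier_quotient \<phi>(2) image_image)
  also have "\<dots> = {y \<in> carrier H. \<psi> y = lzero N}"
  proof -
    have "h x \<in> carrier H \<and> \<psi> (h x) = lzero N" if "x \<in> S" for x
      using that gS[of x] S(1) h(1) by (auto simp: \<psi>(2) subset_eq lie_hom_def)
    moreover have "y \<in> h ` S" if "y \<in> carrier H" "\<psi> y = lzero N" for y
    proof -
      obtain x where "x \<in> carrier K" "y = h x" using \<open>y \<in> carrier H\<close> h(2) by blast
      then show ?thesis using gS[of x] \<open>\<psi> y = lzero N\<close> by (auto simp: \<psi>(2))
    qed
    ultimately show ?thesis by blast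
  qed
  finally have "\<phi> ` carrier (lie_quotient ?J I) = {y \<in> carrier H. \<psi> y = lzero N}" .
  moreover have "inj_on \<phi> (carrier (lie_quotient ?J I))"
    by (auto simp: inj_on_def J.carrier_quotient \<phi>(2) SI)
  moreover have "\<psi> ` carrier H = carrier N"
    using h(2) g(2) \<psi>(2) by (metis (no_types, lifting) image_cong image_image)
  ultimately show ?thesis
    using \<phi>(1) \<psi>(1) J.lie_algebra_quotient H N unfolding lie_short_exact_def by blast
qed

section \<open>Derivations\<close>

text \<open>The path algebra has this form with \<open>S\<close> all paths, and the algebra of
  normal forms has it with \<open>S\<close> the basis paths.\<close>

definition lin_algebra ::
  "'x set \<Rightarrow> (('x \<Rightarrow>\<^sub>0 'k::field) \<Rightarrow> ('x \<Rightarrow>\<^sub>0 'k) \<Rightarrow> ('x \<Rightarrow>\<^sub>0 'k)) \<Rightarrow> ('x \<Rightarrow>\<^sub>0 'k)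
     \<Rightarrow> ('k, 'x \<Rightarrow>\<^sub>0 'k) module" where
  "lin_algebra S mul u =
     \<lparr>carrier = supported S, monoid.mult = mul, one = u, zero = 0, add = (+), module.smult = pm_scale\<rparr>"

lemma lin_algebra_simps [simp]:
  "carrier (lin_algebra S mul u) = supported S"
  "x \<otimes>\<^bsub>lin_algebra S mul u\<^esub> y = mul x y"
  "\<one>\<^bsub>lin_algebra S mul u\<^esub> = u"
  "\<zero>\<^bsub>lin_algebra S mul u\<^esub> = 0"
  "x \<oplus>\<^bsub>lin_algebra S mul u\<^esub> y = x + y"
  "c \<odot>\<^bsub>lin_algebra S mul u\<^esub> x = pm_scale c x"
  by (simp_all add: lin_algebra_def)

text \<open>No ring axioms are assumed of the target, so \<open>\<ominus>\<close> is evaluated from its definition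
  as a definite description.\<close>

lemma a_minus_image:
  assumes bij: "bij_betw \<rho> (supported S) (carrier M)"
    and add: "\<And>x y. x \<in> supported S \<Longrightarrow> y \<in> supported S \<Longrightarrow> \<rho> (x + y) = \<rho> x \<oplus>\<^bsub>M\<^esub> \<rho> y"
    and zero: "\<rho> 0 = \<zero>\<^bsub>M\<^esub>"
    and x: "x \<in> supported S" and y: "y \<in> supported S"
  shows "\<rho> x \<ominus>\<^bsub>M\<^esub> \<rho> y = \<rho> (x - y)"
proof -
  have inj: "z \<in> supported S \<Longrightarrow> w \<in> supported S \<Longrightarrow> \<rho> z = \<rho> w \<longleftrightarrow> z = w" for z w
    using bij by (meson bij_betw_def inj_on_eq_iff)
  have "\<ominus>\<^bsub>M\<^esub> \<rho> y = \<rho> (- y)"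
    unfolding a_inv_def m_inv_def
  proof (rule the_equality)
    show "\<rho> (- y) \<in> carrier (add_monoid M) \<and> \<rho> y \<otimes>\<^bsub>add_monoid M\<^esub> \<rho> (- y) = \<one>\<^bsub>add_monoid M\<^esub>
        \<and> \<rho> (- y) \<otimes>\<^bsub>add_monoid M\<^esub> \<rho> y = \<one>\<^bsub>add_monoid M\<^esub>"
      using bij y by (auto simp: supported_closed zero simp flip: add intro: bij_betwE[THEN bspec])
  next
    fix z assume z: "z \<in> carrier (add_monoid M) \<and> \<rho> y \<otimes>\<^bsub>add_monoid M\<^esub> z = \<one>\<^bsub>add_monoid M\<^esub>
        \<and> z \<otimes>\<^bsub>add_monoid M\<^esub> \<rho> y = \<one>\<^bsub>add_monoid M\<^esub>"
    then obtain w where w: "w \<in> supported S" "z = \<rho> w" using bij by (auto simp: bij_betw_def)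
    then have "\<rho> (y + w) = \<rho> 0" using z y by (simp add: add zero)
    then have "y + w = 0" using inj y w by (simp add: supported_closed)
    then show "z = \<rho> (- y)" using w by (simp add: add_eq_0_iff)
  qed
  then show ?thesis using x y by (simp add: a_minus_def supported_closed flip: add)
qed

lemma a_minus_lin_algebra:
  "x \<in> supported S \<Longrightarrow> y \<in> supported S \<Longrightarrow> x \<ominus>\<^bsub>lin_algebra S mul u\<^esub> y = x - y"
  using a_minus_image[of "\<lambda>x. x" S "lin_algebra S mul u" x y] by (simp add: bij_betw_def)

text \<open>Bilinearity is required of all vectors, so that identities may be checked on basis
  vectors; closure and associativity concern the subspace only.\<close>

locale lin_alg =
  fixes S :: "'x set" and mul :: "('x \<Rightarrow>\<^sub>0 'k::field) \<Rightarrow> ('x \<Rightarrow>\<^sub>0 'k) \<Rightarrow> ('x \<Rightarrow>\<^sub>0 'k)"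
    and u :: "'x \<Rightarrow>\<^sub>0 'k"
  assumes mul_closed: "x \<in> supported S \<Longrightarrow> y \<in> supported S \<Longrightarrow> mul x y \<in> supported S"
    and mul_left_linear: "pm_linear (\<lambda>x. mul x y)"
    and mul_right_linear: "pm_linear (mul x)"
    and mul_assoc: "\<lbrakk>x \<in> supported S; y \<in> supported S; z \<in> supported S\<rbrakk>
          \<Longrightarrow> mul (mul x y) z = mul x (mul y z)"
begin

abbreviation "alg \<equiv> lin_algebra S mul u"

lemmas mul_linear =
  mul_left_linear[THEN pm_linear_add] mul_left_linear[THEN pm_linear_diff]
  mul_left_linear[THEN pm_linear_scale] mul_left_linear[THEN pm_linear_zero]
  mul_left_linear[THEN pm_linear_uminus]
  mul_right_linear[THEN pm_linear_add] mul_right_linear[THEN pm_linear_diff]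
  mul_right_linear[THEN pm_linear_scale] mul_right_linear[THEN pm_linear_zero]
  mul_right_linear[THEN pm_linear_uminus]

section \<open>The Lie algebra of derivations and the ideal of inner ones\<close>

lemma derivation_iff:
  "D \<in> derivations alg \<longleftrightarrow> D \<in> supported S \<rightarrow>\<^sub>E supported S
     \<and> (\<forall>x\<in>supported S. \<forall>y\<in>supported S. D (x + y) = D x + D y)
     \<and> (\<forall>c. \<forall>x\<in>supported S. D (pm_scale c x) = pm_scale c (D x))
     \<and> (\<forall>x\<in>supported S. \<forall>y\<in>supported S. D (mul x y) = mul (D x) y + mul x (D y))"
  by (auto simp: derivations_def)

lemma derivationD:
  assumes "D \<in> derivations alg" "x \<in> supported S"
  shows "D x \<in> supported S" "D (pm_scale c x) = pm_scale c (D x)"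
    "y \<in> supported S \<Longrightarrow> D (x + y) = D x + D y"
    "y \<in> supported S \<Longrightarrow> D (mul x y) = mul (D x) y + mul x (D y)"
  using assms by (auto simp: derivation_iff)

lemma derivation_diff:
  assumes "D \<in> derivations alg" "x \<in> supported S" "y \<in> supported S"
  shows "D (x - y) = D x - D y"
proof -
  have "D (x + pm_scale (- 1) y) = D x + pm_scale (- 1) (D y)"
    using derivationD[OF assms(1)] assms(2,3) supported_closed by metis
  then show ?thesis by (simp add: pm_scale_uminus_one)
qed

lemma derivation_extensional: "D \<in> derivations alg \<Longrightarrow> D \<in> extensional (supported S)"
  by (simp add: derivation_iff PiE_iff)

lemma derivation_eqI:
  assumes "D \<in> derivations alg" "E \<in> derivations alg" "\<And>x. x \<in> supported S \<Longrightarrow> D x = E x"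
  shows "D = E"
  using assms(3) by (rule extensionalityI[OF assms(1,2)[THEN derivation_extensional]])

lemma Der_simps:
  "carrier (Der alg) = derivations alg"
  "lzero (Der alg) = (\<lambda>x\<in>supported S. 0)"
  "ladd (Der alg) D E = (\<lambda>x\<in>supported S. D x + E x)"
  "lscale (Der alg) c D = (\<lambda>x\<in>supported S. pm_scale c (D x))"
  by (simp_all add: Der_def)

lemma Der_bracket:
  assumes "D \<in> derivations alg" "E \<in> derivations alg"
  shows "lbracket (Der alg) D E = (\<lambda>x\<in>supported S. D (E x) - E (D x))"
  using assms by (auto simp: Der_def a_minus_lin_algebra derivationD intro!: restrict_ext)

lemma Der_zero: "(\<lambda>x\<in>supported S. 0) \<in> derivations alg"
  by (auto simp: derivation_iff supported_closed mul_closed mul_linear)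

lemma Der_closed:
  assumes "D \<in> derivations alg" "E \<in> derivations alg"
  shows "(\<lambda>x\<in>supported S. D x + E x) \<in> derivations alg"
    "(\<lambda>x\<in>supported S. pm_scale c (D x)) \<in> derivations alg"
    "(\<lambda>x\<in>supported S. D (E x) - E (D x)) \<in> derivations alg"
proof -
  note D = derivationD[OF assms(1)] derivationD[OF assms(2)]
    derivation_diff[OF assms(1)] derivation_diff[OF assms(2)]
  note s = supported_closed mul_closed mul_linear D pm_scale_add_right pm_scale_diff_right
  show "(\<lambda>x\<in>supported S. D x + E x) \<in> derivations alg"
    by (auto simp: derivation_iff s)
  show "(\<lambda>x\<in>supported S. pm_scale c (D x)) \<in> derivations alg"
    by (auto simp: derivation_iff s mult.commute)
  show "(\<lambda>x\<in>supported S. D (E x) - E (D x)) \<in> derivations alg"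
    by (auto simp: derivation_iff s)
qed

lemma lie_algebra_Der: "lie_algebra (Der alg)"
proof
  note s = Der_simps Der_bracket Der_closed derivationD derivation_diff supported_closed
    pm_scale_add_right pm_scale_diff_right pm_scale_add_left
  show "lzero (Der alg) \<in> carrier (Der alg)"
    by (simp add: Der_simps Der_zero)
  fix D E F c d
  assume D: "D \<in> carrier (Der alg)"
  then have D': "D \<in> derivations alg" by (simp add: Der_simps)
  show "\<exists>y\<in>carrier (Der alg). ladd (Der alg) D y = lzero (Der alg)"
  proof (rule bexI)
    show "lscale (Der alg) (- 1) D \<in> carrier (Der alg)" using D' by (simp add: Der_simps Der_closed)
    show "ladd (Der alg) D (lscale (Der alg) (- 1) D) = lzero (Der alg)"
      by (auto simp: Der_simps pm_scale_uminus_one intro!: restrict_ext)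
  qed
  have "(\<lambda>x\<in>supported S. D x) = D" using D' derivation_extensional extensional_restrict by blast
  moreover have "ladd (Der alg) (lzero (Der alg)) D = (\<lambda>x\<in>supported S. D x)"
    "lscale (Der alg) 1 D = (\<lambda>x\<in>supported S. D x)"
    by (auto simp: Der_simps intro!: restrict_ext)
  ultimately show "ladd (Der alg) (lzero (Der alg)) D = D" "lscale (Der alg) 1 D = D" by simp_all
  show "lscale (Der alg) c (lscale (Der alg) d D) = lscale (Der alg) (c * d) D"
    "lscale (Der alg) (c + d) D = ladd (Der alg) (lscale (Der alg) c D) (lscale (Der alg) d D)"
    "lbracket (Der alg) D D = lzero (Der alg)" "lscale (Der alg) c D \<in> carrier (Der alg)"
    using D' by (auto simp: s intro!: restrict_ext)
  assume "E \<in> carrier (Der alg)"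
  then have E': "E \<in> derivations alg" by (simp add: Der_simps)
  show "ladd (Der alg) D E \<in> carrier (Der alg)"
    "lbracket (Der alg) D E \<in> carrier (Der alg)"
    "ladd (Der alg) D E = ladd (Der alg) E D"
    "lscale (Der alg) c (ladd (Der alg) D E) = ladd (Der alg) (lscale (Der alg) c D) (lscale (Der alg) c E)"
    "lbracket (Der alg) (lscale (Der alg) c D) E = lscale (Der alg) c (lbracket (Der alg) D E)"
    "lbracket (Der alg) D (lscale (Der alg) c E) = lscale (Der alg) c (lbracket (Der alg) D E)"
    using D' E' by (auto simp: s add.commute intro!: restrict_ext)
  assume "F \<in> carrier (Der alg)"
  then have F': "F \<in> derivations alg" by (simp add: Der_simps)
  show "ladd (Der alg) (ladd (Der alg) D E) F = ladd (Der alg) D (ladd (Der alg) E F)"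
    "lbracket (Der alg) (ladd (Der alg) D E) F
      = ladd (Der alg) (lbracket (Der alg) D F) (lbracket (Der alg) E F)"
    "lbracket (Der alg) D (ladd (Der alg) E F)
      = ladd (Der alg) (lbracket (Der alg) D E) (lbracket (Der alg) D F)"
    "ladd (Der alg) (lbracket (Der alg) D (lbracket (Der alg) E F))
       (ladd (Der alg) (lbracket (Der alg) E (lbracket (Der alg) F D))
         (lbracket (Der alg) F (lbracket (Der alg) D E))) = lzero (Der alg)"
    using D' E' F' by (auto simp: s algebra_simps intro!: restrict_ext)
qed

definition inner :: "('x \<Rightarrow>\<^sub>0 'k) \<Rightarrow> ('x \<Rightarrow>\<^sub>0 'k) \<Rightarrow> ('x \<Rightarrow>\<^sub>0 'k)" where
  "inner m = (\<lambda>x\<in>supported S. mul m x - mul x m)"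

lemma Inn_eq: "Inn alg = inner ` supported S"
  unfolding Inn_def inner_def
  by (auto simp: a_minus_lin_algebra mul_closed intro!: image_cong restrict_ext)

lemma inner_derivation: "m \<in> supported S \<Longrightarrow> inner m \<in> derivations alg"
  by (auto simp: inner_def derivation_iff supported_closed mul_closed mul_linear
      pm_scale_diff_right mul_assoc)

lemma lie_ideal_Inn: "lie_ideal (Inn alg) (Der alg)"
  unfolding lie_ideal_def Inn_eq
proof (intro conjI allI ballI)
  show "inner ` supported S \<subseteq> carrier (Der alg)" by (auto simp: Der_simps inner_derivation)
  show "lzero (Der alg) \<in> inner ` supported S"
    by (rule image_eqI[of _ _ 0]) (auto simp: Der_simps inner_def mul_linear supported_closed)
  fix D assume "D \<in> inner ` supported S"
  then obtain m where m: "m \<in> supported S" "D = inner m" by blast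
  show "lscale (Der alg) c D \<in> inner ` supported S" for c
    by (rule image_eqI[of _ _ "pm_scale c m"])
      (auto simp: m Der_simps inner_def mul_linear supported_closed pm_scale_diff_right intro!: restrict_ext)
  show "ladd (Der alg) D E \<in> inner ` supported S" if E: "E \<in> inner ` supported S" for E
  proof -
    obtain n where n: "n \<in> supported S" "E = inner n" using E by blast
    show ?thesis
      by (rule image_eqI[of _ _ "m + n"])
        (auto simp: m n Der_simps inner_def mul_linear supported_closed intro!: restrict_ext)
  qed
  show "lbracket (Der alg) E D \<in> inner ` supported S" if E: "E \<in> carrier (Der alg)" for E
  proof -
    have E': "E \<in> derivations alg" using E by (simp add: Der_simps)
    \<comment> \<open>By the Leibniz rule, E(mx - xm) - (m E(x) - E(x) m) = E(m) x - x E(m).\<close>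
    have "lbracket (Der alg) E D = inner (E m)"
      unfolding m(2) Der_bracket[OF E' inner_derivation[OF m(1)]]
      using m(1) E' by (auto simp: inner_def derivationD derivation_diff mul_closed intro!: restrict_ext)
    then show ?thesis using m E' by (simp add: derivationD)
  qed
qed

text \<open>\<open>M\<close> is known only through the bijection \<open>\<rho>\<close>. Conjugation
  \<open>T\<close> by \<open>\<rho>\<close> carries derivations to derivations and inner ones to
  inner ones, and the Lie structure of \<open>Der M\<close> is obtained as an image under
  \<open>T\<close>. The conclusion gives a surjection with its kernel, the form in which
  \<open>lie_short_exactI\<close> takes its data.\<close>

lemma HH1_iso:
  fixes M :: "('k, 'm) module"
  assumes bij: "bij_betw \<rho> (supported S) (carrier M)"
    and add: "\<And>x y. x \<in> supported S \<Longrightarrow> y \<in> supported S \<Longrightarrow> \<rho> (x + y) = \<rho> x \<oplus>\<^bsub>M\<^esub> \<rho> y"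
    and mult: "\<And>x y. x \<in> supported S \<Longrightarrow> y \<in> supported S \<Longrightarrow> \<rho> (mul x y) = \<rho> x \<otimes>\<^bsub>M\<^esub> \<rho> y"
    and smult: "\<And>c x. x \<in> supported S \<Longrightarrow> \<rho> (pm_scale c x) = c \<odot>\<^bsub>M\<^esub> \<rho> x"
    and zero: "\<rho> 0 = \<zero>\<^bsub>M\<^esub>"
  obtains \<eta> where "lie_algebra (HH1 M)" "lie_hom (Der alg) (HH1 M) \<eta>"
    "\<eta> ` derivations alg = carrier (HH1 M)"
    "\<And>D. D \<in> derivations alg \<Longrightarrow> \<eta> D = lzero (HH1 M) \<longleftrightarrow> D \<in> Inn alg"
proof -
  interpret L: lie_algebra "Der alg" by (rule lie_algebra_Der)
  define \<tau> where "\<tau> = inv_into (supported S) \<rho>"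
  have \<tau>\<rho> [simp]: "x \<in> supported S \<Longrightarrow> \<tau> (\<rho> x) = x" for x
    using bij by (simp add: \<tau>_def bij_betw_def)
  have M: "carrier M = \<rho> ` supported S" using bij by (simp add: bij_betw_def)
  note ops = add[symmetric] mult[symmetric] smult[symmetric] zero[symmetric]
    a_minus_image[OF bij add zero]
  define T where "T D = (\<lambda>y\<in>carrier M. \<rho> (D (\<tau> y)))" for D
  have T: "T D (\<rho> x) = \<rho> (D x)" if "x \<in> supported S" for D x using that by (simp add: T_def M)
  have T_der: "T D \<in> derivations M" if "D \<in> derivations alg" for D
    using that unfolding derivations_def
    by (auto simp: M T ops supported_closed mul_closed derivationD[OF that])
       (auto simp: T_def M derivationD[OF that])
  have T_hom: "lie_hom (Der alg) (Der M) T"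
    unfolding lie_hom_def
    by (auto simp: Der_bracket Der_def T_der)
       (auto simp: T_def M ops derivationD a_minus_lin_algebra intro!: restrict_ext)
  have T_surj: "E \<in> T ` derivations alg" if E: "E \<in> derivations M" for E
  proof
    let ?D = "\<lambda>x\<in>supported S. \<tau> (E (\<rho> x))"
    have "E (\<rho> x) \<in> \<rho> ` supported S" if "x \<in> supported S" for x
      using E that by (auto simp: derivations_def M)
    then have \<rho>D: "\<rho> (?D x) = E (\<rho> x)" and D: "?D x \<in> supported S" if "x \<in> supported S" for x
      using that by (auto simp: f_inv_into_f \<tau>_def inv_into_into)
    have inj: "z = w" if "\<rho> z = \<rho> w" "z \<in> supported S" "w \<in> supported S" for z w
      using that \<tau>\<rho> by metis
    show "?D \<in> derivations alg"
      unfolding derivation_iff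
    proof (intro conjI ballI allI)
      show "?D \<in> supported S \<rightarrow>\<^sub>E supported S" using D by (simp add: Pi_iff PiE_def)
      fix x :: "'x \<Rightarrow>\<^sub>0 'k" assume x: "x \<in> supported S"
      show "?D (pm_scale c x) = pm_scale c (?D x)" for c :: 'k
        by (rule inj) (use x D E in \<open>simp_all add: \<rho>D smult supported_closed del: restrict_apply restrict_apply'\<close>,
          simp add: derivations_def M)
      fix y :: "'x \<Rightarrow>\<^sub>0 'k" assume y: "y \<in> supported S"
      show "?D (x + y) = ?D x + ?D y"
        by (rule inj) (use x y D E in \<open>simp_all add: \<rho>D add supported_closed del: restrict_apply restrict_apply'\<close>,
          simp add: derivations_def M)
      show "?D (mul x y) = mul (?D x) y + mul x (?D y)"
        by (rule inj) (use x y D E in \<open>simp_all add: \<rho>D add mult supported_closed mul_closed del: restrict_apply restrict_apply'\<close>,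
          simp add: derivations_def M)
    qed
    show "E = T ?D"
    proof (rule extensionalityI[of _ "carrier M"])
      show "E \<in> extensional (carrier M)" "T ?D \<in> extensional (carrier M)"
        using E by (simp_all add: T_def derivations_def PiE_iff)
      show "E y = T ?D y" if "y \<in> carrier M" for y
        using that \<rho>D by (auto simp: M T)
    qed
  qed
  have T_img: "T ` carrier (Der alg) = carrier (Der M)"
    using T_der T_surj by (auto simp: Der_def)
  have T_zero: "T (lzero (Der alg)) = lzero (Der M)"
    by (auto simp: Der_def T_def M zero intro!: restrict_ext)
  have T_inj: "D = E" if "D \<in> derivations alg" "E \<in> derivations alg" "T D = T E" for D E
  proof (rule derivation_eqI[OF that(1,2)])
    fix x :: "'x \<Rightarrow>\<^sub>0 'k" assume x: "x \<in> supported S"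
    then have "\<rho> (D x) = \<rho> (E x)" using that(3) T by metis
    then show "D x = E x" using \<tau>\<rho> derivationD(1) that(1,2) x by metis
  qed
  have T_Inn: "T ` Inn alg = Inn M"
  proof -
    have "T (inner m) = (\<lambda>x\<in>carrier M. \<rho> m \<otimes>\<^bsub>M\<^esub> x \<ominus>\<^bsub>M\<^esub> x \<otimes>\<^bsub>M\<^esub> \<rho> m)" if "m \<in> supported S" for m
      using that by (auto simp: T_def M inner_def ops mul_closed intro!: restrict_ext)
    then show ?thesis unfolding Inn_eq unfolding Inn_def M image_image by (auto intro!: image_cong)
  qed
  interpret M: lie_algebra "Der M"
    by (rule lie_algebra_image[where h = T, OF lie_algebra_Der T_hom T_img T_zero])
  have "lie_ideal (Inn M) (Der M)"
    unfolding lie_ideal_def T_Inn[symmetric] T_img[symmetric]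
  proof (intro conjI allI ballI)
    interpret I: lie_ideal_in "Der alg" "Inn alg" by unfold_locales (rule lie_ideal_Inn)
    have hom: "ladd (Der M) (T x) (T y) = T (ladd (Der alg) x y)"
      "lscale (Der M) c (T x) = T (lscale (Der alg) c x)"
      "lbracket (Der M) (T x) (T y) = T (lbracket (Der alg) x y)"
      if "x \<in> carrier (Der alg)" "y \<in> carrier (Der alg)" for x y c
      using T_hom that by (auto simp: lie_hom_def)
    show "T ` Inn alg \<subseteq> T ` carrier (Der alg)" using I.ideal_simps(1) by blast
    show "lzero (Der M) \<in> T ` Inn alg" using I.ideal_simps(2) T_zero by (metis imageI)
    show "ladd (Der M) x y \<in> T ` Inn alg" if "x \<in> T ` Inn alg" "y \<in> T ` Inn alg" for x y
      using that by (auto simp: hom I.ideal_simps)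
    show "lscale (Der M) c x \<in> T ` Inn alg" if "x \<in> T ` Inn alg" for x c
      using that I.ideal_simps by (auto simp: hom(2)[OF _ L.zero_closed])
    show "lbracket (Der M) x y \<in> T ` Inn alg" if "x \<in> T ` carrier (Der alg)" "y \<in> T ` Inn alg" for x y
      using that by (auto simp: hom I.ideal_simps)
  qed
  then interpret I: lie_ideal_in "Der M" "Inn M" by unfold_locales
  show thesis
  proof (rule that)
    show "lie_algebra (HH1 M)" unfolding HH1_def by (rule I.lie_algebra_quotient)
    show "lie_hom (Der alg) (HH1 M) (\<lambda>D. lie_coset (Der M) (Inn M) (T D))"
      unfolding HH1_def by (rule lie_hom_compose[OF T_hom I.lie_hom_coset])
    show "(\<lambda>D. lie_coset (Der M) (Inn M) (T D)) ` derivations alg = carrier (HH1 M)"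
      unfolding HH1_def I.carrier_quotient T_img[symmetric] by (auto simp: Der_simps)
    fix D assume D: "D \<in> derivations alg"
    then have "lie_coset (Der M) (Inn M) (T D) = lzero (HH1 M) \<longleftrightarrow> T D \<in> T ` Inn alg"
      unfolding HH1_def I.lzero_quotient T_Inn
      by (intro I.lie_coset_zero_iff) (simp add: T_der Der_def)
    also have "\<dots> \<longleftrightarrow> D \<in> Inn alg"
      using T_inj[OF D] inner_derivation by (auto simp: Inn_eq)
    finally show "lie_coset (Der M) (Inn M) (T D) = lzero (HH1 M) \<longleftrightarrow> D \<in> Inn alg" .
  qed
qed

end

section \<open>Multilinear identities on basis vectors\<close>

lemma pm_bilinear_eqI:
  assumes "\<And>y. pm_linear (\<lambda>x. F x y)" "\<And>x. pm_linear (F x)"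
    and "\<And>y. pm_linear (\<lambda>x. G x y)" "\<And>x. pm_linear (G x)"
    and "\<And>p q. p \<in> Poly_Mapping.keys x \<Longrightarrow> q \<in> Poly_Mapping.keys y \<Longrightarrow>
      F (Poly_Mapping.single p 1) (Poly_Mapping.single q 1) = G (Poly_Mapping.single p 1) (Poly_Mapping.single q 1)"
  shows "F x y = G x y"
  by (rule pm_linear_eqI[of "\<lambda>x. F x y" "\<lambda>x. G x y"])
    (use assms in \<open>auto intro: pm_linear_eqI[of "F _" "G _"]\<close>)

lemma pm_trilinear_eqI:
  assumes "\<And>y z. pm_linear (\<lambda>x. F x y z)" "\<And>x z. pm_linear (\<lambda>y. F x y z)" "\<And>x y. pm_linear (F x y)"
    and "\<And>y z. pm_linear (\<lambda>x. G x y z)" "\<And>x z. pm_linear (\<lambda>y. G x y z)" "\<And>x y. pm_linear (G x y)"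
    and "\<And>p q r. p \<in> Poly_Mapping.keys x \<Longrightarrow> q \<in> Poly_Mapping.keys y \<Longrightarrow> r \<in> Poly_Mapping.keys z \<Longrightarrow>
      F (Poly_Mapping.single p 1) (Poly_Mapping.single q 1) (Poly_Mapping.single r 1)
        = G (Poly_Mapping.single p 1) (Poly_Mapping.single q 1) (Poly_Mapping.single r 1)"
  shows "F x y z = G x y z"
  by (rule pm_linear_eqI[of "\<lambda>x. F x y z" "\<lambda>x. G x y z"])
    (use assms in \<open>auto intro: pm_bilinear_eqI[of "F _" "G _"]\<close>)

section \<open>Path algebras and their monomial quotients\<close>

lemma psource_Pair [simp]: "psource (u, xs) = u"
  by (simp add: psource_def)

lemma ptarget_Nil [simp]: "ptarget Q (u, []) = u"
  and ptarget_Cons [simp]: "ptarget Q (u, a # xs) = ptarget Q (head Q a, xs)"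
  by (simp_all add: ptarget_def pre_digraph.awalk_verts.simps pre_digraph.awalk_verts_non_Nil)

lemma ptarget_append [simp]: "ptarget Q (u, xs @ ys) = ptarget Q (ptarget Q (u, xs), ys)"
  by (induction xs arbitrary: u) simp_all

definition pmul ::
  "('v, 'a) pre_digraph \<Rightarrow> (('v, 'a) path \<Rightarrow>\<^sub>0 'k::field) \<Rightarrow> (('v, 'a) path \<Rightarrow>\<^sub>0 'k)
     \<Rightarrow> (('v, 'a) path \<Rightarrow>\<^sub>0 'k)" where
  "pmul Q f g = linear_extension (\<lambda>p. linear_extension (path_mult Q p) g) f"

lemma pmul_single [simp]:
  "pmul Q (Poly_Mapping.single p 1) (Poly_Mapping.single q 1) = path_mult Q p q"
  by (simp add: pmul_def)

lemma pm_linear_pmul_left: "pm_linear (\<lambda>f. pmul Q f g)"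
  and pm_linear_pmul_right: "pm_linear (pmul Q f)"
  unfolding pmul_def by (auto intro: pm_linear_coefficients)

lemmas pm_linear_intros =
  pm_linear_linear_extension pm_linear_coefficients pm_linear_plus pm_linear_minus
  pm_linear_ident pm_linear_const_zero pm_linear_pmul_left pm_linear_pmul_right
  pm_linear_compose[OF pm_linear_linear_extension]
  pm_linear_compose[OF pm_linear_pmul_left] pm_linear_compose[OF pm_linear_pmul_right]

lemmas pmul_linear =
  pm_linear_pmul_left[THEN pm_linear_add] pm_linear_pmul_left[THEN pm_linear_diff]
  pm_linear_pmul_left[THEN pm_linear_scale] pm_linear_pmul_left[THEN pm_linear_zero]
  pm_linear_pmul_left[THEN pm_linear_uminus] pm_linear_pmul_left[THEN pm_linear_sum]
  pm_linear_pmul_right[THEN pm_linear_add] pm_linear_pmul_right[THEN pm_linear_diff]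
  pm_linear_pmul_right[THEN pm_linear_scale] pm_linear_pmul_right[THEN pm_linear_zero]
  pm_linear_pmul_right[THEN pm_linear_uminus] pm_linear_pmul_right[THEN pm_linear_sum]

lemma pmul_assoc: "pmul Q (pmul Q x y) z = pmul Q x (pmul Q y z)"
  by (rule pm_trilinear_eqI[of "\<lambda>x y z. pmul Q (pmul Q x y) z" "\<lambda>x y z. pmul Q x (pmul Q y z)"])
    (auto intro!: pm_linear_intros simp: path_mult_def pmul_linear psource_def)

text \<open>Applied to partial relabellings under which each y has at most one admissible preimage,
  so the sum collapses to a single coefficient of \<open>f\<close>.\<close>

lemma lookup_linear_extension_partial:
  "Poly_Mapping.lookup (linear_extension (\<lambda>x. if C x then Poly_Mapping.single (g x) 1 else 0) f) y
    = (\<Sum>x\<in>Poly_Mapping.keys f. if C x \<and> g x = y then Poly_Mapping.lookup f x else 0)"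
  unfolding linear_extension_def lookup_sum by (intro sum.cong) (auto simp: lookup_single when_def)

text \<open>Reduction modulo the relations. Truncation suffices because an ideal generated by paths
  is spanned by the paths it contains.\<close>

definition nf :: "('v, 'a) path_presentation \<Rightarrow> (('v, 'a) path \<Rightarrow>\<^sub>0 'k::field) \<Rightarrow> (('v, 'a) path \<Rightarrow>\<^sub>0 'k)" where
  "nf P = linear_extension (\<lambda>p. if p \<in> basis_paths P then Poly_Mapping.single p 1 else 0)"

lemma pm_linear_nf: "pm_linear (nf P)"
  unfolding nf_def by (rule pm_linear_linear_extension)

lemmas nf_linear = pm_linear_nf[THEN pm_linear_add] pm_linear_nf[THEN pm_linear_diff]
  pm_linear_nf[THEN pm_linear_scale] pm_linear_nf[THEN pm_linear_zero]
  pm_linear_nf[THEN pm_linear_uminus] pm_linear_nf[THEN pm_linear_sum]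

lemma nf_single [simp]:
  "nf P (Poly_Mapping.single p 1) = (if p \<in> basis_paths P then Poly_Mapping.single p 1 else 0)"
  by (simp add: nf_def)

lemma lookup_nf:
  "Poly_Mapping.lookup (nf P f) p = (if p \<in> basis_paths P then Poly_Mapping.lookup f p else 0)"
proof -
  have "(q \<in> basis_paths P \<and> q = p) \<longleftrightarrow> (q = p \<and> p \<in> basis_paths P)" for q by auto
  then show ?thesis
    unfolding nf_def lookup_linear_extension_partial by (simp add: in_keys_iff)
qed

lemma nf_supported: "nf P f \<in> supported (basis_paths P)"
  by (simp add: supported_iff lookup_nf)

lemma nf_ident: "f \<in> supported (basis_paths P) \<Longrightarrow> nf P f = f"
  by (rule poly_mapping_eqI) (auto simp: supported_iff lookup_nf)

lemma nf_eq_zero_iff: "nf P f = 0 \<longleftrightarrow> f \<in> supported (- basis_paths P)"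
  by (auto simp: supported_iff poly_mapping_eq_iff fun_eq_iff lookup_nf)

lemma diff_nf: "f \<in> supported (paths (quiver P)) \<Longrightarrow> f - nf P f \<in> supported (paths (quiver P) - basis_paths P)"
  by (auto simp: supported_iff lookup_nf lookup_minus)

lemma basis_paths_subset: "basis_paths P \<subseteq> paths (quiver P)"
  by (auto simp: basis_paths_def)

lemma supported_mono: "S \<subseteq> T \<Longrightarrow> f \<in> supported S \<Longrightarrow> f \<in> supported T"
  by (auto simp: supported_iff)

lemmas supported_paths = supported_mono[OF basis_paths_subset]

section \<open>Paths under concatenation, and the path algebra as a ring\<close>

lemma paths_Nil: "(u, []) \<in> paths Q \<longleftrightarrow> u \<in> verts Q"
  by (auto simp: paths_def pre_digraph.awalk_def pre_digraph.cas.simps)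

context wf_digraph begin

lemma paths_Cons: "(u, a # xs) \<in> paths G \<longleftrightarrow> a \<in> arcs G \<and> u = tail G a \<and> (head G a, xs) \<in> paths G"
  by (auto simp: paths_def awalk_Cons_iff)

lemma paths_append: "(u, xs @ ys) \<in> paths G \<longleftrightarrow> (u, xs) \<in> paths G \<and> (ptarget G (u, xs), ys) \<in> paths G"
proof (induction xs arbitrary: u)
  case Nil
  have "(u, ys) \<in> paths G \<Longrightarrow> u \<in> verts G" by (auto simp: paths_def awalk_def)
  then show ?case by (auto simp: paths_Nil)
qed (auto simp: paths_Cons)

lemma ptarget_in_verts: "p \<in> paths G \<Longrightarrow> ptarget G p \<in> verts G"
proof (cases p)
  case (Pair u xs)
  then show "p \<in> paths G \<Longrightarrow> ptarget G p \<in> verts G"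
    using paths_append[of u xs "[]"] by (simp add: paths_Nil)
qed

lemma psource_in_verts: "p \<in> paths G \<Longrightarrow> psource p \<in> verts G"
  using paths_append[of "fst p" "[]" "snd p"] by (cases p) (simp add: paths_Nil)

lemma path_mult_supported:
  "p \<in> paths G \<Longrightarrow> q \<in> paths G \<Longrightarrow> path_mult G p q \<in> supported (paths G)"
  by (cases p; cases q) (auto simp: path_mult_def paths_append supported_closed intro!: supported_single)

lemma pmul_supported:
  "f \<in> supported (paths G) \<Longrightarrow> g \<in> supported (paths G) \<Longrightarrow> pmul G f g \<in> supported (paths G)"
  unfolding pmul_def by (intro supported_linear_extension path_mult_supported)

end

definition vertex_sum :: "('v, 'a) pre_digraph \<Rightarrow> (('v, 'a) path \<Rightarrow>\<^sub>0 'k::field)" where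
  "vertex_sum Q = (\<Sum>v\<in>verts Q. Poly_Mapping.single (v, []) 1)"

lemma path_algebra_eq: "path_algebra Q = lin_algebra (paths Q) (pmul Q) (vertex_sum Q)"
  by (simp add: path_algebra_def lin_algebra_def supported_def vertex_sum_def pmul_def[abs_def])

context fin_digraph begin

lemma vertex_sum_unit:
  assumes "f \<in> supported (paths G)"
  shows "pmul G (vertex_sum G) f = f" "pmul G f (vertex_sum G) = f"
proof -
  show "pmul G (vertex_sum G) f = f"
    by (rule supported_linear_eqI[OF pm_linear_pmul_right pm_linear_ident assms])
      (simp add: vertex_sum_def pmul_linear path_mult_def ptarget_in_verts psource_def)
  show "pmul G f (vertex_sum G) = f"
    by (rule supported_linear_eqI[OF pm_linear_pmul_left pm_linear_ident assms])
      (auto simp: vertex_sum_def pmul_linear path_mult_def psource_def dest: psource_in_verts)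
qed

lemma vertex_sum_supported: "vertex_sum G \<in> supported (paths G)"
  unfolding vertex_sum_def by (intro supported_sum supported_single) (simp add: paths_Nil)

lemma ring_path_algebra: "ring (path_algebra G :: ('k::field, ('a, 'b) path \<Rightarrow>\<^sub>0 'k) module)"
  unfolding path_algebra_eq
proof (intro ringI abelian_groupI monoidI)
  fix x :: "('a, 'b) path \<Rightarrow>\<^sub>0 'k"
  assume "x \<in> carrier (lin_algebra (paths G) (pmul G) (vertex_sum G))"
  then show "\<exists>y\<in>carrier (lin_algebra (paths G) (pmul G) (vertex_sum G)).
      y \<oplus>\<^bsub>lin_algebra (paths G) (pmul G) (vertex_sum G)\<^esub> x = \<zero>\<^bsub>lin_algebra (paths G) (pmul G) (vertex_sum G)\<^esub>"
    by (intro bexI[of _ "- x"]) (simp_all add: supported_closed)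
qed (simp_all add: supported_closed pmul_supported pmul_assoc pmul_linear vertex_sum_unit
    vertex_sum_supported add.assoc add.commute)

end

section \<open>Monomial presentations and their algebras of normal forms\<close>

locale monomial =
  fixes P :: "('v, 'a) path_presentation"
  assumes mono: "monomial_presentation P"
begin

sublocale fin_digraph "quiver P"
  using mono by (simp add: monomial_presentation_def)

lemma rels_length: "z \<in> rels P \<Longrightarrow> 2 \<le> length z"
  and rels_path: "z \<in> rels P \<Longrightarrow> rel_path P z \<in> paths (quiver P)"
  and rels_minimal: "z \<in> rels P \<Longrightarrow> z' \<in> rels P \<Longrightarrow> sublist z' z \<Longrightarrow> z' = z"
  using mono by (auto simp: monomial_presentation_def)

text \<open>\<open>delta1\<close> sums over the relations, and a sum over an infinite set would be
  0. Finiteness comes from admissibility: if a relation had more than \<open>N\<close> arrows, it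
  would still contain a relation after losing its last arrow, against minimality.\<close>

lemma finite_rels: "finite (rels P)"
proof -
  obtain N where N: "\<And>p. p \<in> paths (quiver P) \<Longrightarrow> N \<le> length (snd p) \<Longrightarrow> \<exists>z\<in>rels P. sublist z (snd p)"
    using mono unfolding monomial_presentation_def by blast
  have "set z \<subseteq> arcs (quiver P) \<and> length z \<le> N" if z: "z \<in> rels P" for z
  proof
    have z_path: "(tail (quiver P) (hd z), z) \<in> paths (quiver P)" using rels_path[OF z] by (simp add: rel_path_def)
    then show "set z \<subseteq> arcs (quiver P)" by (auto simp: paths_def awalk_def)
    show "length z \<le> N"
    proof (rule ccontr)
      assume len: "\<not> length z \<le> N"
      then have z': "z = butlast z @ [last z]" by (cases z rule: rev_cases) auto
      then have "(tail (quiver P) (hd z), butlast z) \<in> paths (quiver P)"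
        using z_path paths_append by metis
      then obtain z' where "z' \<in> rels P" "sublist z' (butlast z)" using N len by force
      moreover have "sublist (butlast z) z" by (subst (2) z') simp
      moreover from calculation have "sublist z' z" using sublist_order.order_trans by blast
      ultimately have "length z \<le> length (butlast z)" using rels_minimal[OF z] sublist_length_le by blast
      then show False using len by simp
    qed
  qed
  then show ?thesis
    by (intro finite_subset[OF _ finite_lists_length_le[OF finite_arcs, of N]]) auto
qed

lemma basis_paths_iff:
  "(u, xs) \<in> basis_paths P \<longleftrightarrow> (u, xs) \<in> paths (quiver P) \<and> (\<forall>z\<in>rels P. \<not> sublist z xs)"
  by (auto simp: basis_paths_def)

lemma basis_paths_append:
  "(u, xs @ ys) \<in> basis_paths P \<Longrightarrow>
     (u, xs) \<in> basis_paths P \<and> (ptarget (quiver P) (u, xs), ys) \<in> basis_paths P"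
  using sublist_order.order_trans[of _ xs "xs @ ys"] sublist_order.order_trans[of _ ys "xs @ ys"]
  by (auto simp: basis_paths_iff paths_append)

lemma trivial_basis_paths: "v \<in> verts (quiver P) \<Longrightarrow> (v, []) \<in> basis_paths P"
  using rels_length by (fastforce simp: basis_paths_iff paths_Nil)

lemma arrow_basis_paths:
  assumes "a \<in> arcs (quiver P)"
  shows "(tail (quiver P) a, [a]) \<in> basis_paths P"
proof -
  have "\<not> sublist z [a]" if "z \<in> rels P" for z
    using rels_length[OF that] sublist_length_le[of z "[a]"] by auto
  then show ?thesis using assms by (simp add: basis_paths_iff paths_Nil paths_Cons)
qed

text \<open>If a factor contains a relation, so does every product with it. Together with the mirror
  image below this makes the truncated product associative.\<close>

lemma nf_pmul_left: "nf P (pmul (quiver P) (nf P x) y) = nf P (pmul (quiver P) x y)"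
proof (rule pm_bilinear_eqI[of "\<lambda>x y. nf P (pmul (quiver P) (nf P x) y)" "\<lambda>x y. nf P (pmul (quiver P) x y)"])
  fix p q
  show "nf P (pmul (quiver P) (nf P (Poly_Mapping.single p 1)) (Poly_Mapping.single q 1)) = nf P (pmul (quiver P) (Poly_Mapping.single p 1) (Poly_Mapping.single q 1))"
    using basis_paths_append[of "fst q" "snd q" "snd p"]
    by (cases p; cases q) (auto simp: path_mult_def pmul_linear nf_linear)
qed (auto intro!: pm_linear_intros pm_linear_compose[OF pm_linear_nf] pm_linear_nf)

lemma nf_pmul_right: "nf P (pmul (quiver P) x (nf P y)) = nf P (pmul (quiver P) x y)"
proof (rule pm_bilinear_eqI[of "\<lambda>x y. nf P (pmul (quiver P) x (nf P y))" "\<lambda>x y. nf P (pmul (quiver P) x y)"])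
  fix p q
  show "nf P (pmul (quiver P) (Poly_Mapping.single p 1) (nf P (Poly_Mapping.single q 1))) = nf P (pmul (quiver P) (Poly_Mapping.single p 1) (Poly_Mapping.single q 1))"
    using basis_paths_append[of "fst q" "snd q" "snd p"]
    by (cases p; cases q) (auto simp: path_mult_def pmul_linear nf_linear)
qed (auto intro!: pm_linear_intros pm_linear_compose[OF pm_linear_nf] pm_linear_nf)

definition bmul :: "(('v, 'a) path \<Rightarrow>\<^sub>0 'k::field) \<Rightarrow> (('v, 'a) path \<Rightarrow>\<^sub>0 'k) \<Rightarrow> (('v, 'a) path \<Rightarrow>\<^sub>0 'k)" where
  "bmul x y = nf P (pmul (quiver P) x y)"

sublocale N: lin_alg "basis_paths P" bmul "vertex_sum (quiver P)"
proof
  show "pm_linear (\<lambda>x. bmul x y)" "pm_linear (bmul x)" for x y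
    unfolding bmul_def[abs_def] by (auto intro!: pm_linear_intros pm_linear_compose[OF pm_linear_nf])
qed (auto simp: bmul_def nf_supported nf_pmul_left nf_pmul_right pmul_assoc)

text \<open>An explicit candidate for the ideal generated by the relations;
  \<open>genideal_eq\<close> confirms it.\<close>

definition rel_ideal :: "(('v, 'a) path \<Rightarrow>\<^sub>0 'k::field) set" where
  "rel_ideal = supported (paths (quiver P) - basis_paths P)"

lemma rel_ideal_iff:
  "f \<in> rel_ideal \<longleftrightarrow> f \<in> supported (paths (quiver P)) \<and> nf P f = 0"
  by (auto simp: rel_ideal_def supported_iff nf_eq_zero_iff)

lemma ideal_rel_ideal:
  "ideal rel_ideal (path_algebra (quiver P) :: ('k::field, ('v, 'a) path \<Rightarrow>\<^sub>0 'k) module)"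
proof (intro idealI ring_path_algebra)
  let ?R = "path_algebra (quiver P) :: ('k::field, ('v, 'a) path \<Rightarrow>\<^sub>0 'k) module"
  interpret R: ring ?R by (rule ring_path_algebra)
  show "subgroup rel_ideal (add_monoid ?R)"
  proof (rule R.add.subgroupI)
    show "rel_ideal \<subseteq> carrier ?R" by (auto simp: path_algebra_eq rel_ideal_iff)
    show "rel_ideal \<noteq> {}" using supported_closed(1) by (auto simp: rel_ideal_def)
  next
    fix a :: "('v, 'a) path \<Rightarrow>\<^sub>0 'k" assume a: "a \<in> rel_ideal"
    have "\<ominus>\<^bsub>?R\<^esub> a = - a"
      by (rule R.minus_equality) (use a in \<open>auto simp: path_algebra_eq rel_ideal_iff supported_closed\<close>)
    then show "\<ominus>\<^bsub>?R\<^esub> a \<in> rel_ideal" using a by (simp add: rel_ideal_def supported_closed)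
  next
    fix a b :: "('v, 'a) path \<Rightarrow>\<^sub>0 'k" assume "a \<in> rel_ideal" "b \<in> rel_ideal"
    then show "a \<oplus>\<^bsub>?R\<^esub> b \<in> rel_ideal"
      by (simp add: rel_ideal_def supported_closed path_algebra_eq)
  qed
  fix a x :: "('v, 'a) path \<Rightarrow>\<^sub>0 'k" assume "a \<in> rel_ideal" "x \<in> carrier ?R"
  then have a: "a \<in> supported (paths (quiver P))" "nf P a = 0" and x: "x \<in> supported (paths (quiver P))"
    by (simp_all add: rel_ideal_iff path_algebra_eq)
  show "x \<otimes>\<^bsub>?R\<^esub> a \<in> rel_ideal" "a \<otimes>\<^bsub>?R\<^esub> x \<in> rel_ideal"
    using a x nf_pmul_left[of a x] nf_pmul_right[of x a]
    by (simp_all add: path_algebra_eq rel_ideal_iff pmul_supported pmul_linear nf_linear)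
qed

text \<open>Products are read from right to left, so the arrows traversed after the relation form
  the left factor \<open>q\<close>.\<close>

lemma non_basis_factorization:
  assumes p: "p \<in> paths (quiver P) - basis_paths P"
  obtains z q q' where "z \<in> rels P" "q \<in> paths (quiver P)" "q' \<in> paths (quiver P)"
    "(Poly_Mapping.single p 1 :: ('v, 'a) path \<Rightarrow>\<^sub>0 'k::field) = pmul (quiver P) (Poly_Mapping.single q 1)
      (pmul (quiver P) (Poly_Mapping.single (rel_path P z) 1) (Poly_Mapping.single q' 1))"
proof -
  obtain u ws where uw: "p = (u, ws)" by (cases p)
  with p obtain z where z: "z \<in> rels P" "sublist z ws" by (auto simp: basis_paths_def)
  then obtain xs ys where ws: "ws = xs @ z @ ys" by (auto simp: sublist_def)
  have zne: "z \<noteq> []" using rels_length[OF z(1)] by auto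
  have paths: "(u, xs) \<in> paths (quiver P)" "(ptarget (quiver P) (u, xs), z) \<in> paths (quiver P)"
    "(ptarget (quiver P) (ptarget (quiver P) (u, xs), z), ys) \<in> paths (quiver P)"
    using p uw ws by (auto simp: paths_append)
  have rz: "(ptarget (quiver P) (u, xs), z) = rel_path P z"
    using paths(2) zne by (cases z) (auto simp: rel_path_def paths_Cons)
  show thesis
  proof (rule that)
    show "(Poly_Mapping.single p 1 :: ('v, 'a) path \<Rightarrow>\<^sub>0 'k)
        = pmul (quiver P) (Poly_Mapping.single (ptarget (quiver P) (rel_path P z), ys) 1)
      (pmul (quiver P) (Poly_Mapping.single (rel_path P z) 1) (Poly_Mapping.single (u, xs) 1))"
      by (simp add: path_mult_def uw ws flip: rz)
  qed (use z paths rz in auto)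
qed

lemma genideal_eq:
  "Idl\<^bsub>path_algebra (quiver P)\<^esub> {Poly_Mapping.single (rel_path P r) 1 |r. r \<in> rels P}
     = (rel_ideal :: (('v, 'a) path \<Rightarrow>\<^sub>0 'k::field) set)"
proof
  let ?R = "path_algebra (quiver P) :: ('k::field, ('v, 'a) path \<Rightarrow>\<^sub>0 'k) module"
  let ?G = "{Poly_Mapping.single (rel_path P r) 1 |r. r \<in> rels P} :: (('v, 'a) path \<Rightarrow>\<^sub>0 'k) set"
  interpret R: ring ?R by (rule ring_path_algebra)
  have G: "?G \<subseteq> rel_ideal"
    by (auto simp: rel_ideal_iff basis_paths_def rels_path supported_single) (auto simp: rel_path_def)
  then have Gc: "?G \<subseteq> carrier ?R" by (auto simp: rel_ideal_iff path_algebra_eq)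
  show "Idl\<^bsub>?R\<^esub> ?G \<subseteq> rel_ideal"
    by (rule R.genideal_minimal[OF ideal_rel_ideal G])
  interpret J: ideal "Idl\<^bsub>?R\<^esub> ?G" ?R by (rule R.genideal_ideal[OF Gc])
  \<comment> \<open>\<open>Idl\<close> is generated by ring operations alone; scalars are recovered
    by multiplying with c times the unit.\<close>
  have scale: "pm_scale c x \<in> Idl\<^bsub>?R\<^esub> ?G" if "x \<in> Idl\<^bsub>?R\<^esub> ?G" for c x
  proof -
    have x: "x \<in> supported (paths (quiver P))" using J.Icarr[OF that] by (simp add: path_algebra_eq)
    have "pm_scale c (vertex_sum (quiver P)) \<otimes>\<^bsub>?R\<^esub> x \<in> Idl\<^bsub>?R\<^esub> ?G"
      by (rule J.I_l_closed[OF that]) (simp add: path_algebra_eq supported_closed vertex_sum_supported)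
    then show ?thesis using x by (simp add: path_algebra_eq pmul_linear vertex_sum_unit)
  qed
  have path: "Poly_Mapping.single p 1 \<in> Idl\<^bsub>?R\<^esub> ?G" if p: "p \<in> paths (quiver P) - basis_paths P" for p
  proof -
    obtain z q q' where z: "z \<in> rels P" "q \<in> paths (quiver P)" "q' \<in> paths (quiver P)"
      and eq: "(Poly_Mapping.single p 1 :: ('v, 'a) path \<Rightarrow>\<^sub>0 'k) = pmul (quiver P) (Poly_Mapping.single q 1)
        (pmul (quiver P) (Poly_Mapping.single (rel_path P z) 1) (Poly_Mapping.single q' 1))"
      using non_basis_factorization[OF p] by blast
    have "Poly_Mapping.single (rel_path P z) 1 \<in> Idl\<^bsub>?R\<^esub> ?G" using R.genideal_self[OF Gc] z(1) by auto
    then have "Poly_Mapping.single q 1 \<otimes>\<^bsub>?R\<^esub> (Poly_Mapping.single (rel_path P z) 1 \<otimes>\<^bsub>?R\<^esub> Poly_Mapping.single q' 1)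
        \<in> Idl\<^bsub>?R\<^esub> ?G"
      by (intro J.I_l_closed J.I_r_closed) (use z in \<open>auto simp: path_algebra_eq intro!: supported_single\<close>)
    then show ?thesis unfolding eq by (simp add: path_algebra_eq)
  qed
  show "rel_ideal \<subseteq> Idl\<^bsub>?R\<^esub> ?G"
  proof
    fix f :: "('v, 'a) path \<Rightarrow>\<^sub>0 'k" assume f: "f \<in> rel_ideal"
    have "(\<Sum>x\<in>S. pm_scale (Poly_Mapping.lookup f x) (Poly_Mapping.single x 1)) \<in> Idl\<^bsub>?R\<^esub> ?G"
      if "S \<subseteq> paths (quiver P) - basis_paths P" for S
      using that
    proof (induction S rule: infinite_finite_induct)
      case (insert x F)
      then show ?case using J.a_closed scale[OF path, of x] by (simp add: path_algebra_eq)
    qed (use J.zero_closed in \<open>simp_all add: path_algebra_eq\<close>)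
    then show "f \<in> Idl\<^bsub>?R\<^esub> ?G"
      using f by (subst pm_expand) (simp add: rel_ideal_def supported_def)
  qed
qed

text \<open>Every coset of \<open>rel_ideal\<close> contains exactly one vector supported on basis
  paths, namely the normal form of its members. Hence \<open>\<rho>\<close> is an isomorphism from
  the normal forms and \<open>HH1_iso\<close> applies.\<close>

lemma HH1_presented_algebra:
  obtains \<eta> where "lie_algebra (HH1 (presented_algebra P :: ('k::field, _) module))"
    "lie_hom (Der N.alg) (HH1 (presented_algebra P :: ('k, _) module)) \<eta>"
    "\<eta> ` derivations N.alg = carrier (HH1 (presented_algebra P :: ('k, _) module))"
    "\<And>D. D \<in> derivations N.alg \<Longrightarrow>
      \<eta> D = lzero (HH1 (presented_algebra P :: ('k, _) module)) \<longleftrightarrow> D \<in> Inn N.alg"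
proof -
  let ?R = "path_algebra (quiver P) :: ('k::field, ('v, 'a) path \<Rightarrow>\<^sub>0 'k) module"
  let ?M = "presented_algebra P :: ('k, (('v, 'a) path \<Rightarrow>\<^sub>0 'k) set) module"
  interpret R: ring ?R by (rule ring_path_algebra)
  interpret I: ideal rel_ideal ?R by (rule ideal_rel_ideal)
  define \<rho> where "\<rho> x = rel_ideal +>\<^bsub>?R\<^esub> x" for x
  have \<rho>_eq: "\<rho> x = \<rho> y" if "x \<in> supported (paths (quiver P))" "x - y \<in> rel_ideal" for x y
  proof -
    have "x = (x - y) \<oplus>\<^bsub>?R\<^esub> y" by (simp add: path_algebra_eq)
    then have "x \<in> \<rho> y" using that(2) unfolding \<rho>_def a_r_coset_def' by blast
    moreover have "y \<in> carrier ?R"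
      using that supported_closed(3)[of x "paths (quiver P)" "x - y"]
      by (auto simp: path_algebra_eq rel_ideal_iff)
    ultimately show ?thesis unfolding \<rho>_def using I.a_repr_independence' by blast
  qed
  have \<rho>_mem: "x - y \<in> rel_ideal" if "\<rho> x = \<rho> y" "x \<in> supported (paths (quiver P))" for x y
  proof -
    have "x \<in> \<rho> y" using I.a_rcos_self[of x] that by (simp add: path_algebra_eq \<rho>_def)
    then show ?thesis by (auto simp: \<rho>_def a_r_coset_def' path_algebra_eq)
  qed
  have M: "carrier ?M = a_rcosets\<^bsub>?R\<^esub> rel_ideal" "\<zero>\<^bsub>?M\<^esub> = rel_ideal"
    "X \<oplus>\<^bsub>?M\<^esub> Y = X <+>\<^bsub>?R\<^esub> Y" "X \<otimes>\<^bsub>?M\<^esub> Y = rcoset_mult ?R rel_ideal X Y"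
    "c \<odot>\<^bsub>?M\<^esub> X = (\<Union>x\<in>X. rel_ideal +>\<^bsub>?R\<^esub> pm_scale c x)" for X Y c
    unfolding presented_algebra_def genideal_eq
    by (simp_all add: quotient_algebra_def FactRing_def
        ring.extend_def module.fields_def path_algebra_eq)
  show thesis
  proof (rule N.HH1_iso[of \<rho> ?M])
    show "bij_betw \<rho> (supported (basis_paths P)) (carrier ?M)"
    proof (rule bij_betw_imageI)
      show "inj_on \<rho> (supported (basis_paths P))"
      proof (rule inj_onI)
        fix x y :: "('v, 'a) path \<Rightarrow>\<^sub>0 'k"
        assume xy: "x \<in> supported (basis_paths P)" "y \<in> supported (basis_paths P)" "\<rho> x = \<rho> y"
        then have "nf P (x - y) = 0" using \<rho>_mem[of x y] supported_paths by (auto simp: rel_ideal_iff)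
        then show "x = y" using xy by (simp add: nf_ident supported_closed)
      qed
      have "\<exists>y\<in>supported (basis_paths P). \<rho> x = \<rho> y" if "x \<in> supported (paths (quiver P))" for x
        using that \<rho>_eq[of x "nf P x"] diff_nf[of x] nf_supported[of P x] by (auto simp: rel_ideal_def)
      then show "\<rho> ` supported (basis_paths P) = carrier ?M"
        using supported_paths[of _ P] unfolding M A_RCOSETS_def' \<rho>_def[symmetric]
        by (force simp: path_algebra_eq)
    qed
    fix x y :: "('v, 'a) path \<Rightarrow>\<^sub>0 'k" and c :: 'k
    show "\<rho> 0 = \<zero>\<^bsub>?M\<^esub>"
      unfolding M \<rho>_def by (rule I.a_rcos_const) (simp add: rel_ideal_def supported_closed)
    assume x: "x \<in> supported (basis_paths P)"
    then have x': "x \<in> supported (paths (quiver P))" by (rule supported_paths)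
    \<comment> \<open>Scalar multiplication in the quotient is a union over all representatives z of
      the coset, so all of them must give the same coset.\<close>
    have "\<rho> (pm_scale c z) = \<rho> (pm_scale c x)" if "z \<in> \<rho> x" for z
    proof -
      obtain i where i: "i \<in> rel_ideal" "z = i + x"
        using \<open>z \<in> \<rho> x\<close> by (auto simp: \<rho>_def a_r_coset_def' path_algebra_eq)
      then show ?thesis
        using x' by (intro \<rho>_eq) (auto simp: pm_scale_add_right rel_ideal_iff supported_closed nf_linear)
    qed
    moreover have "x \<in> \<rho> x" using I.a_rcos_self[of x] x' by (simp add: \<rho>_def path_algebra_eq)
    ultimately show "\<rho> (pm_scale c x) = c \<odot>\<^bsub>?M\<^esub> \<rho> x"
      unfolding M \<rho>_def[symmetric] by blast
    assume y: "y \<in> supported (basis_paths P)"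
    then have y': "y \<in> supported (paths (quiver P))" by (rule supported_paths)
    show "\<rho> (x + y) = \<rho> x \<oplus>\<^bsub>?M\<^esub> \<rho> y"
      unfolding M \<rho>_def using x' y' by (subst I.a_rcos_sum) (simp_all add: path_algebra_eq)
    have "\<rho> (bmul x y) = \<rho> (pmul (quiver P) x y)"
      using \<rho>_eq[of "pmul (quiver P) x y" "bmul x y"] diff_nf[OF pmul_supported[OF x' y']]
        pmul_supported[OF x' y'] by (simp add: bmul_def rel_ideal_def)
    also have "\<dots> = \<rho> x \<otimes>\<^bsub>?M\<^esub> \<rho> y"
      unfolding M \<rho>_def using x' y' by (subst I.rcoset_mult_add) (simp_all add: path_algebra_eq)
    finally show "\<rho> (bmul x y) = \<rho> x \<otimes>\<^bsub>?M\<^esub> \<rho> y" .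
  qed (fact that)
qed

end

section \<open>Derivations of monomial algebras by parallel paths\<close>

text \<open>Read a//p as the assignment of p to the arrow a; this is then the image of
  \<open>a\<close> under \<open>f\<close>. Elements are compared arrow by arrow.\<close>

definition value_at :: "('x \<times> 'y \<Rightarrow>\<^sub>0 'k::field) \<Rightarrow> 'x \<Rightarrow> ('y \<Rightarrow>\<^sub>0 'k)" where
  "value_at f a = linear_extension (\<lambda>z. if fst z = a then Poly_Mapping.single (snd z) 1 else 0) f"

lemma pm_linear_value_at: "pm_linear (\<lambda>f. value_at f a)"
  unfolding value_at_def by (rule pm_linear_linear_extension)

lemmas value_at_linear = pm_linear_value_at[THEN pm_linear_add] pm_linear_value_at[THEN pm_linear_diff]
  pm_linear_value_at[THEN pm_linear_scale] pm_linear_value_at[THEN pm_linear_zero]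
  pm_linear_value_at[THEN pm_linear_uminus] pm_linear_value_at[THEN pm_linear_sum]

lemma value_at_single [simp]:
  "value_at (Poly_Mapping.single (x, y) 1) a = (if x = a then Poly_Mapping.single y 1 else 0)"
  by (simp add: value_at_def)

lemma lookup_value_at: "Poly_Mapping.lookup (value_at f a) p = Poly_Mapping.lookup f (a, p)"
proof -
  have "fst z = a \<and> snd z = p \<longleftrightarrow> z = (a, p)" for z by (cases z) auto
  then show ?thesis
    unfolding value_at_def lookup_linear_extension_partial by (simp add: in_keys_iff)
qed

lemma value_at_eqI: "(\<And>a. value_at f a = value_at g a) \<Longrightarrow> f = g"
  by (rule poly_mapping_eqI) (metis lookup_value_at prod.collapse)

lemma pm_linear_if: "pm_linear F \<Longrightarrow> pm_linear (\<lambda>x. if C then F x else 0)"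
  by (cases C) (simp_all add: pm_linear_const_zero)

text \<open>The element a//x for a whole vector x, a section of \<open>value_at\<close>.\<close>

definition tag :: "'x \<Rightarrow> ('y \<Rightarrow>\<^sub>0 'k::field) \<Rightarrow> ('x \<times> 'y \<Rightarrow>\<^sub>0 'k)" where
  "tag a = linear_extension (\<lambda>p. Poly_Mapping.single (a, p) 1)"

lemma value_at_tag: "value_at (tag a x) b = (if a = b then x else 0)"
  by (rule pm_linear_eqI[of "\<lambda>x. value_at (tag a x) b"])
    (auto simp: tag_def intro!: pm_linear_if pm_linear_compose[OF pm_linear_value_at] pm_linear_intros)

lemma tag_supported: "x \<in> supported S \<Longrightarrow> tag a x \<in> supported ({a} \<times> S)"
  unfolding tag_def by (erule supported_linear_extension) (auto intro: supported_single)

definition parallel_pairs :: "('v, 'a) path_presentation \<Rightarrow> ('a \<times> ('v, 'a) path) set" where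
  "parallel_pairs P = {(a, p). a \<in> arcs (quiver P) \<and> p \<in> basis_paths P
     \<and> psource p = tail (quiver P) a \<and> ptarget (quiver P) p = head (quiver P) a}"

lemma arrow_parallel_eq: "arrow_parallel P = supported (parallel_pairs P)"
  by (simp add: parallel_space_def supported_def parallel_pairs_def)

lemma value_at_supported:
  "f \<in> supported (parallel_pairs P) \<Longrightarrow> value_at f a \<in> supported (basis_paths P)"
  unfolding value_at_def
  by (erule supported_linear_extension) (auto simp: parallel_pairs_def supported_closed intro: supported_single)

text \<open>The counterpart of \<open>subst_sum\<close> without the filter by basis paths: only the
  unfiltered sum obeys a Leibniz rule in the path algebra. The filter is restored by
  \<open>nf\<close>.\<close>

definition replace_arrow :: "('v, 'a) path \<Rightarrow> 'a \<Rightarrow> ('v, 'a) path \<Rightarrow> (('v, 'a) path \<Rightarrow>\<^sub>0 'k::field)" where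
  "replace_arrow q a p = (\<Sum>i | i < length (snd q) \<and> snd q ! i = a.
     Poly_Mapping.single (psource q, take i (snd q) @ snd p @ drop (Suc i) (snd q)) 1)"

lemma replace_arrow_trivial [simp]: "replace_arrow (u, []) a p = 0"
  by (simp add: replace_arrow_def)

lemma replace_arrow_arrow:
  "replace_arrow (u, [b]) a p = (if a = b then Poly_Mapping.single (u, snd p) 1 else 0)"
proof -
  have "{i. i < length [b] \<and> [b] ! i = a} = (if a = b then {0} else {})" by auto
  then show ?thesis by (simp add: replace_arrow_def)
qed

lemma value_at_subst_sum:
  "value_at (subst_sum P x q a p) y = (if x = y then nf P (replace_arrow q a p) else 0)"
    (is "_ = (if _ then ?n else _)")
proof -
  let ?q = "\<lambda>i. (psource q, take i (snd q) @ snd p @ drop (Suc i) (snd q))"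
  have "?n = (\<Sum>i | i < length (snd q) \<and> snd q ! i = a \<and> ?q i \<in> basis_paths P.
      Poly_Mapping.single (?q i) 1)"
    unfolding replace_arrow_def nf_linear nf_single
    by (subst sum.inter_filter[symmetric]) (auto intro: sum.cong)
  then show ?thesis
    by (simp add: subst_sum_def Let_def value_at_linear)
qed

text \<open>For \<open>f\<close> supported on parallel pairs, the derivation of the path algebra
  that kills the idempotents and sends each arrow to its value under \<open>f\<close>.\<close>

definition replacement ::
  "('a \<times> ('v, 'a) path \<Rightarrow>\<^sub>0 'k::field) \<Rightarrow> (('v, 'a) path \<Rightarrow>\<^sub>0 'k) \<Rightarrow> (('v, 'a) path \<Rightarrow>\<^sub>0 'k)" where
  "replacement f x =
     linear_extension (\<lambda>z. linear_extension (\<lambda>q. replace_arrow q (fst z) (snd z)) x) f"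

lemma pm_linear_replacement_left: "pm_linear (\<lambda>f. replacement f x)"
  and pm_linear_replacement_right: "pm_linear (replacement f)"
  unfolding replacement_def by (auto intro: pm_linear_coefficients)

lemmas replacement_linear =
  pm_linear_replacement_left[THEN pm_linear_add] pm_linear_replacement_left[THEN pm_linear_scale]
  pm_linear_replacement_left[THEN pm_linear_zero] pm_linear_replacement_right[THEN pm_linear_add]
  pm_linear_replacement_right[THEN pm_linear_diff] pm_linear_replacement_right[THEN pm_linear_scale]
  pm_linear_replacement_right[THEN pm_linear_zero]

lemmas pm_linear_intros' = pm_linear_intros
  pm_linear_replacement_left pm_linear_replacement_right pm_linear_nf
  pm_linear_compose[OF pm_linear_replacement_left] pm_linear_compose[OF pm_linear_replacement_right]
  pm_linear_compose[OF pm_linear_nf] pm_linear_value_at pm_linear_compose[OF pm_linear_value_at]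

lemma replacement_single [simp]:
  "replacement (Poly_Mapping.single (a, p) 1) (Poly_Mapping.single q 1) = replace_arrow q a p"
  by (simp add: replacement_def)

lemma value_at_delta1:
  assumes "finite (rels P)"
  shows "value_at (delta1 P f) r
    = (if r \<in> rels P then nf P (replacement f (Poly_Mapping.single (rel_path P r) 1)) else 0)"
proof (rule pm_linear_eqI[of "\<lambda>f. value_at (delta1 P f) r"])
  show "pm_linear (\<lambda>f. value_at (delta1 P f) r)"
    unfolding delta1_def by (intro pm_linear_intros')
  show "pm_linear (\<lambda>f. if r \<in> rels P then nf P (replacement f (Poly_Mapping.single (rel_path P r) 1)) else 0)"
    by (intro pm_linear_if pm_linear_intros')
  fix z
  show "value_at (delta1 P (Poly_Mapping.single z 1)) r = (if r \<in> rels P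
      then nf P (replacement (Poly_Mapping.single z 1) (Poly_Mapping.single (rel_path P r) 1)) else 0)"
    using assms by (cases z) (simp add: delta1_def value_at_linear value_at_subst_sum)
qed

text \<open>Shows the bracket as a commutator of substitutions evaluated at an arrow, which lets it
  be matched with the bracket of derivations.\<close>

lemma value_at_parallel_bracket:
  "value_at (parallel_bracket P f g) a
    = nf P (replacement f (value_at g a)) - nf P (replacement g (value_at f a))"
proof (rule pm_bilinear_eqI[of "\<lambda>f g. value_at (parallel_bracket P f g) a"
      "\<lambda>f g. nf P (replacement f (value_at g a)) - nf P (replacement g (value_at f a))"])
  show "pm_linear (\<lambda>f. value_at (parallel_bracket P f g) a)" for g
    unfolding parallel_bracket_def by (intro pm_linear_intros')
  show "pm_linear (\<lambda>g. value_at (parallel_bracket P f g) a)" for f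
    unfolding parallel_bracket_def case_prod_beta by (intro pm_linear_intros')
  fix z w
  show "value_at (parallel_bracket P (Poly_Mapping.single z 1) (Poly_Mapping.single w 1)) a
    = nf P (replacement (Poly_Mapping.single z 1) (value_at (Poly_Mapping.single w 1) a))
      - nf P (replacement (Poly_Mapping.single w 1) (value_at (Poly_Mapping.single z 1) a))"
    by (cases z; cases w)
      (simp add: parallel_bracket_def value_at_linear value_at_subst_sum replacement_linear nf_linear)
qed (intro pm_linear_intros')+

context wf_digraph begin

lemma replaced_path:
  assumes q: "(u, xs) \<in> paths G" and i: "i < length xs"
    and p: "p \<in> paths G" "psource p = tail G (xs ! i)" "ptarget G p = head G (xs ! i)"
  shows "(u, take i xs @ snd p @ drop (Suc i) xs) \<in> paths G"
    and "ptarget G (u, take i xs @ snd p @ drop (Suc i) xs) = ptarget G (u, xs)"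
proof -
  have xs: "xs = take i xs @ xs ! i # drop (Suc i) xs" using i by (simp add: id_take_nth_drop)
  have "(u, take i xs @ xs ! i # drop (Suc i) xs) \<in> paths G" using q xs by simp
  then have u: "(u, take i xs) \<in> paths G" "ptarget G (u, take i xs) = tail G (xs ! i)"
    "(head G (xs ! i), drop (Suc i) xs) \<in> paths G"
    by (auto simp: paths_append paths_Cons)
  moreover have "(tail G (xs ! i), snd p) = p" using p(2) by (simp add: psource_def prod_eq_iff)
  ultimately show "(u, take i xs @ snd p @ drop (Suc i) xs) \<in> paths G"
    using p by (simp add: paths_append)
  have "ptarget G (u, take i xs @ xs ! i # drop (Suc i) xs) = ptarget G (head G (xs ! i), drop (Suc i) xs)"
    by simp
  then have "ptarget G (u, xs) = ptarget G (head G (xs ! i), drop (Suc i) xs)" using xs by simp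
  then show "ptarget G (u, take i xs @ snd p @ drop (Suc i) xs) = ptarget G (u, xs)"
    using u p \<open>(tail G (xs ! i), snd p) = p\<close> by simp
qed

text \<open>The Leibniz rule on paths: an occurrence of \<open>a\<close> lies either in
  \<open>xs\<close> or in \<open>ys\<close>. Since \<open>p\<close> is parallel to \<open>a\<close>,
  replacing inside \<open>xs\<close> does not move its target, and the product with
  \<open>ys\<close> stays composable.\<close>

lemma replace_arrow_append:
  assumes q': "(u, xs) \<in> paths G" and q: "(ptarget G (u, xs), ys) \<in> paths G"
    and p: "p \<in> paths G" "psource p = tail G a" "ptarget G p = head G a"
  shows "replace_arrow (u, xs @ ys) a p
    = pmul G (replace_arrow (ptarget G (u, xs), ys) a p) (Poly_Mapping.single (u, xs) 1)
      + pmul G (Poly_Mapping.single (ptarget G (u, xs), ys) 1) (replace_arrow (u, xs) a p)"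
proof -
  let ?f = "\<lambda>i. Poly_Mapping.single (u, take i (xs @ ys) @ snd p @ drop (Suc i) (xs @ ys)) 1"
  let ?X = "{i. i < length xs \<and> xs ! i = a}" and ?Y = "{i. i < length ys \<and> ys ! i = a}"
  have "{i. i < length (xs @ ys) \<and> (xs @ ys) ! i = a} = ?X \<union> (\<lambda>i. length xs + i) ` ?Y" (is "?L = ?R")
  proof
    show "?L \<subseteq> ?R"
    proof
      fix i assume i: "i \<in> ?L"
      show "i \<in> ?R"
      proof (cases "i < length xs")
        case False
        with i have "i - length xs \<in> ?Y" "i = length xs + (i - length xs)" by (auto simp: nth_append)
        then show ?thesis by blast
      qed (use i in \<open>auto simp: nth_append\<close>)
    qed
  qed (auto simp: nth_append)
  then have "replace_arrow (u, xs @ ys) a p = sum ?f (?X \<union> (\<lambda>i. length xs + i) ` ?Y)"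
    by (simp add: replace_arrow_def)
  also have "\<dots> = sum ?f ?X + sum ?f ((\<lambda>i. length xs + i) ` ?Y)"
    by (rule sum.union_disjoint) auto
  also have "sum ?f ?X = pmul G (Poly_Mapping.single (ptarget G (u, xs), ys) 1) (replace_arrow (u, xs) a p)"
    unfolding replace_arrow_def pmul_linear pmul_single snd_conv psource_Pair
    using replaced_path(2)[OF q' _ p(1)] p(2,3)
    by (intro sum.cong) (auto simp: path_mult_def simp del: ptarget_append)
  also have "sum ?f ((\<lambda>i. length xs + i) ` ?Y)
      = pmul G (replace_arrow (ptarget G (u, xs), ys) a p) (Poly_Mapping.single (u, xs) 1)"
    unfolding replace_arrow_def pmul_linear pmul_single snd_conv psource_Pair
    by (subst sum.reindex) (auto simp: path_mult_def intro!: sum.cong)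
  finally show ?thesis by (simp add: add.commute)
qed

end

context monomial begin

lemma replacement_pmul:
  fixes f :: "'a \<times> ('v, 'a) path \<Rightarrow>\<^sub>0 'k::field"
  assumes f: "f \<in> supported (parallel_pairs P)"
    and x: "x \<in> supported (paths (quiver P))" and y: "y \<in> supported (paths (quiver P))"
  shows "replacement f (pmul (quiver P) x y)
    = pmul (quiver P) (replacement f x) y + pmul (quiver P) x (replacement f y)"
proof (rule pm_trilinear_eqI[of "\<lambda>f x y. replacement f (pmul (quiver P) x y)"
    "\<lambda>f x y. pmul (quiver P) (replacement f x) y + pmul (quiver P) x (replacement f y)"])
  fix z q q' assume "z \<in> Poly_Mapping.keys f" "q \<in> Poly_Mapping.keys x" "q' \<in> Poly_Mapping.keys y"
  then obtain a p where z: "z = (a, p)" "(a, p) \<in> parallel_pairs P"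
    and q: "q \<in> paths (quiver P)" "q' \<in> paths (quiver P)"
    using assms by (cases z) (auto simp: supported_def)
  have p: "p \<in> paths (quiver P)" "psource p = tail (quiver P) a" "ptarget (quiver P) p = head (quiver P) a"
    using z basis_paths_subset[of P] by (auto simp: parallel_pairs_def)
  let ?q = "Poly_Mapping.single q 1 :: _ \<Rightarrow>\<^sub>0 'k" and ?q' = "Poly_Mapping.single q' 1 :: _ \<Rightarrow>\<^sub>0 'k"
    and ?z = "Poly_Mapping.single z 1 :: _ \<Rightarrow>\<^sub>0 'k"
  show "replacement ?z (pmul (quiver P) ?q ?q')
    = pmul (quiver P) (replacement ?z ?q) ?q' + pmul (quiver P) ?q (replacement ?z ?q')"
  proof (cases "ptarget (quiver P) q' = psource q")
    case True
    then have eq: "q = (ptarget (quiver P) (psource q', snd q'), snd q)" "q' = (psource q', snd q')"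
      by (simp_all add: psource_def)
    then show ?thesis
      using replace_arrow_append[of "psource q'" "snd q'" "snd q" p a] p q True
      by (simp add: path_mult_def z)
  next
    \<comment> \<open>Substitution preserves source and target, so factors that do not compose still
      do not compose afterwards and all terms vanish.\<close>
    case False
    have "pmul (quiver P) (replace_arrow q a p) ?q' = 0"
      unfolding replace_arrow_def pmul_linear using False by (simp add: path_mult_def)
    moreover have "pmul (quiver P) ?q (replace_arrow q' a p) = 0"
      unfolding replace_arrow_def pmul_linear pmul_single
      using False replaced_path(2)[of "psource q'" "snd q'" _ p] p q
      by (intro sum.neutral) (auto simp: path_mult_def psource_def simp del: ptarget_append)
    ultimately show ?thesis using False by (simp add: path_mult_def z replacement_linear)
  qed
qed (intro pm_linear_intros')+

text \<open>Ker(\<delta>1) consists of the substitutions whose derivation of the path algebra sends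
  every relation into the ideal of relations.\<close>

lemma ker_delta1_iff:
  "f \<in> ker_delta1 P \<longleftrightarrow> f \<in> supported (parallel_pairs P)
     \<and> (\<forall>r\<in>rels P. nf P (replacement f (Poly_Mapping.single (rel_path P r) 1)) = 0)"
proof -
  have "delta1 P f = 0 \<longleftrightarrow> (\<forall>r. value_at (delta1 P f) r = 0)"
    by (auto simp: value_at_linear intro: value_at_eqI)
  then show ?thesis
    unfolding ker_delta1_def arrow_parallel_eq value_at_delta1[OF finite_rels] by auto
qed

text \<open>Apply the Leibniz rule to a product q z q' with z a relation. Where z is left untouched
  the term is in the ideal; where z itself is replaced, the kernel condition puts it there.\<close>

lemma replacement_rel_ideal:
  assumes f: "f \<in> ker_delta1 P" and x: "x \<in> rel_ideal"
  shows "nf P (replacement f x) = 0"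
proof (rule supported_linear_eqI[of "\<lambda>x. nf P (replacement f x)" "\<lambda>x. 0", OF _ _ x[unfolded rel_ideal_def]])
  fix p assume p: "p \<in> paths (quiver P) - basis_paths P"
  obtain z q q' where z: "z \<in> rels P" "q \<in> paths (quiver P)" "q' \<in> paths (quiver P)"
    and eq: "(Poly_Mapping.single p 1 :: ('v, 'a) path \<Rightarrow>\<^sub>0 'b) = pmul (quiver P) (Poly_Mapping.single q 1)
        (pmul (quiver P) (Poly_Mapping.single (rel_path P z) 1) (Poly_Mapping.single q' 1))"
    using non_basis_factorization[OF p] by blast
  let ?q = "Poly_Mapping.single q 1 :: ('v, 'a) path \<Rightarrow>\<^sub>0 'b"
  let ?q' = "Poly_Mapping.single q' 1 :: ('v, 'a) path \<Rightarrow>\<^sub>0 'b"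
  let ?z = "Poly_Mapping.single (rel_path P z) 1 :: ('v, 'a) path \<Rightarrow>\<^sub>0 'b"
  have sup: "?q \<in> supported (paths (quiver P))" "?q' \<in> supported (paths (quiver P))"
    "?z \<in> supported (paths (quiver P))"
    using z rels_path by (auto intro: supported_single)
  have f': "f \<in> supported (parallel_pairs P)" and fz: "nf P (replacement f ?z) = 0"
    using f z by (auto simp: ker_delta1_iff)
  have nz: "rel_path P z \<notin> basis_paths P" using z(1) by (auto simp: basis_paths_def rel_path_def)
  have kill: "nf P (pmul (quiver P) u v) = 0" if "nf P u = 0 \<or> nf P v = 0" for u v
    using that nf_pmul_left[of u v] nf_pmul_right[of u v] by (auto simp: pmul_linear nf_linear)
  show "nf P (replacement f (Poly_Mapping.single p 1)) = 0"
    unfolding eq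
    by (simp add: replacement_pmul f' sup pmul_supported nf_linear pmul_linear kill nz fz del: pmul_single)
qed (intro pm_linear_intros')+

text \<open>The derivation therefore descends: its reduced value depends only on the normal form of
  the argument.\<close>

lemma nf_replacement_nf:
  assumes "f \<in> ker_delta1 P" "x \<in> supported (paths (quiver P))"
  shows "nf P (replacement f (nf P x)) = nf P (replacement f x)"
  using replacement_rel_ideal[OF assms(1), of "x - nf P x"] diff_nf[OF assms(2)]
  by (simp add: rel_ideal_def replacement_linear nf_linear)

section \<open>The derivation attached to an element of the kernel\<close>

definition derivation_of ::
  "('a \<times> ('v, 'a) path \<Rightarrow>\<^sub>0 'k::field) \<Rightarrow> (('v, 'a) path \<Rightarrow>\<^sub>0 'k) \<Rightarrow> (('v, 'a) path \<Rightarrow>\<^sub>0 'k)" where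
  "derivation_of f = (\<lambda>x\<in>supported (basis_paths P). nf P (replacement f x))"

abbreviation arrow :: "'a \<Rightarrow> (('v, 'a) path \<Rightarrow>\<^sub>0 'k::field)" where
  "arrow a \<equiv> Poly_Mapping.single (tail (quiver P) a, [a]) 1"

abbreviation idem :: "'v \<Rightarrow> (('v, 'a) path \<Rightarrow>\<^sub>0 'k::field)" where
  "idem v \<equiv> Poly_Mapping.single (v, []) 1"

lemma arrow_supported: "a \<in> arcs (quiver P) \<Longrightarrow> arrow a \<in> supported (basis_paths P)"
  by (intro supported_single arrow_basis_paths)

lemma idem_supported: "v \<in> verts (quiver P) \<Longrightarrow> idem v \<in> supported (basis_paths P)"
  by (intro supported_single trivial_basis_paths)

lemma derivation_of_derivation:
  assumes "f \<in> ker_delta1 P"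
  shows "derivation_of f \<in> derivations N.alg"
proof -
  have f: "f \<in> supported (parallel_pairs P)" using assms by (simp add: ker_delta1_iff)
  have "nf P (replacement f (bmul x y)) = bmul (nf P (replacement f x)) y + bmul x (nf P (replacement f y))"
    if "x \<in> supported (basis_paths P)" "y \<in> supported (basis_paths P)" for x y
    using that[THEN supported_paths] f
    by (simp add: bmul_def nf_replacement_nf[OF assms] pmul_supported replacement_pmul nf_linear
        nf_pmul_left nf_pmul_right)
  then show ?thesis
    by (auto simp: derivation_of_def N.derivation_iff nf_supported supported_closed replacement_linear
        nf_linear N.mul_closed)
qed

lemma derivation_of_idem: "v \<in> verts (quiver P) \<Longrightarrow> derivation_of f (idem v) = 0"
proof -
  have "replacement f (idem v) = 0"
    by (rule pm_linear_eqI[of "\<lambda>f. replacement f (idem v)" "\<lambda>f. 0"])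
      (auto intro!: pm_linear_intros' simp: replacement_def)
  then show "v \<in> verts (quiver P) \<Longrightarrow> derivation_of f (idem v) = 0"
    by (simp add: derivation_of_def idem_supported nf_linear)
qed

lemma replacement_arrow:
  assumes "f \<in> supported (parallel_pairs P)"
  shows "replacement f (arrow a) = value_at f a"
proof (rule supported_linear_eqI[of "\<lambda>f. replacement f (arrow a)" "\<lambda>f. value_at f a", OF _ _ assms])
  fix z assume "z \<in> parallel_pairs P"
  then show "replacement (Poly_Mapping.single z 1) (arrow a) = value_at (Poly_Mapping.single z 1) a"
    by (cases z) (auto simp: replace_arrow_arrow parallel_pairs_def psource_def)
qed (intro pm_linear_intros')+

lemma derivation_of_arrow:
  assumes "f \<in> supported (parallel_pairs P)" "a \<in> arcs (quiver P)"
  shows "derivation_of f (arrow a) = value_at f a"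
  using assms by (simp add: derivation_of_def arrow_supported replacement_arrow nf_ident value_at_supported)

lemma value_at_not_arc:
  assumes "f \<in> supported (parallel_pairs P)" "a \<notin> arcs (quiver P)"
  shows "value_at f a = 0"
  using assms by (intro poly_mapping_eqI) (auto simp: lookup_value_at supported_iff parallel_pairs_def)

lemma derivation_of_inj:
  assumes "f \<in> supported (parallel_pairs P)" "g \<in> supported (parallel_pairs P)"
    and "derivation_of f = derivation_of g"
  shows "f = g"
proof (rule value_at_eqI)
  show "value_at f a = value_at g a" for a
    using derivation_of_arrow[OF assms(1), of a] derivation_of_arrow[OF assms(2), of a]
      value_at_not_arc[OF assms(1), of a] value_at_not_arc[OF assms(2), of a] assms(3)
    by (cases "a \<in> arcs (quiver P)") auto
qed

text \<open>A derivation vanishing on the idempotents sends an arrow \<open>a\<close> into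
  \<open>e\<^sub>t M e\<^sub>s\<close>, so it is determined by its values on arrows.\<close>

lemma derivation_of_surj:
  assumes D: "D \<in> derivations N.alg" and zero: "\<And>v. v \<in> verts (quiver P) \<Longrightarrow> D (idem v) = 0"
  obtains h where "h \<in> ker_delta1 P" "derivation_of h = D"
    "\<And>a. a \<in> arcs (quiver P) \<Longrightarrow> value_at h a = D (arrow a)"
proof -
  note D' = N.derivationD[OF D]
  define h where "h = (\<Sum>a\<in>arcs (quiver P). tag a (D (arrow a)))"
  have hv: "value_at h a = (if a \<in> arcs (quiver P) then D (arrow a) else 0)" for a
    by (simp add: h_def value_at_linear value_at_tag)
  have ends: "D (arrow a) = bmul (idem (head (quiver P) a)) (bmul (D (arrow a)) (idem (tail (quiver P) a)))"
    if a: "a \<in> arcs (quiver P)" for a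
  proof -
    have ar: "arrow a = bmul (idem (head (quiver P) a)) (arrow a)" "arrow a = bmul (arrow a) (idem (tail (quiver P) a))"
      using a by (simp_all add: bmul_def path_mult_def arrow_basis_paths)
    have "D (arrow a) = bmul (D (arrow a)) (idem (tail (quiver P) a))"
      using D'(4)[OF arrow_supported[OF a] idem_supported[OF tail_in_verts[OF a]]] zero[OF tail_in_verts[OF a]]
      by (simp add: N.mul_linear flip: ar(2))
    moreover have "D (arrow a) = bmul (idem (head (quiver P) a)) (D (arrow a))"
      using D'(4)[OF idem_supported[OF head_in_verts[OF a]] arrow_supported[OF a]] zero[OF head_in_verts[OF a]]
      by (simp add: N.mul_linear flip: ar(1))
    ultimately show ?thesis by metis
  qed
  have "D (arrow a) \<in> supported {p. (a, p) \<in> parallel_pairs P}" if a: "a \<in> arcs (quiver P)" for a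
  proof -
    have "bmul (idem (head (quiver P) a)) (bmul x (idem (tail (quiver P) a)))
      \<in> supported {p. (a, p) \<in> parallel_pairs P}" if "x \<in> supported (basis_paths P)" for x :: "('v, 'a) path \<Rightarrow>\<^sub>0 'b"
      unfolding bmul_def
    proof (rule supported_linear_mem[OF _ that])
      fix p assume "p \<in> basis_paths P"
      then show "nf P (pmul (quiver P) (idem (head (quiver P) a)) (nf P (pmul (quiver P) (Poly_Mapping.single p 1) (idem (tail (quiver P) a)))))
          \<in> supported {p. (a, p) \<in> parallel_pairs P}"
        using a by (auto simp: path_mult_def nf_linear pmul_linear parallel_pairs_def psource_def supported_closed
            intro!: supported_single)
    qed (intro pm_linear_intros')
    then show ?thesis using ends[OF a] D'(1)[OF arrow_supported[OF a]] by metis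
  qed
  then have "tag a (D (arrow a)) \<in> supported (parallel_pairs P)" if "a \<in> arcs (quiver P)" for a
    by (rule supported_mono[OF _ tag_supported[OF _], rotated]) (use that in auto)
  then have h_mem: "h \<in> supported (parallel_pairs P)"
    unfolding h_def by (rule supported_sum)
  \<comment> \<open>Stated for all paths, not only basis paths: for a relation the left side is
    D(0), and this is how \<open>h\<close> is seen to lie in the kernel.\<close>
  have nf_rep: "D (nf P (Poly_Mapping.single (u, xs) 1)) = nf P (replacement h (Poly_Mapping.single (u, xs) 1))"
    if "(u, xs) \<in> paths (quiver P)" for u xs
    using that
  proof (induction xs arbitrary: u)
    case Nil
    then have u: "u \<in> verts (quiver P)" by (simp add: paths_Nil)
    then show ?case
      using derivation_of_idem[of u h] by (simp add: trivial_basis_paths zero derivation_of_def idem_supported)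
  next
    case (Cons a xs)
    then have a: "a \<in> arcs (quiver P)" "u = tail (quiver P) a" "(head (quiver P) a, xs) \<in> paths (quiver P)"
      by (auto simp: paths_Cons)
    let ?xs = "Poly_Mapping.single (head (quiver P) a, xs) 1 :: ('v, 'a) path \<Rightarrow>\<^sub>0 'b"
    have eq: "Poly_Mapping.single (u, a # xs) 1 = pmul (quiver P) ?xs (arrow a)"
      using a by (simp add: path_mult_def)
    have xs: "?xs \<in> supported (paths (quiver P))" using a by (intro supported_single)
    have "D (nf P (pmul (quiver P) ?xs (arrow a))) = D (bmul (nf P ?xs) (arrow a))"
      by (simp only: bmul_def nf_pmul_left)
    also have "\<dots> = bmul (D (nf P ?xs)) (arrow a) + bmul (nf P ?xs) (D (arrow a))"
      by (rule D'(4)[OF nf_supported arrow_supported[OF a(1)]])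
    also have "\<dots> = nf P (pmul (quiver P) (replacement h ?xs) (arrow a) + pmul (quiver P) ?xs (replacement h (arrow a)))"
      unfolding Cons.IH[OF a(3)] replacement_arrow[OF h_mem] hv bmul_def
      using a(1) by (simp only: if_True nf_pmul_left nf_linear)
    also have "\<dots> = nf P (replacement h (pmul (quiver P) ?xs (arrow a)))"
      using replacement_pmul[OF h_mem xs supported_paths[OF arrow_supported[OF a(1)]]] by simp
    finally show ?case unfolding eq .
  qed
  have h_ker: "h \<in> ker_delta1 P"
    unfolding ker_delta1_iff
  proof (intro conjI h_mem ballI)
    fix r assume r: "r \<in> rels P"
    then have "rel_path P r \<notin> basis_paths P" by (auto simp: basis_paths_def rel_path_def)
    moreover have "D 0 = 0" using D'(2)[OF supported_closed(1), of 0] by simp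
    ultimately show "nf P (replacement h (Poly_Mapping.single (rel_path P r) 1)) = 0"
      using nf_rep[of "tail (quiver P) (hd r)" r] rels_path[OF r] by (simp add: rel_path_def)
  qed
  have "derivation_of h x = D x" if x: "x \<in> supported (basis_paths P)" for x
  proof -
    have "nf P (replacement h x) = D (nf P x)"
    proof (rule supported_linear_eqI[of "\<lambda>x. nf P (replacement h x)" "\<lambda>x. D (nf P x)", OF _ _ x])
      show "pm_linear (\<lambda>x. D (nf P x))"
        by (rule pm_linearI) (simp_all add: nf_linear D' nf_supported)
      fix p assume "p \<in> basis_paths P"
      then show "nf P (replacement h (Poly_Mapping.single p 1)) = D (nf P (Poly_Mapping.single p 1))"
        using nf_rep[of "fst p" "snd p"] basis_paths_subset[of P] by auto
    qed (intro pm_linear_intros')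
    then show ?thesis using x by (simp add: derivation_of_def nf_ident)
  qed
  then have "derivation_of h = D"
    by (intro N.derivation_eqI[OF derivation_of_derivation[OF h_ker] D])
  then show thesis using that h_ker hv by simp
qed

end

section \<open>The combinatorial description of the first Hochschild cohomology\<close>

definition ker_lie ::
  "('v, 'a) path_presentation \<Rightarrow> ('k::field, 'a \<times> ('v, 'a) path \<Rightarrow>\<^sub>0 'k) lie_struct" where
  "ker_lie P = \<lparr>carrier = ker_delta1 P, lzero = 0, ladd = (+), lscale = pm_scale,
     lbracket = parallel_bracket P\<rparr>"

lemma ker_lie_simps [simp]:
  "carrier (ker_lie P) = ker_delta1 P" "lzero (ker_lie P) = 0" "ladd (ker_lie P) = (+)"
  "lscale (ker_lie P) = pm_scale" "lbracket (ker_lie P) = parallel_bracket P"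
  by (simp_all add: ker_lie_def)

definition cycle_pairs :: "('v, 'a) path_presentation \<Rightarrow> ('v \<times> ('v, 'a) path) set" where
  "cycle_pairs P = {(v, p). v \<in> verts (quiver P) \<and> p \<in> basis_paths P \<and> psource p = v
     \<and> ptarget (quiver P) p = v}"

lemma vertex_parallel_eq: "vertex_parallel P = supported (cycle_pairs P)"
  by (simp add: parallel_space_def supported_def cycle_pairs_def)

text \<open>In e//p the vertex is the source of p, so on parallel pairs nothing is lost. The result
  is the algebra element whose commutators with the arrows make up \<delta>0.\<close>

definition forget_vertex :: "('v \<times> ('v, 'a) path \<Rightarrow>\<^sub>0 'k::field) \<Rightarrow> (('v, 'a) path \<Rightarrow>\<^sub>0 'k)" where
  "forget_vertex = linear_extension (\<lambda>z. Poly_Mapping.single (snd z) 1)"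

lemma pm_linear_forget_vertex: "pm_linear forget_vertex"
  unfolding forget_vertex_def by (rule pm_linear_linear_extension)

lemma pm_linear_delta0: "pm_linear (delta0 P)"
  unfolding delta0_def by (rule pm_linear_linear_extension)

lemma forget_vertex_supported:
  "y \<in> supported (cycle_pairs P) \<Longrightarrow> forget_vertex y \<in> supported (basis_paths P)"
  unfolding forget_vertex_def
  by (erule supported_linear_extension) (auto simp: cycle_pairs_def intro: supported_single)

context monomial begin

lemma ker_delta1_closed:
  "0 \<in> ker_delta1 P"
  "f \<in> ker_delta1 P \<Longrightarrow> g \<in> ker_delta1 P \<Longrightarrow> f + g \<in> ker_delta1 P"
  "f \<in> ker_delta1 P \<Longrightarrow> pm_scale c f \<in> ker_delta1 P"
  by (auto simp: ker_delta1_iff supported_closed replacement_linear nf_linear)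

text \<open>The commutator of the two derivations kills the idempotents, so it comes from some
  \<open>h\<close> in the kernel, and \<open>h\<close> agrees with the bracket on every arrow.
  Closure of the kernel under the bracket is a by-product.\<close>

lemma derivation_of_bracket:
  assumes f: "f \<in> ker_delta1 P" and g: "g \<in> ker_delta1 P"
  shows "parallel_bracket P f g \<in> ker_delta1 P"
    and "derivation_of (parallel_bracket P f g) = lbracket (Der N.alg) (derivation_of f) (derivation_of g)"
proof -
  note D = derivation_of_derivation[OF f] derivation_of_derivation[OF g]
  define E where "E = lbracket (Der N.alg) (derivation_of f) (derivation_of g)"
  have E: "E x = derivation_of f (derivation_of g x) - derivation_of g (derivation_of f x)"
    if "x \<in> supported (basis_paths P)" for x
    using that by (simp add: E_def N.Der_bracket[OF D])
  have fg: "f \<in> supported (parallel_pairs P)" "g \<in> supported (parallel_pairs P)"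
    using f g by (auto simp: ker_delta1_iff)
  have zero: "derivation_of h 0 = 0" for h :: "'a \<times> ('v, 'a) path \<Rightarrow>\<^sub>0 'b"
    by (simp add: derivation_of_def supported_closed replacement_linear nf_linear)
  have E_der: "E \<in> derivations N.alg"
    unfolding E_def N.Der_bracket[OF D] by (rule N.Der_closed[OF D])
  have E_idem: "E (idem v) = 0" if "v \<in> verts (quiver P)" for v
    using that by (simp add: E idem_supported derivation_of_idem zero)
  obtain h where h: "h \<in> ker_delta1 P" "derivation_of h = E"
      "\<And>a. a \<in> arcs (quiver P) \<Longrightarrow> value_at h a = E (arrow a)"
    using derivation_of_surj[OF E_der E_idem] by blast
  have "parallel_bracket P f g = h"
  proof (rule value_at_eqI)
    fix a
    show "value_at (parallel_bracket P f g) a = value_at h a"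
    proof (cases "a \<in> arcs (quiver P)")
      case True
      then show ?thesis
        using value_at_supported[OF fg(1), of a] value_at_supported[OF fg(2), of a]
        by (simp add: value_at_parallel_bracket h(3) E arrow_supported derivation_of_arrow fg)
          (simp add: derivation_of_def)
    next
      case False
      then have "value_at f a = 0" "value_at g a = 0" "value_at h a = 0"
        using value_at_not_arc fg h(1) by (auto simp: ker_delta1_iff)
      then show ?thesis by (simp add: value_at_parallel_bracket replacement_linear nf_linear)
    qed
  qed
  then show "parallel_bracket P f g \<in> ker_delta1 P"
    "derivation_of (parallel_bracket P f g) = lbracket (Der N.alg) (derivation_of f) (derivation_of g)"
    using h by (simp_all add: E_def)
qed

lemma lie_hom_derivation_of: "lie_hom (ker_lie P) (Der N.alg) derivation_of"
  unfolding lie_hom_def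
  by (simp add: N.Der_simps derivation_of_derivation derivation_of_bracket Pi_iff)
     (auto simp: derivation_of_def replacement_linear nf_linear intro!: restrict_ext)

text \<open>\<open>derivation_of\<close> is injective and identifies the kernel with a Lie
  subalgebra of \<open>Der\<close>; the laws, the Jacobi identity among them, are carried back along
  its inverse.\<close>

lemma lie_algebra_ker_lie: "lie_algebra (ker_lie P :: ('k::field, _) lie_struct)"
proof -
  let ?K = "ker_delta1 P :: ('a \<times> ('v, 'a) path \<Rightarrow>\<^sub>0 'k) set"
  let ?D = "derivation_of :: ('a \<times> ('v, 'a) path \<Rightarrow>\<^sub>0 'k) \<Rightarrow> _"
  let ?L = "(Der N.alg)\<lparr>carrier := ?D ` ?K\<rparr>"
  have inj: "inj_on ?D ?K"
    by (auto simp: inj_on_def ker_delta1_iff intro: derivation_of_inj)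
  have hom: "ladd (Der N.alg) (?D f) (?D g) = ?D (f + g)" "lscale (Der N.alg) c (?D f) = ?D (pm_scale c f)"
    "lbracket (Der N.alg) (?D f) (?D g) = ?D (parallel_bracket P f g)"
    if "f \<in> ?K" "g \<in> ?K" for f g c
    using lie_hom_derivation_of that by (auto simp: lie_hom_def)
  have zero: "lzero (Der N.alg) = ?D 0"
    by (simp add: N.Der_simps derivation_of_def replacement_linear nf_linear)
  interpret L: lie_algebra ?L
  proof (rule lie_algebra.sub_lie_algebra[OF N.lie_algebra_Der])
    show "?D ` ?K \<subseteq> carrier (Der N.alg)" by (auto simp: N.Der_simps derivation_of_derivation)
    show "lzero (Der N.alg) \<in> ?D ` ?K" by (simp add: zero ker_delta1_closed)
    show "lscale (Der N.alg) c x \<in> ?D ` ?K" if "x \<in> ?D ` ?K" for c x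
      using that by (auto simp: hom(2)[OF _ ker_delta1_closed(1)] ker_delta1_closed)
    show "ladd (Der N.alg) x y \<in> ?D ` ?K" "lbracket (Der N.alg) x y \<in> ?D ` ?K"
      if xy: "x \<in> ?D ` ?K" "y \<in> ?D ` ?K" for x y
    proof -
      obtain f g where "f \<in> ?K" "g \<in> ?K" "x = ?D f" "y = ?D g" using xy by blast
      then show "ladd (Der N.alg) x y \<in> ?D ` ?K" "lbracket (Der N.alg) x y \<in> ?D ` ?K"
        by (simp_all add: hom ker_delta1_closed derivation_of_bracket(1))
    qed
  qed
  have inv: "f \<in> ?K \<Longrightarrow> inv_into ?K ?D (?D f) = f" for f
    using inj by (rule inv_into_f_f)
  show ?thesis
  proof (rule lie_algebra_image[where h = "inv_into ?K ?D", OF L.lie_algebra_axioms])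
    show "lie_hom ?L (ker_lie P) (inv_into ?K ?D)"
      by (auto simp: lie_hom_def hom inv ker_delta1_closed derivation_of_bracket(1)
          hom(2)[OF _ ker_delta1_closed(1)])
    show "inv_into ?K ?D ` carrier ?L = carrier (ker_lie P)"
      by (auto simp: image_image inv)
    show "inv_into ?K ?D (lzero ?L) = lzero (ker_lie P)"
      by (simp add: zero inv ker_delta1_closed)
  qed
qed

section \<open>Splitting off an inner derivation\<close>

lemma idem_mult_idem:
  "v \<in> verts (quiver P) \<Longrightarrow> w \<in> verts (quiver P) \<Longrightarrow> bmul (idem v) (idem w) = (if v = w then idem v else 0)"
  by (simp add: bmul_def path_mult_def trivial_basis_paths nf_linear)

text \<open>The derivation \<open>D\<close> agrees on the idempotents with the inner derivation of
  \<open>\<Sum>\<^sub>v D(e\<^sub>v) e\<^sub>v\<close>.\<close>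

lemma derivation_decomposition:
  assumes D: "D \<in> derivations N.alg"
  obtains f m where "f \<in> ker_delta1 P" "m \<in> supported (basis_paths P)"
    "D = ladd (Der N.alg) (derivation_of f) (N.inner m)"
proof -
  note D' = N.derivationD[OF D]
  let ?V = "verts (quiver P)"
  define m where "m = (\<Sum>v\<in>?V. bmul (D (idem v)) (idem v))"
  have m: "m \<in> supported (basis_paths P)"
    unfolding m_def by (intro supported_sum N.mul_closed D' idem_supported)
  have inner_m: "N.inner m (idem w) = D (idem w)" if w: "w \<in> ?V" for w
  proof -
    let ?x = "D (idem w)"
    have "bmul m (idem w) = (\<Sum>v\<in>?V. bmul (D (idem v)) (bmul (idem v) (idem w)))"
      unfolding m_def pm_linear_sum[OF N.mul_left_linear]
      by (intro sum.cong) (auto simp: N.mul_assoc D' idem_supported w)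
    also have "\<dots> = (\<Sum>v\<in>?V. if v = w then bmul ?x (idem w) else 0)"
      by (intro sum.cong) (auto simp: idem_mult_idem w N.mul_linear)
    finally have left: "bmul m (idem w) = bmul ?x (idem w)" using w by simp
    have "bmul (idem w) (bmul (D (idem v)) (idem v)) = (if v = w then bmul ?x (idem v) else 0) - bmul ?x (idem v)"
      if v: "v \<in> ?V" for v
    proof -
      \<comment> \<open>Differentiating the orthogonality relation for \<open>idem w\<close> and
        \<open>idem v\<close> determines \<open>idem w\<close> times
        D(\<open>idem v\<close>).\<close>
      have "D (bmul (idem w) (idem v)) = bmul ?x (idem v) + bmul (idem w) (D (idem v))"
        using v w by (intro D' idem_supported)
      then have *: "bmul (idem w) (D (idem v)) = (if v = w then D (idem v) else 0) - bmul ?x (idem v)"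
        using D'(2)[OF supported_closed(1), of 0] v w by (auto simp: idem_mult_idem algebra_simps)
      have "bmul (idem w) (bmul (D (idem v)) (idem v)) = bmul (bmul (idem w) (D (idem v))) (idem v)"
        using v w by (simp add: N.mul_assoc D' idem_supported)
      also have "\<dots> = (if v = w then bmul ?x (idem v) else 0) - bmul (bmul ?x (idem v)) (idem v)"
        unfolding * by (simp add: N.mul_linear)
      also have "bmul (bmul ?x (idem v)) (idem v) = bmul ?x (idem v)"
        using v w by (simp add: N.mul_assoc D' idem_supported idem_mult_idem)
      finally show ?thesis .
    qed
    \<comment> \<open>In the sum over v the idempotents add up to the unit, so the second part
      contributes minus \<open>?x\<close> itself.\<close>
    then have "bmul (idem w) m = (\<Sum>v\<in>?V. (if v = w then bmul ?x (idem v) else 0) - bmul ?x (idem v))"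
      unfolding m_def pm_linear_sum[OF N.mul_right_linear] by (intro sum.cong) auto
    also have "\<dots> = bmul ?x (idem w) - bmul ?x (vertex_sum (quiver P))"
      using w by (simp add: sum_subtractf vertex_sum_def pm_linear_sum[OF N.mul_right_linear])
    also have "bmul ?x (vertex_sum (quiver P)) = ?x"
      using w by (simp add: bmul_def vertex_sum_unit supported_paths nf_ident D' idem_supported)
    finally have "bmul (idem w) m = bmul ?x (idem w) - ?x" .
    with left show ?thesis using w by (simp add: N.inner_def idem_supported)
  qed
  define E where "E = ladd (Der N.alg) D (lscale (Der N.alg) (- 1) (N.inner m))"
  interpret L: lie_algebra "Der N.alg" by (rule N.lie_algebra_Der)
  have car: "D \<in> carrier (Der N.alg)" "N.inner m \<in> carrier (Der N.alg)"
    using D m by (simp_all add: N.Der_simps N.inner_derivation)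
  have "E \<in> carrier (Der N.alg)"
    unfolding E_def by (intro L.add_closed L.scale_closed car)
  then have E_der: "E \<in> derivations N.alg" by (simp only: N.Der_simps)
  have E_idem: "E (idem v) = 0" if "v \<in> ?V" for v
    using that by (simp add: E_def N.Der_simps idem_supported inner_m pm_scale_uminus_one)
  obtain f where f: "f \<in> ker_delta1 P" "derivation_of f = E"
    using derivation_of_surj[OF E_der E_idem] by metis
  have "ladd (Der N.alg) (N.inner m) E = D"
    unfolding E_def using car by (intro L.add_diff_cancel)
  moreover have "E \<in> carrier (Der N.alg)" using E_der by (simp add: N.Der_simps)
  ultimately have "D = ladd (Der N.alg) (derivation_of f) (N.inner m)"
    using car f(2) L.add_commute by metis
  with f m that show thesis by blast
qed

text \<open>Serves to show that an element commuting with all idempotents is a combination of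
  cycles.\<close>

lemma lookup_bmul_idem:
  assumes "m \<in> supported (basis_paths P)"
  shows "Poly_Mapping.lookup (bmul m (idem v)) p = (if psource p = v then Poly_Mapping.lookup m p else 0)"
    and "Poly_Mapping.lookup (bmul (idem v) m) p = (if ptarget (quiver P) p = v then Poly_Mapping.lookup m p else 0)"
proof -
  have "bmul m (idem v) = linear_extension (\<lambda>p. if psource p = v then Poly_Mapping.single p 1 else 0) m"
    by (rule supported_linear_eqI[OF N.mul_left_linear _ assms])
      (auto simp: bmul_def path_mult_def nf_linear intro!: pm_linear_intros)
  moreover have "(psource q = v \<and> q = p) = (q = p \<and> psource p = v)" for q by auto
  ultimately show "Poly_Mapping.lookup (bmul m (idem v)) p = (if psource p = v then Poly_Mapping.lookup m p else 0)"
    by (simp add: lookup_linear_extension_partial in_keys_iff)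
  have "bmul (idem v) m = linear_extension (\<lambda>p. if ptarget (quiver P) p = v then Poly_Mapping.single p 1 else 0) m"
    by (rule supported_linear_eqI[OF N.mul_right_linear _ assms])
      (auto simp: bmul_def path_mult_def psource_def nf_linear intro!: pm_linear_intros)
  moreover have "(ptarget (quiver P) q = v \<and> q = p) = (q = p \<and> ptarget (quiver P) p = v)" for q by auto
  ultimately show "Poly_Mapping.lookup (bmul (idem v) m) p = (if ptarget (quiver P) p = v then Poly_Mapping.lookup m p else 0)"
    by (simp add: lookup_linear_extension_partial in_keys_iff)
qed

text \<open>With m the forgotten cycle vector, \<delta>0 sends a to am - ma, whereas
  \<open>inner\<close> uses mx - xm. This is the origin of the minus signs below.\<close>

lemma value_at_delta0:
  fixes y :: "'v \<times> ('v, 'a) path \<Rightarrow>\<^sub>0 'k::field"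
  assumes "y \<in> supported (cycle_pairs P)"
  shows "value_at (delta0 P y) a = (if a \<in> arcs (quiver P)
    then bmul (arrow a) (forget_vertex y) - bmul (forget_vertex y) (arrow a) else 0)"
proof (rule supported_linear_eqI[of "\<lambda>y. value_at (delta0 P y) a"
      "\<lambda>y. if a \<in> arcs (quiver P) then bmul (arrow a) (forget_vertex y) - bmul (forget_vertex y) (arrow a) else 0",
      OF _ _ assms])
  show "pm_linear (\<lambda>y. if a \<in> arcs (quiver P)
      then bmul (arrow a) (forget_vertex y) - bmul (forget_vertex y) (arrow a) else 0)"
    by (intro pm_linear_if pm_linear_minus pm_linear_compose[OF N.mul_left_linear]
        pm_linear_compose[OF N.mul_right_linear] pm_linear_forget_vertex)
  fix z assume "z \<in> cycle_pairs P"
  then obtain p where z: "z = (psource p, p)" "p \<in> basis_paths P" "ptarget (quiver P) p = psource p"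
    by (auto simp: cycle_pairs_def)
  have *: "value_at (\<Sum>b | b \<in> arcs (quiver P) \<and> C b \<and> F b \<in> basis_paths P. Poly_Mapping.single (b, F b) 1) a
      = (if a \<in> arcs (quiver P) \<and> C a then nf P (Poly_Mapping.single (F a) 1) else (0 :: _ \<Rightarrow>\<^sub>0 'k))" for C F
    by (simp add: value_at_linear)
  have delta: "delta0 P (Poly_Mapping.single z (1 :: 'k))
      = (\<Sum>b | b \<in> arcs (quiver P) \<and> tail (quiver P) b = psource p \<and> (psource p, snd p @ [b]) \<in> basis_paths P.
          Poly_Mapping.single (b, (psource p, snd p @ [b])) 1)
      - (\<Sum>b | b \<in> arcs (quiver P) \<and> head (quiver P) b = psource p \<and> (tail (quiver P) b, b # snd p) \<in> basis_paths P.
          Poly_Mapping.single (b, (tail (quiver P) b, b # snd p)) 1)"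
    by (subst z(1)) (simp add: delta0_def Let_def)
  have "forget_vertex (Poly_Mapping.single z (1 :: 'k)) = Poly_Mapping.single p 1"
    by (subst z(1)) (simp add: forget_vertex_def)
  then show "value_at (delta0 P (Poly_Mapping.single z (1 :: 'k))) a = (if a \<in> arcs (quiver P)
      then bmul (arrow a) (forget_vertex (Poly_Mapping.single z (1 :: 'k)))
        - bmul (forget_vertex (Poly_Mapping.single z (1 :: 'k))) (arrow a) else 0)"
    unfolding delta value_at_linear(2) *
    by (auto simp: bmul_def path_mult_def z(3) nf_linear simp del: nf_single)
qed (rule pm_linear_compose[OF pm_linear_value_at pm_linear_delta0])

text \<open>Cycles commute with the idempotents, so the inner derivation kills these and comes from
  an element of the kernel. That element and \<delta>0(y) have the same values on arrows.\<close>

lemma derivation_of_delta0: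
  assumes y: "y \<in> supported (cycle_pairs P)"
  shows "delta0 P y \<in> ker_delta1 P"
    and "derivation_of (delta0 P y) = N.inner (- forget_vertex y)"
proof -
  let ?m = "- forget_vertex y"
  have m: "?m \<in> supported (basis_paths P)" using forget_vertex_supported[OF y] by (rule supported_closed)
  have "bmul (forget_vertex y) (idem v) = bmul (idem v) (forget_vertex y)" for v
    by (rule supported_linear_eqI[of "\<lambda>y. bmul (forget_vertex y) (idem v)" "\<lambda>y. bmul (idem v) (forget_vertex y)", OF _ _ y])
      (auto simp: forget_vertex_def bmul_def path_mult_def cycle_pairs_def psource_def
        intro!: pm_linear_intros pm_linear_compose[OF pm_linear_nf])
  then have zero: "N.inner ?m (idem v) = 0" if "v \<in> verts (quiver P)" for v
    using that by (simp add: N.inner_def idem_supported N.mul_linear)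
  obtain h where h: "h \<in> ker_delta1 P" "derivation_of h = N.inner ?m"
      "\<And>a. a \<in> arcs (quiver P) \<Longrightarrow> value_at h a = N.inner ?m (arrow a)"
    using derivation_of_surj[OF N.inner_derivation[OF m] zero] by blast
  have "h = delta0 P y"
  proof (rule value_at_eqI)
    fix a
    show "value_at h a = value_at (delta0 P y) a"
      using h value_at_not_arc[of h a]
      by (auto simp: value_at_delta0[OF y] N.inner_def arrow_supported N.mul_linear ker_delta1_iff)
  qed
  with h show "delta0 P y \<in> ker_delta1 P" "derivation_of (delta0 P y) = N.inner ?m" by simp_all
qed

lemma im_delta0_subset: "im_delta0 P \<subseteq> ker_delta1 P"
  by (auto simp: im_delta0_def vertex_parallel_eq derivation_of_delta0)

text \<open>If \<open>derivation_of f\<close> is inner by m, it kills the idempotents, so m commutes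
  with them and is supported on cycles. Hence m is the forgotten form of some y, and f is
  \<delta>0(-y).\<close>

lemma derivation_of_inner_iff:
  assumes f: "f \<in> ker_delta1 P"
  shows "derivation_of f \<in> Inn N.alg \<longleftrightarrow> f \<in> im_delta0 P"
proof
  assume "f \<in> im_delta0 P"
  then show "derivation_of f \<in> Inn N.alg"
    by (auto simp: im_delta0_def vertex_parallel_eq derivation_of_delta0 N.Inn_eq forget_vertex_supported
        intro!: imageI supported_closed)
next
  assume "derivation_of f \<in> Inn N.alg"
  then obtain m where m: "m \<in> supported (basis_paths P)" "derivation_of f = N.inner m"
    by (auto simp: N.Inn_eq)
  have comm: "bmul m (idem v) = bmul (idem v) m" if "v \<in> verts (quiver P)" for v
  proof -
    have "N.inner m (idem v) = 0" using derivation_of_idem[OF that, of f] m(2) by simp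
    then show ?thesis using that by (simp add: N.inner_def idem_supported)
  qed
  have "m \<in> supported {p \<in> basis_paths P. ptarget (quiver P) p = psource p}"
    unfolding supported_def
  proof safe
    fix p assume p: "p \<in> Poly_Mapping.keys m"
    then show p': "p \<in> basis_paths P" using m(1) by (auto simp: supported_def)
    then have "psource p \<in> verts (quiver P)" using basis_paths_subset[of P] psource_in_verts by blast
    \<comment> \<open>On the left p keeps its coefficient; on the right it does so only if it also
      ends at its source.\<close>
    then have "Poly_Mapping.lookup (bmul m (idem (psource p))) p = Poly_Mapping.lookup (bmul (idem (psource p)) m) p"
      by (simp only: comm)
    then show "ptarget (quiver P) p = psource p"
      using p m(1) by (auto simp: lookup_bmul_idem in_keys_iff split: if_splits)
  qed
  note m' = this
  define y where "y = linear_extension (\<lambda>p. Poly_Mapping.single (psource p, p) 1) m"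
  have y: "y \<in> supported (cycle_pairs P)"
    unfolding y_def using m'
    by (rule supported_linear_extension)
      (use basis_paths_subset[of P] psource_in_verts in \<open>auto simp: cycle_pairs_def intro!: supported_single\<close>)
  have "forget_vertex y = m"
    unfolding y_def
    by (rule pm_linear_eqI[of "\<lambda>m. forget_vertex (linear_extension (\<lambda>p. Poly_Mapping.single (psource p, p) 1) m)" "\<lambda>m. m"])
      (auto simp: forget_vertex_def intro!: pm_linear_intros)
  then have "derivation_of (delta0 P (- y)) = derivation_of f"
    using y m(2) by (simp add: derivation_of_delta0 supported_closed pm_linear_uminus[OF pm_linear_forget_vertex])
  then have "f = delta0 P (- y)"
    using derivation_of_delta0(1)[of "- y"] y f
    by (intro derivation_of_inj) (auto simp: ker_delta1_iff supported_closed)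
  then show "f \<in> im_delta0 P" using y by (auto simp: im_delta0_def vertex_parallel_eq supported_closed)
qed

text \<open>The identification with Ker/Im, given as a surjection from Ker with kernel Im so that no
  second quotient has to be formed. Surjectivity holds because a derivation differs from some
  \<open>derivation_of f\<close> by an inner one.\<close>

theorem HH1_combinatorial:
  obtains \<theta> where "lie_algebra (HH1 (presented_algebra P :: ('k::field, _) module))"
    "lie_hom (ker_lie P) (HH1 (presented_algebra P :: ('k, _) module)) \<theta>"
    "\<theta> ` ker_delta1 P = carrier (HH1 (presented_algebra P :: ('k, _) module))"
    "\<And>f. f \<in> ker_delta1 P \<Longrightarrow>
      \<theta> f = lzero (HH1 (presented_algebra P :: ('k, _) module)) \<longleftrightarrow> f \<in> im_delta0 P"
proof -
  let ?H = "HH1 (presented_algebra P :: ('k, _) module)"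
  obtain \<eta> where \<eta>: "lie_algebra ?H" "lie_hom (Der N.alg) ?H \<eta>" "\<eta> ` derivations N.alg = carrier ?H"
    "\<And>D. D \<in> derivations N.alg \<Longrightarrow> \<eta> D = lzero ?H \<longleftrightarrow> D \<in> Inn N.alg"
    using HH1_presented_algebra by blast
  interpret H: lie_algebra ?H by fact
  show thesis
  proof (rule that[of "\<lambda>f. \<eta> (derivation_of f)"])
    show "lie_hom (ker_lie P) ?H (\<lambda>f. \<eta> (derivation_of f))"
      by (rule lie_hom_compose[OF lie_hom_derivation_of \<eta>(2)])
    show "(\<lambda>f. \<eta> (derivation_of f)) ` ker_delta1 P = carrier ?H"
    proof
      show "(\<lambda>f. \<eta> (derivation_of f)) ` ker_delta1 P \<subseteq> carrier ?H"
        using \<eta>(3) derivation_of_derivation by blast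
      show "carrier ?H \<subseteq> (\<lambda>f. \<eta> (derivation_of f)) ` ker_delta1 P"
      proof
        fix h assume "h \<in> carrier ?H"
        then obtain D where D: "D \<in> derivations N.alg" "h = \<eta> D" using \<eta>(3) by blast
        obtain f m where f: "f \<in> ker_delta1 P" and m: "m \<in> supported (basis_paths P)"
          and D_eq: "D = ladd (Der N.alg) (derivation_of f) (N.inner m)"
          using derivation_decomposition[OF D(1)] by blast
        have der: "derivation_of f \<in> derivations N.alg" "N.inner m \<in> derivations N.alg"
          using f m by (simp_all add: derivation_of_derivation N.inner_derivation)
        have "\<eta> (N.inner m) = lzero ?H" using \<eta>(4)[OF der(2)] m by (simp add: N.Inn_eq)
        moreover have "h = ladd ?H (\<eta> (derivation_of f)) (\<eta> (N.inner m))"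
          unfolding D(2) D_eq using \<eta>(2) der by (simp add: lie_hom_def N.Der_simps)
        moreover have "\<eta> (derivation_of f) \<in> carrier ?H" using \<eta>(3) der(1) by blast
        ultimately show "h \<in> (\<lambda>f. \<eta> (derivation_of f)) ` ker_delta1 P"
          using f by (auto simp: H.add_zero_right)
      qed
    qed
    show "\<eta> (derivation_of f) = lzero ?H \<longleftrightarrow> f \<in> im_delta0 P" if "f \<in> ker_delta1 P" for f
      using \<eta>(4)[OF derivation_of_derivation[OF that]] derivation_of_inner_iff[OF that] by simp
  qed fact
qed

end

section \<open>Opposite and dual extension presentations\<close>

definition opposite_quiver :: "('v, 'a) pre_digraph \<Rightarrow> ('v, 'a) pre_digraph" where
  "opposite_quiver Q = \<lparr>verts = verts Q, arcs = arcs Q, tail = head Q, head = tail Q\<rparr>"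

lemma opposite_quiver_simps [simp]:
  "verts (opposite_quiver Q) = verts Q" "arcs (opposite_quiver Q) = arcs Q"
  "tail (opposite_quiver Q) = head Q" "head (opposite_quiver Q) = tail Q"
  "opposite_quiver (opposite_quiver Q) = Q"
  by (simp_all add: opposite_quiver_def)

lemma op_presentation_simps [simp]:
  "quiver (op_presentation P) = opposite_quiver (quiver P)" "rels (op_presentation P) = rev ` rels P"
  by (simp_all add: op_presentation_def opposite_quiver_def)

lemma wf_digraph_opposite: "wf_digraph Q \<Longrightarrow> wf_digraph (opposite_quiver Q)"
  by (simp add: wf_digraph_def)

lemma opposite_path:
  assumes "wf_digraph Q" "(u, xs) \<in> paths Q"
  shows "(ptarget Q (u, xs), rev xs) \<in> paths (opposite_quiver Q)
    \<and> ptarget (opposite_quiver Q) (ptarget Q (u, xs), rev xs) = u"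
proof -
  interpret Q: wf_digraph Q by fact
  interpret O: wf_digraph "opposite_quiver Q" using assms(1) by (rule wf_digraph_opposite)
  show ?thesis
    using assms(2)
  proof (induction xs arbitrary: u)
    case (Cons a xs)
    then have a: "a \<in> arcs Q" "u = tail Q a" "(head Q a, xs) \<in> paths Q" by (auto simp: Q.paths_Cons)
    with Cons.IH[OF a(3)] show ?case by (simp add: O.paths_append O.paths_Cons paths_Nil)
  qed (simp add: paths_Nil)
qed

lemma ptarget_last: "xs \<noteq> [] \<Longrightarrow> ptarget Q (u, xs) = head Q (last xs)"
  by (induction xs arbitrary: u) auto

lemma monomial_opposite:
  assumes "monomial_presentation P"
  shows "monomial_presentation (op_presentation P)"
proof -
  interpret P: monomial P by unfold_locales fact
  have wf: "wf_digraph (quiver P)" by (rule P.wf_digraph)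
  have fin: "fin_digraph (opposite_quiver (quiver P))"
    by unfold_locales auto
  have rel: "2 \<le> length z \<and> rel_path (op_presentation P) z \<in> paths (opposite_quiver (quiver P))"
    if z: "z \<in> rev ` rels P" for z
  proof -
    obtain r where r: "r \<in> rels P" "z = rev r" using z by blast
    have "r \<noteq> []" using P.rels_length[OF r(1)] by auto
    then have "rel_path (op_presentation P) z = (ptarget (quiver P) (rel_path P r), rev r)"
      by (simp add: rel_path_def r(2) ptarget_last hd_rev)
    then show ?thesis
      using opposite_path[OF wf, of "tail (quiver P) (hd r)" r] P.rels_path[OF r(1)] P.rels_length[OF r(1)] r
      by (simp add: rel_path_def)
  qed
  obtain N where N: "\<forall>p\<in>paths (quiver P). N \<le> length (snd p) \<longrightarrow> (\<exists>z\<in>rels P. sublist z (snd p))"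
    using assms unfolding monomial_presentation_def by blast
  have "\<exists>z\<in>rev ` rels P. sublist z xs"
    if path: "(u, xs) \<in> paths (opposite_quiver (quiver P))" and len: "N \<le> length xs" for u xs
  proof -
    have "(ptarget (opposite_quiver (quiver P)) (u, xs), rev xs) \<in> paths (quiver P)"
      using opposite_path[OF wf_digraph_opposite[OF wf] path] by simp
    then obtain z where "z \<in> rels P" "sublist z (rev xs)" using N len by fastforce
    then show ?thesis by (intro bexI[of _ "rev z"]) (auto simp: sublist_rev_left)
  qed
  then show ?thesis
    unfolding monomial_presentation_def op_presentation_simps
    using fin rel P.rels_minimal by (auto simp: sublist_rev intro!: exI[of _ N])
qed

text \<open>\<open>C\<close> stands for \<open>A\<close> reversed, so its arrows descend, and the
  last assumption is the component condition for reversed arrows. In this form \<open>A\<close>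
  itself disappears from the argument.\<close>

locale dual_ext =
  fixes B :: "('v::linorder, 'b) path_presentation" and C :: "('v, 'c) path_presentation"
  assumes B_directed: "directed_monomial B"
    and C_mono: "monomial_presentation C"
    and C_decreasing: "c \<in> arcs (quiver C) \<Longrightarrow> head (quiver C) c < tail (quiver C) c"
    and verts_eq: "verts (quiver C) = verts (quiver B)"
    and C_within: "c \<in> arcs (quiver C) \<Longrightarrow>
      (tail (quiver C) c, head (quiver C) c) \<in> (arcs_ends (quiver B) \<union> (arcs_ends (quiver B))\<inverse>)\<^sup>*"
begin

abbreviation Lam :: "('v, 'b + 'c) path_presentation" where
  "Lam \<equiv> dual_extension B C"

lemma B_increasing: "b \<in> arcs (quiver B) \<Longrightarrow> tail (quiver B) b < head (quiver B) b"
  using B_directed by (simp add: directed_monomial_def)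

sublocale B: monomial B
  using B_directed by unfold_locales (simp add: directed_monomial_def)

sublocale C: monomial C
  by unfold_locales (rule C_mono)

lemma quiver_Lam [simp]:
  "verts (quiver Lam) = verts (quiver B)"
  "Inl b \<in> arcs (quiver Lam) \<longleftrightarrow> b \<in> arcs (quiver B)"
  "Inr c \<in> arcs (quiver Lam) \<longleftrightarrow> c \<in> arcs (quiver C)"
  "tail (quiver Lam) (Inl b) = tail (quiver B) b" "tail (quiver Lam) (Inr c) = tail (quiver C) c"
  "head (quiver Lam) (Inl b) = head (quiver B) b" "head (quiver Lam) (Inr c) = head (quiver C) c"
  by (auto simp: dual_extension_def)

lemma arcs_Lam: "arcs (quiver Lam) = Inl ` arcs (quiver B) \<union> Inr ` arcs (quiver C)"
  by (simp add: dual_extension_def)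

lemma rels_Lam_cases [consumes 1, case_names Inl Inr mixed]:
  assumes "r \<in> rels Lam"
  obtains z where "r = map Inl z" "z \<in> rels B" | z' where "r = map Inr z'" "z' \<in> rels C"
  | b c where "r = [Inr c, Inl b]" "b \<in> arcs (quiver B)" "c \<in> arcs (quiver C)"
      "head (quiver C) c = tail (quiver B) b"
  using assms by (auto simp: dual_extension_def)

lemma rels_Lam_intros:
  "z \<in> rels B \<Longrightarrow> map Inl z \<in> rels Lam" "z' \<in> rels C \<Longrightarrow> map Inr z' \<in> rels Lam"
  "b \<in> arcs (quiver B) \<Longrightarrow> c \<in> arcs (quiver C) \<Longrightarrow> head (quiver C) c = tail (quiver B) b
     \<Longrightarrow> [Inr c, Inl b] \<in> rels Lam"
  by (auto simp: dual_extension_def)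

lemma fin_digraph_Lam: "fin_digraph (quiver Lam)"
  by unfold_locales (auto simp: arcs_Lam verts_eq[symmetric] C.head_in_verts C.tail_in_verts,
    auto simp: verts_eq)

interpretation Q: fin_digraph "quiver Lam" by (rule fin_digraph_Lam)

lemma ptarget_Inl [simp]: "ptarget (quiver Lam) (u, map Inl xs) = ptarget (quiver B) (u, xs)"
  by (induction xs arbitrary: u) simp_all

lemma ptarget_Inr [simp]: "ptarget (quiver Lam) (u, map Inr xs) = ptarget (quiver C) (u, xs)"
  by (induction xs arbitrary: u) simp_all

lemma paths_Inl [simp]: "(u, map Inl xs) \<in> paths (quiver Lam) \<longleftrightarrow> (u, xs) \<in> paths (quiver B)"
  by (induction xs arbitrary: u) (simp_all add: Q.paths_Cons B.paths_Cons paths_Nil)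

lemma paths_Inr [simp]: "(u, map Inr xs) \<in> paths (quiver Lam) \<longleftrightarrow> (u, xs) \<in> paths (quiver C)"
  by (induction xs arbitrary: u) (simp_all add: Q.paths_Cons C.paths_Cons paths_Nil verts_eq)

text \<open>Inside a path an arrow of C followed by one of B is composable, hence a mixed relation.
  Without such a step all arrows of B come first.\<close>

lemma path_normal_form:
  assumes "(u, ws) \<in> paths (quiver Lam)"
    and "\<And>b c. [Inr c, Inl b] \<in> rels Lam \<Longrightarrow> \<not> sublist [Inr c, Inl b] ws"
  shows "\<exists>ps qs. ws = map Inl ps @ map Inr qs"
  using assms
proof (induction ws arbitrary: u)
  case (Cons a ws)
  have a: "a \<in> arcs (quiver Lam)" "(head (quiver Lam) a, ws) \<in> paths (quiver Lam)"
    using Cons.prems(1) by (auto simp: Q.paths_Cons)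
  have "\<not> sublist [Inr c, Inl b] ws" if "[Inr c, Inl b] \<in> rels Lam" for b c
    using Cons.prems(2)[OF that] sublist_order.order_trans[of _ ws "a # ws"]
      sublist_append_leftI[of ws "[a]"] by auto
  then obtain ps qs where ws: "ws = map Inl ps @ map Inr qs" using Cons.IH[OF a(2)] by blast
  show ?case
  proof (cases a)
    case (Inl b)
    then have "a # ws = map Inl (b # ps) @ map Inr qs" using ws by simp
    then show ?thesis by blast
  next
    case (Inr c)
    have "ps = []"
    proof (cases ps)
      case (Cons b ps')
      then have "[Inr c, Inl b] \<in> rels Lam"
        using a ws Inr by (intro rels_Lam_intros) (auto simp: Q.paths_Cons)
      moreover have "sublist [Inr c, Inl b] (a # ws)"
        using ws Inr Cons sublist_append_rightI[of "[Inr c, Inl b]" "map Inl ps' @ map Inr qs"] by simp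
      ultimately show ?thesis using Cons.prems(2) by blast
    qed
    then have "a # ws = map Inl [] @ map Inr (c # qs)" using ws Inr by simp
    then show ?thesis by blast
  qed
qed (auto intro: exI[of _ "[]"])

lemma sublist_map_inj: "inj f \<Longrightarrow> sublist (map f xs) (map f ys) \<longleftrightarrow> sublist xs ys"
  by (metis list.map_comp inv_o_cancel list.map_id map_mono_sublist)

text \<open>Minimality: a relation of B and one of C share no arrows, neither contains a mixed one,
  and a mixed relation of length two has no shorter relation inside. Admissibility: a path of length
  \<open>M + N\<close> without mixed relations has at least \<open>M\<close> arrows in its B part or
  at least \<open>N\<close> in its C part.\<close>

lemma monomial_Lam: "monomial_presentation Lam"
  unfolding monomial_presentation_def
proof (intro conjI ballI impI)
  show "fin_digraph (quiver Lam)" by (rule fin_digraph_Lam)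
  fix z assume z: "z \<in> rels Lam"
  then show "2 \<le> length z" using B.rels_length C.rels_length by (cases rule: rels_Lam_cases) auto
  show "rel_path Lam z \<in> paths (quiver Lam)"
    using z
  proof (cases rule: rels_Lam_cases)
    case (Inl r)
    then have "r \<noteq> []" using B.rels_length by force
    then show ?thesis using B.rels_path[OF Inl(2)] Inl(1) by (simp add: rel_path_def hd_map)
  next
    case (Inr r)
    then have "r \<noteq> []" using C.rels_length by force
    then show ?thesis using C.rels_path[OF Inr(2)] Inr(1) by (simp add: rel_path_def hd_map)
  next
    case (mixed b c)
    then show ?thesis by (simp add: rel_path_def Q.paths_Cons paths_Nil)
  qed
  fix z' assume z': "z' \<in> rels Lam" and sub: "sublist z' z"
  have set: "set z' \<subseteq> set z" using sub by (rule set_mono_sublist)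
  have len: "length z' \<le> length z" using sub by (rule sublist_length_le)
  have two: "2 \<le> length z'" using z' B.rels_length C.rels_length by (cases rule: rels_Lam_cases) auto
  show "z' = z"
    using z
  proof (cases rule: rels_Lam_cases)
    case (Inl r)
    show ?thesis
      using z'
    proof (cases rule: rels_Lam_cases)
      case Inl': (Inl r')
      then show ?thesis using Inl sub B.rels_minimal by (auto simp: sublist_map_inj)
    qed (use Inl set two in \<open>auto simp: neq_Nil_conv Suc_le_length_iff numeral_2_eq_2\<close>)
  next
    case (Inr r)
    show ?thesis
      using z'
    proof (cases rule: rels_Lam_cases)
      case Inr': (Inr r')
      then show ?thesis using Inr sub C.rels_minimal by (auto simp: sublist_map_inj)
    qed (use Inr set two in \<open>auto simp: neq_Nil_conv Suc_le_length_iff numeral_2_eq_2\<close>)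
  next
    case (mixed b c)
    then have "length z' = length z" using len two by simp
    then show ?thesis using sub by (auto simp: sublist_def)
  qed
next
  obtain M where M: "\<forall>p\<in>paths (quiver B). M \<le> length (snd p) \<longrightarrow> (\<exists>z\<in>rels B. sublist z (snd p))"
    using B.mono unfolding monomial_presentation_def by blast
  obtain N where N: "\<forall>p\<in>paths (quiver C). N \<le> length (snd p) \<longrightarrow> (\<exists>z\<in>rels C. sublist z (snd p))"
    using C.mono unfolding monomial_presentation_def by blast
  have "\<exists>z\<in>rels Lam. sublist z ws" if ws: "(u, ws) \<in> paths (quiver Lam)" "M + N \<le> length ws" for u ws
  proof (rule ccontr)
    assume none: "\<not> (\<exists>z\<in>rels Lam. sublist z ws)"
    then obtain ps qs where eq: "ws = map Inl ps @ map Inr qs" using path_normal_form[OF ws(1)] by blast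
    have paths: "(u, ps) \<in> paths (quiver B)" "(ptarget (quiver B) (u, ps), qs) \<in> paths (quiver C)"
      using ws(1) by (auto simp: eq Q.paths_append)
    consider "M \<le> length ps" | "N \<le> length qs" using ws(2) eq by fastforce
    then show False
    proof cases
      case 1
      then obtain z where "z \<in> rels B" "sublist z ps" using M paths(1) by force
      then show False
        using none rels_Lam_intros(1) eq sublist_order.order_trans[of "map Inl z" "map Inl ps" ws]
        by (auto simp: map_mono_sublist)
    next
      case 2
      then obtain z where "z \<in> rels C" "sublist z qs" using N paths(2) by force
      then show False
        using none rels_Lam_intros(2) eq sublist_order.order_trans[of "map Inr z" "map Inr qs" ws]
        by (auto simp: map_mono_sublist)
    qed
  qed
  then show "\<exists>N. \<forall>p\<in>paths (quiver Lam). N \<le> length (snd p) \<longrightarrow> (\<exists>z\<in>rels Lam. sublist z (snd p))"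
    by (intro exI[of _ "M + N"]) auto
qed

sublocale L: monomial Lam
  by unfold_locales (rule monomial_Lam)

section \<open>Basis paths of the dual extension and the effect of directedness\<close>

lemma basis_normal_form:
  assumes "(u, ws) \<in> basis_paths Lam"
  obtains ps qs where "ws = map Inl ps @ map Inr qs" "(u, ps) \<in> paths (quiver B)"
    "(ptarget (quiver B) (u, ps), qs) \<in> paths (quiver C)"
proof -
  obtain ps qs where ws: "ws = map Inl ps @ map Inr qs"
    using assms path_normal_form[of u ws] by (auto simp: L.basis_paths_iff)
  then show thesis using that assms by (simp add: L.basis_paths_iff Q.paths_append)
qed

text \<open>A relation all of whose arrows lie in B is a relation of B.\<close>

lemma basis_paths_Inl [simp]: "(u, map Inl ps) \<in> basis_paths Lam \<longleftrightarrow> (u, ps) \<in> basis_paths B"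
proof -
  have "(\<exists>z\<in>rels Lam. sublist z (map Inl ps)) \<longleftrightarrow> (\<exists>z\<in>rels B. sublist z ps)"
  proof
    assume "\<exists>z\<in>rels Lam. sublist z (map Inl ps)"
    then obtain r where r: "r \<in> rels Lam" "sublist r (map Inl ps)" by blast
    have set: "set r \<subseteq> range Inl" using set_mono_sublist[OF r(2)] by auto
    have ne: "r \<noteq> []" using L.rels_length[OF r(1)] by auto
    show "\<exists>z\<in>rels B. sublist z ps"
      using r set ne by (cases rule: rels_Lam_cases) (auto simp: sublist_map_inj neq_Nil_conv)
  qed (auto intro: rels_Lam_intros map_mono_sublist)
  then show ?thesis by (auto simp: L.basis_paths_iff B.basis_paths_iff)
qed

lemma B_path_increasing: "(u, xs) \<in> paths (quiver B) \<Longrightarrow> u \<le> ptarget (quiver B) (u, xs) \<and> (xs \<noteq> [] \<longrightarrow> u < ptarget (quiver B) (u, xs))"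
proof (induction xs arbitrary: u)
  case (Cons b xs)
  then have "b \<in> arcs (quiver B)" "u = tail (quiver B) b" "(head (quiver B) b, xs) \<in> paths (quiver B)"
    by (auto simp: B.paths_Cons)
  with Cons.IH[of "head (quiver B) b"] B_increasing[of b] show ?case by auto
qed simp

lemma C_path_decreasing: "(u, xs) \<in> paths (quiver C) \<Longrightarrow> ptarget (quiver C) (u, xs) \<le> u \<and> (xs \<noteq> [] \<longrightarrow> ptarget (quiver C) (u, xs) < u)"
proof (induction xs arbitrary: u)
  case (Cons b xs)
  then have "b \<in> arcs (quiver C)" "u = tail (quiver C) b" "(head (quiver C) b, xs) \<in> paths (quiver C)"
    by (auto simp: C.paths_Cons)
  with Cons.IH[of "head (quiver C) b"] C_decreasing[of b] show ?case by auto
qed simp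

text \<open>The path must end above its source while its C part only descends, so its B part is not
  empty. The first arrow matters: it is the one that meets a preceding arrow of C.\<close>

lemma parallel_Inl_normal_form:
  assumes "(Inl b, (u, ws)) \<in> parallel_pairs Lam"
  obtains b' ps qs where "ws = map Inl (b' # ps) @ map Inr qs"
proof -
  have b: "b \<in> arcs (quiver B)" "(u, ws) \<in> basis_paths Lam" "u = tail (quiver B) b"
    "ptarget (quiver Lam) (u, ws) = head (quiver B) b"
    using assms by (auto simp: parallel_pairs_def)
  obtain ps qs where ws: "ws = map Inl ps @ map Inr qs"
    "(u, ps) \<in> paths (quiver B)" "(ptarget (quiver B) (u, ps), qs) \<in> paths (quiver C)"
    using basis_normal_form[OF b(2)] by blast
  have "ps \<noteq> []"
    using C_path_decreasing[OF ws(3)] b B_increasing[OF b(1)] ws(1) by auto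
  with ws(1) that show thesis by (cases ps) auto
qed

text \<open>An arrow of C goes down, a path of B never does.\<close>

lemma parallel_Inr_not_pure:
  assumes "(Inr c, (u, ws)) \<in> parallel_pairs Lam"
  shows "\<not> list_all isl ws"
proof
  assume pure: "list_all isl ws"
  have c: "c \<in> arcs (quiver C)" "(u, ws) \<in> basis_paths Lam" "u = tail (quiver C) c"
    "ptarget (quiver Lam) (u, ws) = head (quiver C) c"
    using assms by (auto simp: parallel_pairs_def)
  obtain ps qs where ws: "ws = map Inl ps @ map Inr qs" "(u, ps) \<in> paths (quiver B)"
    using basis_normal_form[OF c(2)] by blast
  with pure have "ws = map Inl ps" by (cases qs) auto
  then show False using B_path_increasing[OF ws(2)] c C_decreasing[OF c(1)] by auto
qed

text \<open>To return to its source a nontrivial path has to rise in B and fall in C, so it has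
  arrows of both kinds.\<close>

lemma cycle_mixed:
  assumes "(u, ws) \<in> basis_paths Lam" "ptarget (quiver Lam) (u, ws) = u" "ws \<noteq> []"
  shows "2 \<le> length ws \<and> \<not> list_all isl ws"
proof -
  obtain ps qs where ws: "ws = map Inl ps @ map Inr qs"
    "(u, ps) \<in> paths (quiver B)" "(ptarget (quiver B) (u, ps), qs) \<in> paths (quiver C)"
    using basis_normal_form[OF assms(1)] by blast
  have t: "ptarget (quiver C) (ptarget (quiver B) (u, ps), qs) = u" using assms(2) ws(1) by simp
  have "ps \<noteq> []" "qs \<noteq> []"
    using B_path_increasing[OF ws(2)] C_path_decreasing[OF ws(3)] t assms(3) ws(1) by auto
  then show ?thesis using ws(1) by (cases ps; cases qs) auto
qed

end

section \<open>Restriction to the arrows of B\<close>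

lemma replace_arrow_no_occurrence: "a \<notin> set (snd q) \<Longrightarrow> replace_arrow q a p = 0"
  unfolding replace_arrow_def by (rule sum.neutral) auto

lemma replacement_no_occurrence:
  assumes "f \<in> supported S" "\<And>a p. (a, p) \<in> S \<Longrightarrow> a \<notin> set (snd q)"
  shows "replacement f (Poly_Mapping.single q 1) = 0"
proof (rule supported_linear_eqI[of "\<lambda>f. replacement f (Poly_Mapping.single q 1)" "\<lambda>f. 0", OF _ _ assms(1)])
  fix z assume "z \<in> S"
  then show "replacement (Poly_Mapping.single z 1) (Poly_Mapping.single q 1) = 0"
    using assms(2) by (cases z) (simp add: replace_arrow_no_occurrence)
qed (rule pm_linear_replacement_left pm_linear_const_zero)+

text \<open>Trivial paths count as pure, so that the idempotents survive restriction.\<close>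

definition pure_path :: "('v, 'b + 'c) path \<Rightarrow> bool" where
  "pure_path p \<longleftrightarrow> list_all isl (snd p)"

definition project_path :: "('v, 'b + 'c) path \<Rightarrow> ('v, 'b) path" where
  "project_path p = (fst p, map projl (snd p))"

definition include_path :: "('v, 'b) path \<Rightarrow> ('v, 'b + 'c) path" where
  "include_path p = (fst p, map Inl (snd p))"

lemma map_Inl_projl: "list_all isl ws \<Longrightarrow> map (\<lambda>a. Inl (projl a)) ws = ws"
  by (induction ws) (auto simp: isl_def)

lemma pure_path_iff: "pure_path p \<and> project_path p = q \<longleftrightarrow> p = include_path q"
  by (cases p; cases q)
    (auto simp: pure_path_def project_path_def include_path_def map_Inl_projl o_def list_all_iff)

lemma pure_include_path [simp]: "pure_path (include_path q)" "project_path (include_path q) = q"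
  using pure_path_iff by metis+

definition restrict_paths :: "(('v, 'b + 'c) path \<Rightarrow>\<^sub>0 'k::field) \<Rightarrow> (('v, 'b) path \<Rightarrow>\<^sub>0 'k)" where
  "restrict_paths = linear_extension (\<lambda>p. if pure_path p then Poly_Mapping.single (project_path p) 1 else 0)"

lemma pm_linear_restrict_paths: "pm_linear restrict_paths"
  unfolding restrict_paths_def by (rule pm_linear_linear_extension)

lemmas restrict_paths_linear = pm_linear_restrict_paths[THEN pm_linear_add]
  pm_linear_restrict_paths[THEN pm_linear_diff] pm_linear_restrict_paths[THEN pm_linear_sum]
  pm_linear_restrict_paths[THEN pm_linear_zero] pm_linear_restrict_paths[THEN pm_linear_uminus]

lemma restrict_paths_single [simp]: "restrict_paths (Poly_Mapping.single p 1)
  = (if pure_path p then Poly_Mapping.single (project_path p) 1 else 0)"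
  by (simp add: restrict_paths_def)

lemma lookup_restrict_paths: "Poly_Mapping.lookup (restrict_paths x) p = Poly_Mapping.lookup x (include_path p)"
  unfolding restrict_paths_def lookup_linear_extension_partial pure_path_iff by (simp add: in_keys_iff)

definition restrict_pairs ::
  "(('b + 'c) \<times> ('v, 'b + 'c) path \<Rightarrow>\<^sub>0 'k::field) \<Rightarrow> ('b \<times> ('v, 'b) path \<Rightarrow>\<^sub>0 'k)" where
  "restrict_pairs = linear_extension (\<lambda>z. if isl (fst z) \<and> pure_path (snd z)
     then Poly_Mapping.single (projl (fst z), project_path (snd z)) 1 else 0)"

lemma pm_linear_restrict_pairs: "pm_linear restrict_pairs"
  unfolding restrict_pairs_def by (rule pm_linear_linear_extension)

lemmas restrict_pairs_linear = pm_linear_restrict_pairs[THEN pm_linear_add]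
  pm_linear_restrict_pairs[THEN pm_linear_scale] pm_linear_restrict_pairs[THEN pm_linear_diff]
  pm_linear_restrict_pairs[THEN pm_linear_zero]

lemma lookup_restrict_pairs:
  fixes f :: "('b + 'c) \<times> ('v, 'b + 'c) path \<Rightarrow>\<^sub>0 'k::field"
  shows
  "Poly_Mapping.lookup (restrict_pairs f) (b, p) = Poly_Mapping.lookup f (Inl b, include_path p)"
proof -
  have "(isl (fst z) \<and> pure_path (snd z)) \<and> (projl (fst z), project_path (snd z)) = (b, p)
      \<longleftrightarrow> z = (Inl b, include_path p)" for z :: "('b + 'c) \<times> ('v, 'b + 'c) path"
    using pure_path_iff[of "snd z" p] by (cases z; cases "fst z") auto
  then show ?thesis
    unfolding restrict_pairs_def lookup_linear_extension_partial by (simp only:) (simp add: in_keys_iff)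
qed

lemma value_at_restrict_pairs: "value_at (restrict_pairs f) b = restrict_paths (value_at f (Inl b))"
  by (rule poly_mapping_eqI) (simp add: lookup_value_at lookup_restrict_pairs lookup_restrict_paths)

definition include_pairs ::
  "('b \<times> ('v, 'b) path \<Rightarrow>\<^sub>0 'k::field) \<Rightarrow> (('b + 'c) \<times> ('v, 'b + 'c) path \<Rightarrow>\<^sub>0 'k)" where
  "include_pairs = linear_extension (\<lambda>z. Poly_Mapping.single (Inl (fst z), include_path (snd z)) 1)"

lemma restrict_include_pairs: "restrict_pairs (include_pairs f) = f"
  by (rule pm_linear_eqI[of "\<lambda>f. restrict_pairs (include_pairs f)" "\<lambda>f. f"])
    (auto simp: restrict_pairs_def include_pairs_def intro!: pm_linear_intros)

lemma replace_arrow_include: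
  "replace_arrow (include_path q) (Inl b) (include_path p)
    = linear_extension (\<lambda>p. Poly_Mapping.single (include_path p) 1) (replace_arrow q b p)"
  unfolding replace_arrow_def pm_linear_sum[OF pm_linear_linear_extension] linear_extension_single
  by (intro sum.cong) (auto simp: include_path_def psource_def take_map drop_map)

lemma restrict_include_paths:
  "restrict_paths (linear_extension (\<lambda>p. Poly_Mapping.single (include_path p) 1) x) = x"
  by (rule pm_linear_eqI[of "\<lambda>x. restrict_paths (linear_extension (\<lambda>p. Poly_Mapping.single (include_path p) 1) x)" "\<lambda>x. x"])
    (auto simp: restrict_paths_def intro!: pm_linear_intros)

text \<open>The new path contains all of \<open>p\<close> and all of \<open>q\<close> except one
  occurrence of \<open>a\<close>. If \<open>a\<close> is an arrow of B, removing it leaves every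
  arrow of C in \<open>q\<close>.\<close>

lemma restrict_replace_arrow_impure:
  assumes "\<not> pure_path p \<or> isl a \<and> \<not> pure_path q"
  shows "restrict_paths (replace_arrow q a p) = 0"
  unfolding replace_arrow_def restrict_paths_linear restrict_paths_single
proof (rule sum.neutral, safe)
  fix i assume i: "i < length (snd q)" "a = snd q ! i"
  let ?w = "take i (snd q) @ snd p @ drop (Suc i) (snd q)"
  have "snd q = take i (snd q) @ snd q ! i # drop (Suc i) (snd q)" using i(1) by (rule id_take_nth_drop)
  then have "pure_path q \<longleftrightarrow> list_all isl (take i (snd q)) \<and> isl (snd q ! i) \<and> list_all isl (drop (Suc i) (snd q))"
    unfolding pure_path_def by (metis list_all_append list.pred_inject(2))
  then have "\<not> pure_path (psource q, ?w)"
    using assms i(2) by (auto simp: pure_path_def)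
  then show "(if pure_path (psource q, ?w) then Poly_Mapping.single (project_path (psource q, ?w)) 1 else 0) = 0"
    by simp
qed

section \<open>Restriction of kernels, brackets and products\<close>

context dual_ext begin

lemma supported_pairs_restrict:
  assumes "f \<in> supported (parallel_pairs Lam)"
  shows "restrict_pairs f \<in> supported (parallel_pairs B)"
  unfolding supported_iff
proof (intro allI impI)
  fix z :: "'b \<times> ('v, 'b) path" assume z: "z \<notin> parallel_pairs B"
  obtain b u ps where zb: "z = (b, (u, ps))" by (cases z) auto
  have "(Inl b, include_path (u, ps)) \<notin> parallel_pairs Lam"
    using z zb by (auto simp: parallel_pairs_def include_path_def)
  then have "Poly_Mapping.lookup f (Inl b, include_path (u, ps)) = 0"
    using assms unfolding supported_iff by blast
  then show "Poly_Mapping.lookup (restrict_pairs f) z = 0" by (simp add: zb lookup_restrict_pairs)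
qed

lemma supported_pairs_include:
  assumes "f \<in> supported (parallel_pairs B)"
  shows "include_pairs f \<in> supported {(a, p) \<in> parallel_pairs Lam. isl a}"
  unfolding include_pairs_def using assms
  by (rule supported_linear_extension) (auto simp: parallel_pairs_def include_path_def intro!: supported_single)

text \<open>An impure path could only become pure when its single arrow of \<open>C\<close> is replaced by a path
  of arrows of \<open>B\<close>; but these two go in opposite directions, so they are never parallel.\<close>

lemma restrict_replacement:
  fixes f :: "('b + 'c) \<times> ('v, 'b + 'c) path \<Rightarrow>\<^sub>0 'k::field"
  assumes f: "f \<in> supported (parallel_pairs Lam)"
  shows "restrict_paths (replacement f x) = replacement (restrict_pairs f) (restrict_paths x)"
proof (rule pm_bilinear_eqI[of "\<lambda>f x. restrict_paths (replacement f x)"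
      "\<lambda>f x. replacement (restrict_pairs f) (restrict_paths x)"])
  fix z q assume "z \<in> Poly_Mapping.keys f" "q \<in> Poly_Mapping.keys x"
  obtain a p where z: "z = (a, p)" "(a, p) \<in> parallel_pairs Lam"
    using f \<open>z \<in> Poly_Mapping.keys f\<close> by (cases z) (auto simp: supported_def)
  have "restrict_paths (replace_arrow q a p)
    = (if isl a \<and> pure_path p \<and> pure_path q then replace_arrow (project_path q) (projl a) (project_path p)
       else (0 :: ('v, 'b) path \<Rightarrow>\<^sub>0 'k))"
  proof (cases "isl a \<and> pure_path p \<and> pure_path q")
    case True
    then obtain b where b: "a = Inl b" by (auto simp: isl_def)
    have "p = include_path (project_path p)" "q = include_path (project_path q)"
      using True pure_path_iff by blast+
    then have "(replace_arrow q a p :: _ \<Rightarrow>\<^sub>0 'k)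
      = linear_extension (\<lambda>p. Poly_Mapping.single (include_path p) 1) (replace_arrow (project_path q) b (project_path p))"
      unfolding b by (metis replace_arrow_include)
    then show ?thesis using True b by (simp add: restrict_include_paths)
  next
    case False
    show ?thesis
    proof (cases "pure_path p \<and> (isl a \<longrightarrow> pure_path q)")
      case True
      then show ?thesis
        using False parallel_Inr_not_pure[of _ "fst p" "snd p"] z(2)
        by (cases a) (auto simp: pure_path_def)
    next
      case False
      then show ?thesis using restrict_replace_arrow_impure[of p a q] by auto
    qed
  qed
  then show "restrict_paths (replacement (Poly_Mapping.single z 1) (Poly_Mapping.single q 1))
      = (replacement (restrict_pairs (Poly_Mapping.single z 1)) (restrict_paths (Poly_Mapping.single q 1)) :: ('v, 'b) path \<Rightarrow>\<^sub>0 'k)"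
    by (auto simp: z(1) restrict_pairs_def replacement_linear)
qed (auto intro!: pm_linear_compose[OF pm_linear_restrict_paths pm_linear_replacement_left]
    pm_linear_compose[OF pm_linear_restrict_paths pm_linear_replacement_right]
    pm_linear_compose[OF pm_linear_replacement_left pm_linear_restrict_pairs]
    pm_linear_compose[OF pm_linear_replacement_right pm_linear_restrict_paths])

lemma include_path_basis: "include_path p \<in> basis_paths Lam \<longleftrightarrow> p \<in> basis_paths B"
  by (cases p) (simp add: include_path_def)

lemma restrict_nf: "restrict_paths (nf Lam x) = nf B (restrict_paths x)"
  by (rule poly_mapping_eqI) (simp add: lookup_restrict_paths lookup_nf include_path_basis)

text \<open>A concatenation is pure exactly if both factors are, and projecting a pure path does not
  change its ends.\<close>

lemma restrict_pmul:
  "restrict_paths (pmul (quiver Lam) x y) = pmul (quiver B) (restrict_paths x) (restrict_paths y)"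
proof (rule pm_bilinear_eqI[of "\<lambda>x y. restrict_paths (pmul (quiver Lam) x y)"
      "\<lambda>x y. pmul (quiver B) (restrict_paths x) (restrict_paths y)"])
  fix p q :: "('v, 'b + 'c) path"
  have "ptarget (quiver Lam) q = ptarget (quiver B) (project_path q)" if "pure_path q"
    using that map_Inl_projl[of "snd q"] ptarget_Inl[of "fst q" "map projl (snd q)"]
    by (simp add: pure_path_def project_path_def o_def del: ptarget_Inl)
  then show "restrict_paths (pmul (quiver Lam) (Poly_Mapping.single p 1) (Poly_Mapping.single q 1))
      = pmul (quiver B) (restrict_paths (Poly_Mapping.single p 1)) (restrict_paths (Poly_Mapping.single q 1))"
    by (auto simp: path_mult_def pmul_linear restrict_paths_linear)
      (auto simp: pure_path_def project_path_def psource_def)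
qed (auto intro!: pm_linear_compose[OF pm_linear_restrict_paths pm_linear_pmul_left]
    pm_linear_compose[OF pm_linear_restrict_paths pm_linear_pmul_right]
    pm_linear_compose[OF pm_linear_pmul_left pm_linear_restrict_paths]
    pm_linear_compose[OF pm_linear_pmul_right pm_linear_restrict_paths])

lemma rel_path_Inl: "z \<in> rels B \<Longrightarrow> rel_path Lam (map Inl z) = include_path (rel_path B z)"
  using B.rels_length[of z] by (cases z) (auto simp: rel_path_def include_path_def)

lemma restrict_ker:
  assumes "f \<in> ker_delta1 Lam"
  shows "restrict_pairs f \<in> ker_delta1 B"
proof -
  have f: "f \<in> supported (parallel_pairs Lam)" using assms by (simp add: L.ker_delta1_iff)
  have "nf B (replacement (restrict_pairs f) (Poly_Mapping.single (rel_path B z) 1)) = 0" if z: "z \<in> rels B" for z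
  proof -
    have "nf Lam (replacement f (Poly_Mapping.single (include_path (rel_path B z)) 1)) = 0"
      using assms rels_Lam_intros(1)[OF z] rel_path_Inl[OF z] by (auto simp: L.ker_delta1_iff)
    then have "restrict_paths (nf Lam (replacement f (Poly_Mapping.single (include_path (rel_path B z)) 1))) = 0"
      by (simp add: restrict_paths_linear)
    then show ?thesis by (simp add: restrict_nf restrict_replacement[OF f])
  qed
  then show ?thesis using supported_pairs_restrict[OF f] by (simp add: B.ker_delta1_iff)
qed

lemma restrict_bracket:
  assumes "f \<in> supported (parallel_pairs Lam)" "g \<in> supported (parallel_pairs Lam)"
  shows "restrict_pairs (parallel_bracket Lam f g) = parallel_bracket B (restrict_pairs f) (restrict_pairs g)"
proof (rule value_at_eqI)
  fix b
  show "value_at (restrict_pairs (parallel_bracket Lam f g)) b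
      = value_at (parallel_bracket B (restrict_pairs f) (restrict_pairs g)) b"
    by (simp add: value_at_restrict_pairs value_at_parallel_bracket restrict_paths_linear restrict_nf
        restrict_replacement assms)
qed

lemma lie_hom_restrict: "lie_hom (ker_lie Lam) (ker_lie B) restrict_pairs"
  by (auto simp: lie_hom_def restrict_ker restrict_pairs_linear restrict_bracket L.ker_delta1_iff)

lemma rel_path_mixed: "rel_path Lam [Inr c, Inl b] = (tail (quiver C) c, [Inr c, Inl b])"
  by (simp add: rel_path_def)

text \<open>A path parallel to b starts with an arrow b' of B having the source of b. After the
  substitution c is followed by b', which is again a mixed relation.\<close>

lemma mixed_relation_zero:
  assumes f: "f \<in> supported {(a, p) \<in> parallel_pairs Lam. isl a}" and r: "[Inr c, Inl b] \<in> rels Lam"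
  shows "nf Lam (replacement f (Poly_Mapping.single (rel_path Lam [Inr c, Inl b]) 1)) = 0"
proof (rule supported_linear_eqI[of "\<lambda>f. nf Lam (replacement f (Poly_Mapping.single (rel_path Lam [Inr c, Inl b]) 1))"
      "\<lambda>f. 0", OF _ _ f])
  fix z assume "z \<in> {(a, p) \<in> parallel_pairs Lam. isl a}"
  then obtain b0 u ws where z: "z = (Inl b0, (u, ws))" "(Inl b0, (u, ws)) \<in> parallel_pairs Lam"
    by (cases z) (auto simp: isl_def)
  show "nf Lam (replacement (Poly_Mapping.single z 1) (Poly_Mapping.single (rel_path Lam [Inr c, Inl b]) 1)) = 0"
  proof (cases "b0 = b")
    case True
    obtain b' ps qs where ws: "ws = map Inl (b' # ps) @ map Inr qs" using parallel_Inl_normal_form[OF z(2)] by blast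
    have bc: "b \<in> arcs (quiver B)" "c \<in> arcs (quiver C)" "head (quiver C) c = tail (quiver B) b"
      using r by (auto elim: rels_Lam_cases)
    have uw: "(u, ws) \<in> paths (quiver Lam)" "u = tail (quiver B) b"
      using z(2) True basis_paths_subset[of Lam] by (auto simp: parallel_pairs_def)
    then have "[Inr c, Inl b'] \<in> rels Lam"
      using bc by (intro rels_Lam_intros) (auto simp: ws L.paths_Cons)
    moreover have "sublist [Inr c, Inl b'] (Inr c # ws)"
      using sublist_append_rightI[of "[Inr c, Inl b']" "map Inl ps @ map Inr qs"] by (simp add: ws)
    ultimately have "(tail (quiver C) c, Inr c # ws) \<notin> basis_paths Lam" by (auto simp: L.basis_paths_iff)
    \<comment> \<open>Lists follow the order of traversal, so b stands in position 1, after
      c.\<close>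
    moreover have "{i. i < length [Inr c, Inl b] \<and> [Inr c, Inl b] ! i = Inl b} = {1}"
      by (auto simp: less_Suc_eq)
    ultimately show ?thesis using True by (simp add: z(1) rel_path_mixed replace_arrow_def)
  next
    case False
    then show ?thesis by (simp add: z(1) rel_path_mixed replace_arrow_no_occurrence nf_linear)
  qed
qed (rule pm_linear_compose[OF pm_linear_nf pm_linear_replacement_left] pm_linear_const_zero)+

text \<open>For elements living on arrows of B only the relations of B are conditions: relations of
  C contain no arrow to replace, and mixed relations stay mixed.\<close>

lemma ker_delta1_Inl_iff:
  assumes f: "f \<in> supported {(a, p) \<in> parallel_pairs Lam. isl a}"
  shows "f \<in> ker_delta1 Lam \<longleftrightarrow>
    (\<forall>z\<in>rels B. nf Lam (replacement f (Poly_Mapping.single (rel_path Lam (map Inl z)) 1)) = 0)"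
proof
  assume "f \<in> ker_delta1 Lam"
  then show "\<forall>z\<in>rels B. nf Lam (replacement f (Poly_Mapping.single (rel_path Lam (map Inl z)) 1)) = 0"
    using rels_Lam_intros(1) by (auto simp: L.ker_delta1_iff)
next
  assume B: "\<forall>z\<in>rels B. nf Lam (replacement f (Poly_Mapping.single (rel_path Lam (map Inl z)) 1)) = 0"
  have "nf Lam (replacement f (Poly_Mapping.single (rel_path Lam r) 1)) = 0" if r: "r \<in> rels Lam" for r
    using r
  proof (cases rule: rels_Lam_cases)
    case (Inl z)
    then show ?thesis using B by simp
  next
    case (Inr z)
    then have "replacement f (Poly_Mapping.single (rel_path Lam r) 1) = 0"
      by (intro replacement_no_occurrence[OF f]) (auto simp: rel_path_def isl_def)
    then show ?thesis by (simp add: nf_linear)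
  next
    case (mixed b c)
    then show ?thesis using mixed_relation_zero[OF f, of c b] r by simp
  qed
  moreover have "f \<in> supported (parallel_pairs Lam)" using f by (rule supported_mono[rotated]) auto
  ultimately show "f \<in> ker_delta1 Lam" by (simp add: L.ker_delta1_iff)
qed

text \<open>Gives a right inverse of restriction on kernels, hence its surjectivity. Inclusion
  commutes with substitution and with reduction, so the conditions for relations of B carry
  over.\<close>

lemma include_ker:
  fixes f :: "'b \<times> ('v, 'b) path \<Rightarrow>\<^sub>0 'k::field"
  assumes "f \<in> ker_delta1 B"
  shows "include_pairs f \<in> ker_delta1 Lam"
proof -
  let ?i = "linear_extension (\<lambda>p. Poly_Mapping.single (include_path p) 1)
    :: (('v, 'b) path \<Rightarrow>\<^sub>0 'k) \<Rightarrow> (('v, 'b + 'c) path \<Rightarrow>\<^sub>0 'k)"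
  have f: "f \<in> supported (parallel_pairs B)" using assms by (simp add: B.ker_delta1_iff)
  have "replacement (include_pairs f) (Poly_Mapping.single (include_path q) 1)
      = ?i (replacement f (Poly_Mapping.single q 1))" for q
  proof (rule pm_linear_eqI[of "\<lambda>f. replacement (include_pairs f) (Poly_Mapping.single (include_path q) 1)"
        "\<lambda>f. ?i (replacement f (Poly_Mapping.single q 1))"])
    show "pm_linear (\<lambda>f. replacement (include_pairs f) (Poly_Mapping.single (include_path q) 1))"
      unfolding include_pairs_def by (intro pm_linear_compose[OF pm_linear_replacement_left] pm_linear_linear_extension)
    show "pm_linear (\<lambda>f. ?i (replacement f (Poly_Mapping.single q 1)))"
      by (intro pm_linear_compose[OF pm_linear_linear_extension] pm_linear_replacement_left)
    fix z :: "'b \<times> ('v, 'b) path"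
    show "replacement (include_pairs (Poly_Mapping.single z 1)) (Poly_Mapping.single (include_path q) 1)
      = ?i (replacement (Poly_Mapping.single z 1) (Poly_Mapping.single q 1))"
      by (cases z) (simp add: include_pairs_def replace_arrow_include)
  qed
  moreover have "nf Lam (?i x) = ?i (nf B x)" for x
  proof (rule pm_linear_eqI[of "\<lambda>x. nf Lam (?i x)" "\<lambda>x. ?i (nf B x)"])
    show "pm_linear (\<lambda>x. nf Lam (?i x))" "pm_linear (\<lambda>x. ?i (nf B x))"
      by (intro pm_linear_compose[OF pm_linear_nf] pm_linear_compose[OF pm_linear_linear_extension]
          pm_linear_linear_extension pm_linear_nf)+
  qed (auto simp: include_path_basis)
  ultimately have "nf Lam (replacement (include_pairs f) (Poly_Mapping.single (rel_path Lam (map Inl z)) 1)) = 0"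
    if "z \<in> rels B" for z
    using assms that by (simp add: rel_path_Inl B.ker_delta1_iff)
  then show ?thesis by (simp add: ker_delta1_Inl_iff[OF supported_pairs_include[OF f]])
qed

text \<open>Makes J the kernel of restriction. The point is that the parts of \<open>x\<close> on
  arrows of B and on arrows of C each lie in Ker(\<delta>1) by themselves.\<close>

lemma J_lie_eq: "(J_lie Lam :: ('k::field, _) lie_struct) = (ker_lie Lam)\<lparr>carrier := {f \<in> ker_delta1 Lam. restrict_pairs f = 0}\<rparr>"
proof -
  have "{f + g |f g. f \<in> J_mixed Lam \<and> g \<in> ker_delta1_off_B Lam} = {f \<in> ker_delta1 Lam. restrict_pairs f = (0 :: _ \<Rightarrow>\<^sub>0 'k)}"
  proof safe
    fix f g :: "('b + 'c) \<times> ('v, 'b + 'c) path \<Rightarrow>\<^sub>0 'k"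
    assume fg: "f \<in> J_mixed Lam" "g \<in> ker_delta1_off_B Lam"
    then show "f + g \<in> ker_delta1 Lam"
      by (auto simp: J_mixed_def ker_delta1_off_B_def L.ker_delta1_closed)
    have "restrict_pairs f = 0"
    proof (rule poly_mapping_eqI)
      fix z :: "'b \<times> ('v, 'b) path"
      obtain b p where z: "z = (b, p)" by (cases z)
      have mixed: "include_path p \<notin> mixed_paths Lam"
      proof
        assume "include_path p \<in> mixed_paths Lam"
        then obtain ps qs where "map Inl (snd p) = map Inl ps @ map (Inr :: 'c \<Rightarrow> 'b + 'c) qs" "qs \<noteq> []"
          by (auto simp: mixed_paths_def include_path_def)
        then show False by (cases qs) (auto simp: map_eq_append_conv)
      qed
      have "f \<in> supported {(a, p). p \<in> mixed_paths Lam}"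
        using fg(1) by (auto simp: J_mixed_def parallel_space_def supported_def)
      then show "Poly_Mapping.lookup (restrict_pairs f) z = Poly_Mapping.lookup 0 z"
        using mixed unfolding z lookup_restrict_pairs supported_iff lookup_zero by blast
    qed
    moreover have "restrict_pairs g = 0"
    proof (rule poly_mapping_eqI)
      fix z :: "'b \<times> ('v, 'b) path"
      obtain b p where z: "z = (b, p)" by (cases z)
      have "g \<in> supported {(a, p). \<not> isl a}"
        using fg(2) by (auto simp: ker_delta1_off_B_def supported_def)
      then show "Poly_Mapping.lookup (restrict_pairs g) z = Poly_Mapping.lookup 0 z"
        unfolding z lookup_restrict_pairs supported_iff lookup_zero
        by (elim allE[of _ "(Inl b, include_path p)"]) simp
    qed
    ultimately show "restrict_pairs (f + g) = 0" by (simp add: restrict_pairs_linear)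
  next
    fix x :: "('b + 'c) \<times> ('v, 'b + 'c) path \<Rightarrow>\<^sub>0 'k"
    assume x: "x \<in> ker_delta1 Lam" "restrict_pairs x = 0"
    have x_par: "x \<in> supported (parallel_pairs Lam)" using x(1) by (simp add: L.ker_delta1_iff)
    define f where "f = linear_extension (\<lambda>z. if isl (fst z) then Poly_Mapping.single z 1 else 0) x"
    define g where "g = x - f"
    have f_lookup: "Poly_Mapping.lookup f z = (if isl (fst z) then Poly_Mapping.lookup x z else 0)" for z
    proof -
      have "(isl (fst w) \<and> w = z) = (w = z \<and> isl (fst z))" for w by auto
      then show ?thesis unfolding f_def lookup_linear_extension_partial by (simp add: in_keys_iff)
    qed
    have f_par: "f \<in> supported {(a, p) \<in> parallel_pairs Lam. isl a}"
      using x_par by (auto simp: supported_iff f_lookup)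
    have g_off: "g \<in> supported {(a, p). \<not> isl a}"
      by (auto simp: supported_iff g_def lookup_minus f_lookup)
    have "nf Lam (replacement f (Poly_Mapping.single (rel_path Lam (map Inl z)) 1)) = 0" if z: "z \<in> rels B" for z
    proof -
      have "nf Lam (replacement x (Poly_Mapping.single (rel_path Lam (map Inl z)) 1)) = 0"
        using x(1) rels_Lam_intros(1)[OF z] by (simp add: L.ker_delta1_iff)
      \<comment> \<open>No relation of B contains an arrow of C, so here \<open>x\<close> acts
        through \<open>f\<close> alone.\<close>
      moreover have "replacement g (Poly_Mapping.single (rel_path Lam (map Inl z)) 1) = 0"
        by (rule replacement_no_occurrence[OF g_off]) (auto simp: rel_path_def)
      moreover have "x = f + g" by (simp add: g_def)
      ultimately show ?thesis by (simp add: replacement_linear)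
    qed
    then have f_ker: "f \<in> ker_delta1 Lam" by (simp add: ker_delta1_Inl_iff[OF f_par])
    then have g_ker: "g \<in> ker_delta1 Lam"
      unfolding g_def using L.ker_delta1_closed(2)[OF x(1) L.ker_delta1_closed(3)[of f "- 1"]]
      by (simp add: pm_scale_uminus_one)
    have "f \<in> J_mixed Lam"
    proof -
      have "z \<in> {(a, p). a \<in> {a \<in> arcs (quiver Lam). isl a} \<and> p \<in> mixed_paths Lam
          \<and> psource p = tail (quiver Lam) a \<and> ptarget (quiver Lam) p = head (quiver Lam) a}"
        if z: "z \<in> Poly_Mapping.keys f" for z
      proof -
        obtain b u ws where zb: "z = (Inl b, (u, ws))" "(Inl b, (u, ws)) \<in> parallel_pairs Lam"
          using f_par z by (cases z) (auto simp: supported_def isl_def)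
        obtain b' ps qs where ws: "ws = map Inl (b' # ps) @ map Inr qs"
          using parallel_Inl_normal_form[OF zb(2)] by blast
        \<comment> \<open>Were the path pure, its coefficient would appear in the restriction of
          \<open>x\<close>, which is 0.\<close>
        have "qs \<noteq> []"
        proof
          assume "qs = []"
          then have "Poly_Mapping.lookup (restrict_pairs x) (b, (u, b' # ps)) = Poly_Mapping.lookup f z"
            by (simp add: lookup_restrict_pairs include_path_def f_lookup zb(1) ws)
          then show False using z x(2) by (simp add: in_keys_iff)
        qed
        then have "(u, ws) \<in> mixed_paths Lam"
          using zb(2) ws unfolding mixed_paths_def parallel_pairs_def by blast
        then show ?thesis using zb by (auto simp: parallel_pairs_def)
      qed
      then show ?thesis using f_ker unfolding J_mixed_def parallel_space_def by blast
    qed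
    moreover have "g \<in> ker_delta1_off_B Lam"
      using g_ker g_off by (auto simp: ker_delta1_off_B_def supported_def)
    moreover have "x = f + g" by (simp add: g_def)
    ultimately show "\<exists>f g. x = f + g \<and> f \<in> J_mixed Lam \<and> g \<in> ker_delta1_off_B Lam" by blast
  qed
  then show ?thesis by (simp add: J_lie_def ker_lie_def)
qed

end

section \<open>Restriction of cycles and of the image of \<delta>0\<close>

definition restrict_vertices ::
  "('v \<times> ('v, 'b + 'c) path \<Rightarrow>\<^sub>0 'k::field) \<Rightarrow> ('v \<times> ('v, 'b) path \<Rightarrow>\<^sub>0 'k)" where
  "restrict_vertices = linear_extension (\<lambda>z. if pure_path (snd z)
     then Poly_Mapping.single (fst z, project_path (snd z)) 1 else 0)"

definition include_vertices ::
  "('v \<times> ('v, 'b) path \<Rightarrow>\<^sub>0 'k::field) \<Rightarrow> ('v \<times> ('v, 'b + 'c) path \<Rightarrow>\<^sub>0 'k)" where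
  "include_vertices = linear_extension (\<lambda>z. Poly_Mapping.single (fst z, include_path (snd z)) 1)"

lemma restrict_include_vertices: "restrict_vertices (include_vertices y) = y"
  by (rule pm_linear_eqI[of "\<lambda>y. restrict_vertices (include_vertices y)" "\<lambda>y. y"])
    (auto simp: restrict_vertices_def include_vertices_def intro!: pm_linear_intros)

lemma restrict_forget_vertex: "restrict_paths (forget_vertex y) = forget_vertex (restrict_vertices y)"
proof (rule pm_linear_eqI[of "\<lambda>y. restrict_paths (forget_vertex y)" "\<lambda>y. forget_vertex (restrict_vertices y)"])
  show "pm_linear (\<lambda>y. restrict_paths (forget_vertex y))"
    by (rule pm_linear_compose[OF pm_linear_restrict_paths pm_linear_forget_vertex])
  show "pm_linear (\<lambda>y. forget_vertex (restrict_vertices y))"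
    unfolding restrict_vertices_def by (rule pm_linear_compose[OF pm_linear_forget_vertex pm_linear_linear_extension])
qed (simp add: forget_vertex_def restrict_vertices_def)

context dual_ext begin

lemma supported_cycle_pairs_restrict:
  assumes "y \<in> supported (cycle_pairs Lam)"
  shows "restrict_vertices y \<in> supported (cycle_pairs B)"
  unfolding restrict_vertices_def
proof (rule supported_linear_extension[OF assms])
  fix z assume z: "z \<in> cycle_pairs Lam"
  show "(if pure_path (snd z) then Poly_Mapping.single (fst z, project_path (snd z)) 1 else 0) \<in> supported (cycle_pairs B)"
  proof (cases "pure_path (snd z)")
    case True
    then have "snd z = include_path (project_path (snd z))" using pure_path_iff by blast
    then obtain v u ps where zv: "z = (v, include_path (u, ps))" by (metis prod.collapse)
    moreover from this have "(v, (u, ps)) \<in> cycle_pairs B"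
      using z by (auto simp: cycle_pairs_def include_path_def)
    ultimately show ?thesis by (simp add: supported_single)
  qed (simp add: supported_closed)
qed

lemma supported_cycle_pairs_include:
  assumes "y \<in> supported (cycle_pairs B)"
  shows "include_vertices y \<in> supported (cycle_pairs Lam)"
  unfolding include_vertices_def using assms
  by (rule supported_linear_extension) (auto simp: cycle_pairs_def include_path_def intro!: supported_single)

lemma restrict_bmul: "restrict_paths (L.bmul x y) = B.bmul (restrict_paths x) (restrict_paths y)"
  by (simp add: L.bmul_def B.bmul_def restrict_nf restrict_pmul)

lemma restrict_delta0:
  assumes y: "y \<in> supported (cycle_pairs Lam)"
  shows "restrict_pairs (delta0 Lam y) = delta0 B (restrict_vertices y)"
proof (rule value_at_eqI)
  fix b
  show "value_at (restrict_pairs (delta0 Lam y)) b = value_at (delta0 B (restrict_vertices y)) b"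
    by (simp add: value_at_restrict_pairs L.value_at_delta0[OF y] restrict_bmul restrict_paths_linear
        B.value_at_delta0[OF supported_cycle_pairs_restrict[OF y]] restrict_forget_vertex
        pure_path_def project_path_def)
qed

lemma im_delta0_eq: "im_delta0 P = delta0 P ` supported (cycle_pairs P)"
  by (simp add: im_delta0_def vertex_parallel_eq)

lemma restrict_im_delta0: "f \<in> im_delta0 Lam \<Longrightarrow> restrict_pairs f \<in> im_delta0 B"
  by (auto simp: im_delta0_eq restrict_delta0 supported_cycle_pairs_restrict)

text \<open>A nontrivial cycle is mixed, so only the trivial paths contribute to the part
  of degree one of \<open>\<delta>\<^sup>0\<close>.\<close>

lemma value_at_delta0_linear_part:
  fixes y :: "'v \<times> ('v, 'b + 'c) path \<Rightarrow>\<^sub>0 'k::field"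
  assumes y: "y \<in> supported (cycle_pairs Lam)" and a: "a \<in> arcs (quiver Lam)"
  defines "c \<equiv> \<lambda>v. Poly_Mapping.lookup y (v, (v, []))"
  shows "value_at (delta0 Lam y) a - pm_scale (c (tail (quiver Lam) a) - c (head (quiver Lam) a)) (L.arrow a)
    \<in> supported {p. 2 \<le> length (snd p) \<and> \<not> pure_path p}"
  unfolding c_def
proof (rule supported_linear_mem[OF _ y])
  let ?c = "\<lambda>y v. Poly_Mapping.lookup y (v, (v, []))"
  show "pm_linear (\<lambda>y :: 'v \<times> ('v, 'b + 'c) path \<Rightarrow>\<^sub>0 'k. value_at (delta0 Lam y) a
      - pm_scale (?c y (tail (quiver Lam) a) - ?c y (head (quiver Lam) a)) (L.arrow a))"
  proof (rule pm_linear_minus)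
    show "pm_linear (\<lambda>y :: 'v \<times> ('v, 'b + 'c) path \<Rightarrow>\<^sub>0 'k. value_at (delta0 Lam y) a)"
      by (rule pm_linear_compose[OF pm_linear_value_at pm_linear_delta0])
  qed (rule pm_linearI; simp add: lookup_add pm_scale_add_left[symmetric] algebra_simps)
  fix z assume z: "z \<in> cycle_pairs Lam"
  then obtain v ws where zv: "z = (v, (v, ws))" "(v, ws) \<in> basis_paths Lam" "ptarget (quiver Lam) (v, ws) = v"
    "v \<in> verts (quiver B)"
    by (auto simp: cycle_pairs_def psource_def)
  have forget: "forget_vertex (Poly_Mapping.single z (1 :: 'k)) = Poly_Mapping.single (v, ws) 1"
    by (simp add: forget_vertex_def zv(1))
  have eq: "value_at (delta0 Lam (Poly_Mapping.single z (1 :: 'k))) a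
      = L.bmul (L.arrow a) (Poly_Mapping.single (v, ws) 1) - L.bmul (Poly_Mapping.single (v, ws) 1) (L.arrow a)"
    using L.value_at_delta0[OF supported_single[OF z], of "1 :: 'k" a] a by (simp add: forget)
  show "value_at (delta0 Lam (Poly_Mapping.single z (1 :: 'k))) a
      - pm_scale (?c (Poly_Mapping.single z (1 :: 'k)) (tail (quiver Lam) a) - ?c (Poly_Mapping.single z (1 :: 'k)) (head (quiver Lam) a))
          (L.arrow a) \<in> supported {p. 2 \<le> length (snd p) \<and> \<not> pure_path p}"
  proof (cases "ws = []")
    case True
    \<comment> \<open>A trivial cycle at v contributes a if v is the source of a, and -a if v is its
      target.\<close>
    have "value_at (delta0 Lam (Poly_Mapping.single z (1 :: 'k))) a = pm_scale (?c (Poly_Mapping.single z (1 :: 'k)) (tail (quiver Lam) a)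
        - ?c (Poly_Mapping.single z (1 :: 'k)) (head (quiver Lam) a)) (L.arrow a)"
      unfolding eq using a L.arrow_basis_paths[OF a]
      by (auto simp: True zv(1) lookup_single when_def L.bmul_def path_mult_def nf_linear pm_scale_uminus_one)
    then show ?thesis by (simp add: supported_closed)
  next
    case False
    have mixed: "2 \<le> length ws" "\<not> list_all isl ws"
      using cycle_mixed[OF zv(2,3) False] by simp_all
    \<comment> \<open>Each product, unless zero, contains the whole mixed cycle, so it is long and
      impure.\<close>
    have "L.bmul (L.arrow a) (Poly_Mapping.single (v, ws) (1 :: 'k)) \<in> supported {p. 2 \<le> length (snd p) \<and> \<not> pure_path p}"
      "L.bmul (Poly_Mapping.single (v, ws) (1 :: 'k)) (L.arrow a) \<in> supported {p. 2 \<le> length (snd p) \<and> \<not> pure_path p}"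
      using mixed by (auto simp: L.bmul_def path_mult_def nf_linear pure_path_def supported_closed intro!: supported_single)
    then show ?thesis
      unfolding eq using a False by (simp add: zv(1) lookup_single when_def supported_closed)
  qed
qed

text \<open>Both sides turn into conditions on the coefficients \<open>c\<close> of the trivial
  cycles: equal values at the two ends of every arrow of B on the left, of every arrow of \<Lambda>
  on the right. The component hypothesis bridges the two.\<close>

lemma delta0_restrict_zero_iff:
  assumes y: "y \<in> supported (cycle_pairs Lam)"
  shows "restrict_pairs (delta0 Lam y) = 0
    \<longleftrightarrow> (\<forall>(a, p)\<in>Poly_Mapping.keys (delta0 Lam y). 2 \<le> length (snd p))"
proof -
  \<comment> \<open>Terms in \<open>?T\<close> are invisible to both sides: impure, so restriction
    kills them, and long, so the degree condition allows them.\<close>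
  let ?T = "{p :: ('v, 'b + 'c) path. 2 \<le> length (snd p) \<and> \<not> pure_path p}"
  define c where "c v = Poly_Mapping.lookup y (v, (v, []))" for v
  have val: "Poly_Mapping.lookup (delta0 Lam y) (a, p)
      = (if p = (tail (quiver Lam) a, [a]) then c (tail (quiver Lam) a) - c (head (quiver Lam) a) else 0)"
    if a: "a \<in> arcs (quiver Lam)" and p: "p \<notin> ?T" for a p
  proof -
    have "Poly_Mapping.lookup (value_at (delta0 Lam y) a - pm_scale (c (tail (quiver Lam) a) - c (head (quiver Lam) a)) (L.arrow a)) p = 0"
      using value_at_delta0_linear_part[OF y a] p unfolding supported_iff c_def by blast
    then show ?thesis by (auto simp: lookup_minus lookup_value_at lookup_single when_def split: if_splits)
  qed
  have no_arc: "Poly_Mapping.lookup (delta0 Lam y) (a, p) = 0" if "a \<notin> arcs (quiver Lam)" for a p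
    using L.value_at_delta0[OF y, of a] that by (simp flip: lookup_value_at)
  have short: "(tail (quiver Lam) a, [a]) \<notin> ?T" for a by simp
  have restrict: "restrict_pairs (delta0 Lam y) = 0 \<longleftrightarrow> (\<forall>b\<in>arcs (quiver B). c (tail (quiver B) b) = c (head (quiver B) b))"
  proof
    assume zero: "restrict_pairs (delta0 Lam y) = 0"
    show "\<forall>b\<in>arcs (quiver B). c (tail (quiver B) b) = c (head (quiver B) b)"
    proof
      fix b assume b: "b \<in> arcs (quiver B)"
      have "Poly_Mapping.lookup (restrict_pairs (delta0 Lam y)) (b, (tail (quiver B) b, [b]))
        = c (tail (quiver B) b) - c (head (quiver B) b)"
        unfolding lookup_restrict_pairs include_path_def using val[OF _ short[of "Inl b"]] b by simp
      then show "c (tail (quiver B) b) = c (head (quiver B) b)" using zero by simp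
    qed
  next
    assume const: "\<forall>b\<in>arcs (quiver B). c (tail (quiver B) b) = c (head (quiver B) b)"
    show "restrict_pairs (delta0 Lam y) = 0"
    proof (rule poly_mapping_eqI)
      fix z :: "'b \<times> ('v, 'b) path"
      obtain b p where z: "z = (b, p)" by (cases z)
      have "include_path p \<notin> ?T" by simp
      then show "Poly_Mapping.lookup (restrict_pairs (delta0 Lam y)) z = Poly_Mapping.lookup 0 z"
        using const val[of "Inl b" "include_path p"] no_arc[of "Inl b" "include_path p"]
        by (cases "b \<in> arcs (quiver B)") (auto simp: z lookup_restrict_pairs)
    qed
  qed
  have degree: "(\<forall>(a, p)\<in>Poly_Mapping.keys (delta0 Lam y). 2 \<le> length (snd p))
      \<longleftrightarrow> (\<forall>a\<in>arcs (quiver Lam). c (tail (quiver Lam) a) = c (head (quiver Lam) a))"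
  proof
    assume deg: "\<forall>(a, p)\<in>Poly_Mapping.keys (delta0 Lam y). 2 \<le> length (snd p)"
    show "\<forall>a\<in>arcs (quiver Lam). c (tail (quiver Lam) a) = c (head (quiver Lam) a)"
    proof
      fix a assume a: "a \<in> arcs (quiver Lam)"
      have "(a, (tail (quiver Lam) a, [a])) \<notin> Poly_Mapping.keys (delta0 Lam y)" using deg by fastforce
      then show "c (tail (quiver Lam) a) = c (head (quiver Lam) a)"
        using val[OF a short] by (simp add: in_keys_iff)
    qed
  next
    assume const: "\<forall>a\<in>arcs (quiver Lam). c (tail (quiver Lam) a) = c (head (quiver Lam) a)"
    show "\<forall>(a, p)\<in>Poly_Mapping.keys (delta0 Lam y). 2 \<le> length (snd p)"
    proof clarify
      fix a u ws assume key: "(a, (u, ws)) \<in> Poly_Mapping.keys (delta0 Lam y)"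
      then have a: "a \<in> arcs (quiver Lam)" using no_arc by (auto simp: in_keys_iff)
      have "(u, ws) \<in> ?T"
      proof (rule ccontr)
        assume "(u, ws) \<notin> ?T"
        then have "Poly_Mapping.lookup (delta0 Lam y) (a, (u, ws)) = 0" using val[OF a] const a by simp
        then show False using key by (simp add: in_keys_iff)
      qed
      then show "2 \<le> length (snd (u, ws))" by simp
    qed
  qed
  \<comment> \<open>Follow a zigzag of arrows of B from one end of d to the other.\<close>
  have C_const: "c (tail (quiver C) d) = c (head (quiver C) d)"
    if const: "\<forall>b\<in>arcs (quiver B). c (tail (quiver B) b) = c (head (quiver B) b)" and d: "d \<in> arcs (quiver C)" for d
    using C_within[OF d]
    by (induction rule: rtrancl_induct) (use const in \<open>auto simp: arcs_ends_conv\<close>)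
  show ?thesis
    unfolding restrict degree by (simp add: arcs_Lam ball_Un) (use C_const in blast)
qed

text \<open>So I is the intersection of J with the image of \<delta>0, exactly the part of J that
  dies in cohomology.\<close>

lemma I_ideal_eq: "I_ideal Lam = {f \<in> im_delta0 Lam. restrict_pairs f = 0}"
  unfolding I_ideal_def
  using delta0_restrict_zero_iff unfolding im_delta0_eq by blast

theorem dual_extension_exact:
  "lie_algebra (J_lie Lam :: ('k::field, _) lie_struct)
   \<and> lie_ideal (I_ideal Lam) (J_lie Lam :: ('k, _) lie_struct)
   \<and> (\<exists>\<phi> \<psi>. lie_short_exact (lie_quotient (J_lie Lam :: ('k, _) lie_struct) (I_ideal Lam)) \<phi>
       (HH1 (presented_algebra Lam)) \<psi> (HH1 (presented_algebra B)))"
proof -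
  let ?H = "HH1 (presented_algebra Lam :: ('k, _) module)"
  let ?N = "HH1 (presented_algebra B :: ('k, _) module)"
  let ?K = "ker_lie Lam :: ('k, _) lie_struct"
  let ?S = "{f \<in> ker_delta1 Lam. restrict_pairs f = 0} :: (('b + 'c) \<times> ('v, 'b + 'c) path \<Rightarrow>\<^sub>0 'k) set"
  obtain h where H: "lie_algebra ?H" and h: "lie_hom ?K ?H h" "h ` ker_delta1 Lam = carrier ?H"
    "\<And>f. f \<in> ker_delta1 Lam \<Longrightarrow> h f = lzero ?H \<longleftrightarrow> f \<in> im_delta0 Lam"
    using L.HH1_combinatorial by blast
  obtain g where N: "lie_algebra ?N" and g: "lie_hom (ker_lie B) ?N g" "g ` ker_delta1 B = carrier ?N"
    "\<And>f. f \<in> ker_delta1 B \<Longrightarrow> g f = lzero ?N \<longleftrightarrow> f \<in> im_delta0 B"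
    using B.HH1_combinatorial by blast
  interpret K: lie_algebra ?K by (rule L.lie_algebra_ker_lie)
  interpret H: lie_algebra ?H by (rule H)
  have S_pairs: "f \<in> supported (parallel_pairs Lam)" if "f \<in> ker_delta1 Lam" for f :: "('b + 'c) \<times> ('v, 'b + 'c) path \<Rightarrow>\<^sub>0 'k"
    using that by (simp add: L.ker_delta1_iff)
  have S_bracket: "parallel_bracket Lam x y \<in> ?S" if "x \<in> ?S" "y \<in> ?S" for x y
  proof -
    have "parallel_bracket B (0 :: 'b \<times> ('v, 'b) path \<Rightarrow>\<^sub>0 'k) 0 = 0" by (simp add: parallel_bracket_def)
    then show ?thesis using that S_pairs by (simp add: L.derivation_of_bracket restrict_bracket)
  qed
  have J: "lie_algebra (?K\<lparr>carrier := ?S\<rparr>)"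
  proof (rule K.sub_lie_algebra)
    show "lbracket ?K x y \<in> ?S" if "x \<in> ?S" "y \<in> ?S" for x y
      using S_bracket[OF that] by simp
  qed (auto simp: L.ker_delta1_closed restrict_pairs_linear)
  \<comment> \<open>Being the kernel of \<open>h\<close> on J, I inherits the closure properties of
    an ideal.\<close>
  have I_iff: "f \<in> I_ideal Lam \<longleftrightarrow> f \<in> ?S \<and> h f = lzero ?H" for f
    using h(3) L.im_delta0_subset by (auto simp: I_ideal_eq)
  have hom: "h (f + f') = ladd ?H (h f) (h f')" "h (pm_scale c f) = lscale ?H c (h f)"
    "h (parallel_bracket Lam f f') = lbracket ?H (h f) (h f')" "h f \<in> carrier ?H"
    if "f \<in> ker_delta1 Lam" "f' \<in> ker_delta1 Lam" for f f' c
    using h(1) that by (auto simp: lie_hom_def)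
  have H_zero: "lscale ?H c (lzero ?H) = lzero ?H" "u \<in> carrier ?H \<Longrightarrow> lbracket ?H u (lzero ?H) = lzero ?H" for c u
    using H.scale_scale[OF H.zero_closed, of c 0] H.bracket_scale_right[OF _ H.zero_closed, of u 0]
    by (simp_all add: H.scale_zero_left H.zero_closed H.bracket_closed)
  have I: "lie_ideal (I_ideal Lam) (?K\<lparr>carrier := ?S\<rparr>)"
    unfolding lie_ideal_def
  proof (intro conjI ballI allI)
    show "I_ideal Lam \<subseteq> carrier (?K\<lparr>carrier := ?S\<rparr>)" by (auto simp: I_iff)
    have "h 0 = lzero ?H" using K.lie_hom_zero[OF H h(1)] by simp
    then show "lzero (?K\<lparr>carrier := ?S\<rparr>) \<in> I_ideal Lam"
      by (simp add: I_iff L.ker_delta1_closed restrict_pairs_linear)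
    fix x :: "('b + 'c) \<times> ('v, 'b + 'c) path \<Rightarrow>\<^sub>0 'k"
    show "lscale (?K\<lparr>carrier := ?S\<rparr>) c x \<in> I_ideal Lam" if "x \<in> I_ideal Lam" for c
      using that hom(2)[OF _ L.ker_delta1_closed(1), of x c] by (simp add: I_iff L.ker_delta1_closed restrict_pairs_linear H_zero)
    fix y :: "('b + 'c) \<times> ('v, 'b + 'c) path \<Rightarrow>\<^sub>0 'k"
    assume y: "y \<in> I_ideal Lam"
    show "ladd (?K\<lparr>carrier := ?S\<rparr>) x y \<in> I_ideal Lam" if "x \<in> I_ideal Lam"
      using that y by (simp add: I_iff L.ker_delta1_closed restrict_pairs_linear hom H.add_zero H.zero_closed)
    show "lbracket (?K\<lparr>carrier := ?S\<rparr>) x y \<in> I_ideal Lam" if "x \<in> carrier (?K\<lparr>carrier := ?S\<rparr>)"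
      using that y S_bracket[of x y] H_zero(2)[OF hom(4)[of x x]] by (simp add: I_iff hom)
  qed
  have "\<exists>\<phi> \<psi>. lie_short_exact (lie_quotient (?K\<lparr>carrier := ?S\<rparr>) (I_ideal Lam)) \<phi> ?H \<psi> ?N"
  proof (rule lie_short_exactI[OF K.lie_algebra_axioms H N h(1), where g = "\<lambda>f. g (restrict_pairs f)"])
    show "h ` carrier ?K = carrier ?H" using h(2) by simp
    show "lie_hom ?K ?N (\<lambda>f. g (restrict_pairs f))" by (rule lie_hom_compose[OF lie_hom_restrict g(1)])
    show "(\<lambda>f. g (restrict_pairs f)) ` carrier ?K = carrier ?N"
    proof -
      have "f \<in> restrict_pairs ` ker_delta1 Lam" if "f \<in> ker_delta1 B" for f :: "'b \<times> ('v, 'b) path \<Rightarrow>\<^sub>0 'k"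
        using that by (intro image_eqI[OF _ include_ker]) (simp_all add: restrict_include_pairs)
      then have "restrict_pairs ` ker_delta1 Lam = (ker_delta1 B :: ('b \<times> ('v, 'b) path \<Rightarrow>\<^sub>0 'k) set)"
        by (auto simp: restrict_ker)
      then show ?thesis using g(2) by (metis image_image ker_lie_simps(1))
    qed
    show "?S \<subseteq> carrier ?K" by auto
    show "lie_algebra (?K\<lparr>carrier := ?S\<rparr>)" by (rule J)
    show "lie_ideal (I_ideal Lam) (?K\<lparr>carrier := ?S\<rparr>)" by (rule I)
    fix x :: "('b + 'c) \<times> ('v, 'b + 'c) path \<Rightarrow>\<^sub>0 'k"
    show "h x = lzero ?H \<longleftrightarrow> x \<in> I_ideal Lam" if "x \<in> ?S" using that by (simp add: I_iff)
    assume "x \<in> carrier ?K"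
    then have x: "x \<in> ker_delta1 Lam" by simp
    show "g (restrict_pairs x) = lzero ?N" if "h x = lzero ?H"
      using that x h(3) g(3) restrict_im_delta0 restrict_ker by blast
    show "g (restrict_pairs x) = lzero ?N \<longleftrightarrow> (\<exists>j\<in>?S. h x = h j)"
    proof
      assume "g (restrict_pairs x) = lzero ?N"
      then obtain y where y: "y \<in> supported (cycle_pairs B)" "restrict_pairs x = delta0 B y"
        using g(3)[OF restrict_ker[OF x]] by (auto simp: im_delta0_eq)
      \<comment> \<open>Lift the coboundary of B to \<Lambda>. Subtracting it leaves the class of x
        unchanged and moves x into J.\<close>
      let ?d = "delta0 Lam (include_vertices y)"
      have d: "?d \<in> im_delta0 Lam" "?d \<in> ker_delta1 Lam" "restrict_pairs ?d = restrict_pairs x"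
        using y supported_cycle_pairs_include[OF y(1)]
        by (auto simp: im_delta0_eq L.derivation_of_delta0 restrict_delta0 restrict_include_vertices)
      have j: "x - ?d \<in> ker_delta1 Lam"
        using L.ker_delta1_closed(2)[OF x L.ker_delta1_closed(3)[OF d(2), of "- 1"]] by (simp add: pm_scale_uminus_one)
      have "h x = ladd ?H (h (x - ?d)) (h ?d)" using hom(1)[OF j d(2)] by simp
      also have "h ?d = lzero ?H" using h(3) d by blast
      finally have "h x = h (x - ?d)" using hom(4)[OF j j] by (simp add: H.add_zero_right)
      then show "\<exists>j\<in>?S. h x = h j" using j d(3) by (intro bexI[of _ "x - ?d"]) (simp_all add: restrict_pairs_linear)
    next
      assume "\<exists>j\<in>?S. h x = h j"
      then obtain j where j: "j \<in> ?S" "h x = h j" by blast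
      \<comment> \<open>Conversely x - j is a coboundary of \<Lambda>; it restricts to a coboundary
        of B, and j restricts to 0.\<close>
      then have "h (x - j) = lzero ?H"
        using K.lie_hom_diff_zero_iff[OF H h(1), of x j] x by (simp add: pm_scale_uminus_one)
      moreover have "x - j \<in> ker_delta1 Lam"
        using L.ker_delta1_closed(2)[OF x L.ker_delta1_closed(3)[of j "- 1"]] j by (simp add: pm_scale_uminus_one)
      ultimately have "restrict_pairs (x - j) \<in> im_delta0 B" using h(3) restrict_im_delta0 by blast
      then have "restrict_pairs x \<in> im_delta0 B" using j by (simp add: restrict_pairs_linear)
      then show "g (restrict_pairs x) = lzero ?N" using g(3) restrict_ker x by blast
    qed
  qed
  with J I show ?thesis by (simp add: J_lie_eq)
qed

end

theorem theorem5p8: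
  fixes A :: "('v::linorder, 'a) path_presentation"
    and B :: "('v, 'b) path_presentation"
  assumes "directed_monomial A" and "directed_monomial B"
    and "verts (quiver A) = verts (quiver B)"
    and "arrows_within_components A B"
  shows "let \<Lambda> = dual_extension B (op_presentation A);
             J = (J_lie \<Lambda> :: ('k::alg_closed_field, _) lie_struct);
             I = I_ideal \<Lambda>
         in lie_algebra J \<and> lie_ideal I J
            \<and> (\<exists>\<phi> \<psi>. lie_short_exact
                  (lie_quotient J I) \<phi>
                  (HH1 (presented_algebra \<Lambda>)) \<psi>
                  (HH1 (presented_algebra B)))"
proof -
  let ?R = "arcs_ends (quiver B) \<union> (arcs_ends (quiver B))\<inverse>"
  \<comment> \<open>Passing to the opposite swaps the ends of each arrow of \<open>A\<close>, so the
    component condition is needed for the reversed pair.\<close>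
  have "sym ?R" by (auto simp: sym_def)
  then have sym: "(v, w) \<in> ?R\<^sup>* \<Longrightarrow> (w, v) \<in> ?R\<^sup>*" for v w using sym_rtrancl symD by metis
  interpret dual_ext B "op_presentation A"
    by unfold_locales
      (use assms sym in \<open>auto simp: directed_monomial_def monomial_opposite arrows_within_components_def\<close>)
  show ?thesis unfolding Let_def by (rule dual_extension_exact)
qed

end
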